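(* There exists an algorithm that, for any directed graph $G=(V,E)$ on $n$ vertices and $m$ edges with a designated source vertex $s\in V$, and any integers $\lambda,k\geq 1$, computes in $O(\lambda 2^k mn)$ time a $(\lambda,k)$-FT-BFP for $G$ with at most $\lambda 2^k n$ edges.
   Context: All edges have unit capacity; $\textsc{max-flow}(s,t,G)$ denotes the value of a maximum $s$-$t$ flow in $G$ (equivalently the maximum number of pairwise edge-disjoint $s$-to-$t$ paths). For $F\subseteq E$, $G\setminus F$ is $G$ with the edges of $F$ deleted. Given a directed graph $G=(V,E)$ with designated source $s$, a $(\lambda,k)$-Fault-Tolerant Bounded-Flow-Preserver ($(\lambda,k)$-FT-BFP) of $G$ is a subgraph $H=(V,E_H)$ with $E_H\subseteq E$ such that for every $F\subseteq E$ with $|F|\leq k$ and every $t\in V$: if $\textsc{max-flow}(s,t,G\setminus F)\leq\lambda$ then $\textsc{max-flow}(s,t,H\setminus F)=\textsc{max-flow}(s,t,G\setminus F)$, and otherwise $\textsc{max-flow}(s,t,H\setminus F)\geq\lambda$. *)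

theory Defs
  imports Complex_Main "Graph_Theory.Digraph_Component"
begin

definition is_flow :: "('a,'b) pre_digraph \<Rightarrow> 'a \<Rightarrow> 'a \<Rightarrow> ('b \<Rightarrow> real) \<Rightarrow> bool" where
  "is_flow G s t f \<longleftrightarrow>
     (\<forall>e\<in>arcs G. 0 \<le> f e \<and> f e \<le> 1) \<and>
     (\<forall>v\<in>verts G - {s, t}. (\<Sum>e\<in>in_arcs G v. f e) = (\<Sum>e\<in>out_arcs G v. f e))"

definition flow_value :: "('a,'b) pre_digraph \<Rightarrow> 'a \<Rightarrow> ('b \<Rightarrow> real) \<Rightarrow> real" where
  "flow_value G s f = (\<Sum>e\<in>out_arcs G s. f e) - (\<Sum>e\<in>in_arcs G s. f e)"

text \<open>In a finite digraph the set below is non-empty and bounded. For \<open>s = t\<close> conservation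
  at all other vertices forces the net outflow of \<open>s\<close>, and hence the maximum, to be \<open>0\<close>.\<close>

definition max_flow :: "('a,'b) pre_digraph \<Rightarrow> 'a \<Rightarrow> 'a \<Rightarrow> real" where
  "max_flow G s t = Sup {flow_value G s f | f. is_flow G s t f}"

definition del_arcs :: "('a,'b) pre_digraph \<Rightarrow> 'b set \<Rightarrow> ('a,'b) pre_digraph" where
  "del_arcs G F = G\<lparr>arcs := arcs G - F\<rparr>"

definition ft_bfp ::
  "nat \<Rightarrow> nat \<Rightarrow> ('a,'b) pre_digraph \<Rightarrow> 'a \<Rightarrow> ('a,'b) pre_digraph \<Rightarrow> bool" where
  "ft_bfp lam k G s H \<longleftrightarrow>
     spanning H G \<and>
     (\<forall>F. F \<subseteq> arcs G \<and> finite F \<and> card F \<le> k \<longrightarrow>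
       (\<forall>t\<in>verts G.
         if max_flow (del_arcs G F) s t \<le> real lam
         then max_flow (del_arcs H F) s t = max_flow (del_arcs G F) s t
         else max_flow (del_arcs H F) s t \<ge> real lam))"

text \<open>A program uses finitely many named registers and finitely many named arrays, all holding
  natural numbers. Every operation (constant, register read, array access, addition, truncated
  subtraction, comparison, connective, assignment, branch) takes one unit of time. There is
  deliberately no multiplication, shift or bitwise operation, so that large numbers cannot be
  used to hide work. A fixed program mentions only finitely many arrays, so they could be
  interleaved in a single memory at the cost of a constant factor.\<close>

datatype expr =
    Lit nat
  | Reg string
  | Elem string expr
  | Add expr expr
  | Sub expr expr

datatype test =
    Less expr expr
  | Equal expr expr
  | Negate test
  | Both test test

datatype prog =
    Skip
  | Assign string expr
  | Store string expr expr
  | Seq prog prog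
  | Branch test prog prog
  | Loop test prog

record mem =
  regs :: "string \<Rightarrow> nat"
  arrs :: "string \<Rightarrow> nat \<Rightarrow> nat"

fun expr_val :: "expr \<Rightarrow> mem \<Rightarrow> nat" where
  "expr_val (Lit c) \<sigma> = c"
| "expr_val (Reg x) \<sigma> = regs \<sigma> x"
| "expr_val (Elem a e) \<sigma> = arrs \<sigma> a (expr_val e \<sigma>)"
| "expr_val (Add e f) \<sigma> = expr_val e \<sigma> + expr_val f \<sigma>"
| "expr_val (Sub e f) \<sigma> = expr_val e \<sigma> - expr_val f \<sigma>"

fun expr_time :: "expr \<Rightarrow> nat" where
  "expr_time (Lit c) = 1"
| "expr_time (Reg x) = 1"
| "expr_time (Elem a e) = expr_time e + 1"
| "expr_time (Add e f) = expr_time e + expr_time f + 1"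
| "expr_time (Sub e f) = expr_time e + expr_time f + 1"

fun test_val :: "test \<Rightarrow> mem \<Rightarrow> bool" where
  "test_val (Less e f) \<sigma> \<longleftrightarrow> expr_val e \<sigma> < expr_val f \<sigma>"
| "test_val (Equal e f) \<sigma> \<longleftrightarrow> expr_val e \<sigma> = expr_val f \<sigma>"
| "test_val (Negate b) \<sigma> \<longleftrightarrow> \<not> test_val b \<sigma>"
| "test_val (Both b c) \<sigma> \<longleftrightarrow> test_val b \<sigma> \<and> test_val c \<sigma>"

fun test_time :: "test \<Rightarrow> nat" where
  "test_time (Less e f) = expr_time e + expr_time f + 1"
| "test_time (Equal e f) = expr_time e + expr_time f + 1"
| "test_time (Negate b) = test_time b + 1"
| "test_time (Both b c) = test_time b + test_time c + 1"

definition set_reg :: "string \<Rightarrow> nat \<Rightarrow> mem \<Rightarrow> mem" where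
  "set_reg x v \<sigma> = \<sigma>\<lparr>regs := (regs \<sigma>)(x := v)\<rparr>"

definition set_elem :: "string \<Rightarrow> nat \<Rightarrow> nat \<Rightarrow> mem \<Rightarrow> mem" where
  "set_elem a i v \<sigma> = \<sigma>\<lparr>arrs := (arrs \<sigma>)(a := (arrs \<sigma> a)(i := v))\<rparr>"

text \<open>\<open>run p \<sigma> T \<tau>\<close>: started in memory \<open>\<sigma>\<close>, program \<open>p\<close> halts after exactly \<open>T\<close> time units in
  memory \<open>\<tau>\<close>. A program that diverges has no run.\<close>

inductive run :: "prog \<Rightarrow> mem \<Rightarrow> nat \<Rightarrow> mem \<Rightarrow> bool" where
  skip: "run Skip \<sigma> 1 \<sigma>"
| assign: "run (Assign x e) \<sigma> (expr_time e + 1) (set_reg x (expr_val e \<sigma>) \<sigma>)"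
| store: "run (Store a i e) \<sigma> (expr_time i + expr_time e + 1)
            (set_elem a (expr_val i \<sigma>) (expr_val e \<sigma>) \<sigma>)"
| seq: "run p \<sigma> T\<^sub>1 \<rho> \<Longrightarrow> run q \<rho> T\<^sub>2 \<tau> \<Longrightarrow> run (Seq p q) \<sigma> (T\<^sub>1 + T\<^sub>2) \<tau>"
| branch_true: "test_val b \<sigma> \<Longrightarrow> run p \<sigma> T \<tau> \<Longrightarrow> run (Branch b p q) \<sigma> (test_time b + 1 + T) \<tau>"
| branch_false: "\<not> test_val b \<sigma> \<Longrightarrow> run q \<sigma> T \<tau> \<Longrightarrow> run (Branch b p q) \<sigma> (test_time b + 1 + T) \<tau>"
| loop_done: "\<not> test_val b \<sigma> \<Longrightarrow> run (Loop b p) \<sigma> (test_time b + 1) \<sigma>"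
| loop_step: "test_val b \<sigma> \<Longrightarrow> run p \<sigma> T\<^sub>1 \<rho> \<Longrightarrow> run (Loop b p) \<rho> T\<^sub>2 \<tau> \<Longrightarrow>
    run (Loop b p) \<sigma> (test_time b + 1 + T\<^sub>1 + T\<^sub>2) \<tau>"

inductive_cases run_SkipE: "run Skip \<sigma> T \<tau>"
  and run_AssignE: "run (Assign x e) \<sigma> T \<tau>"
  and run_StoreE: "run (Store a i e) \<sigma> T \<tau>"
  and run_SeqE: "run (Seq p q) \<sigma> T \<tau>"
  and run_BranchE: "run (Branch b p q) \<sigma> T \<tau>"
  and run_LoopE: "run (Loop b p) \<sigma> T \<tau>"

lemma run_deterministic:
  "run p \<sigma> T \<tau> \<Longrightarrow> run p \<sigma> T' \<tau>' \<Longrightarrow> T = T' \<and> \<tau> = \<tau>'"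
proof (induction arbitrary: T' \<tau>' rule: run.induct)
  case (skip \<sigma>)
  show ?case by (rule run_SkipE[OF skip]) simp
next
  case (assign x e \<sigma>)
  show ?case by (rule run_AssignE[OF assign]) simp
next
  case (store a i e \<sigma>)
  show ?case by (rule run_StoreE[OF store]) simp
next
  case (seq p \<sigma> T\<^sub>1 \<rho> q T\<^sub>2 \<tau>)
  obtain U\<^sub>1 \<rho>' U\<^sub>2 where *: "T' = U\<^sub>1 + U\<^sub>2" "run p \<sigma> U\<^sub>1 \<rho>'" "run q \<rho>' U\<^sub>2 \<tau>'"
    by (rule run_SeqE[OF seq.prems]) (rule that)
  from seq.IH(1)[OF *(2)] have "T\<^sub>1 = U\<^sub>1" "\<rho> = \<rho>'" by (rule conjunct1, rule conjunct2)
  moreover from this(2) *(3) have "run q \<rho> U\<^sub>2 \<tau>'" by (simp only:)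
  from seq.IH(2)[OF this] have "T\<^sub>2 = U\<^sub>2" "\<tau> = \<tau>'" by (rule conjunct1, rule conjunct2)
  ultimately show ?case using *(1) by (simp only: simp_thms)
next
  case (branch_true b \<sigma> p T \<tau> q)
  obtain U where *: "T' = test_time b + 1 + U" "run p \<sigma> U \<tau>'"
    by (rule run_BranchE[OF branch_true.prems]) (simp_all add: branch_true.hyps(1) that)
  show ?case unfolding *(1) using branch_true.IH[OF *(2)] by (simp only: simp_thms)
next
  case (branch_false b \<sigma> q T \<tau> p)
  obtain U where *: "T' = test_time b + 1 + U" "run q \<sigma> U \<tau>'"
    by (rule run_BranchE[OF branch_false.prems]) (simp_all add: branch_false.hyps(1) that)
  show ?case unfolding *(1) using branch_false.IH[OF *(2)] by (simp only: simp_thms)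
next
  case (loop_done b \<sigma> p)
  show ?case by (rule run_LoopE[OF loop_done.prems]) (simp_all add: loop_done.hyps)
next
  case (loop_step b \<sigma> p T\<^sub>1 \<rho> T\<^sub>2 \<tau>)
  obtain U\<^sub>1 \<rho>' U\<^sub>2 where *: "T' = test_time b + 1 + U\<^sub>1 + U\<^sub>2" "run p \<sigma> U\<^sub>1 \<rho>'"
      "run (Loop b p) \<rho>' U\<^sub>2 \<tau>'"
    by (rule run_LoopE[OF loop_step.prems]) (simp_all add: loop_step.hyps(1) that)
  from loop_step.IH(1)[OF *(2)] have "T\<^sub>1 = U\<^sub>1" "\<rho> = \<rho>'" by (rule conjunct1, rule conjunct2)
  moreover from this(2) *(3) have "run (Loop b p) \<rho> U\<^sub>2 \<tau>'" by (simp only:)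
  from loop_step.IH(2)[OF this] have "T\<^sub>2 = U\<^sub>2" "\<tau> = \<tau>'" by (rule conjunct1, rule conjunct2)
  ultimately show ?case using *(1) by (simp only: simp_thms)
qed

text \<open>A digraph on \<open>n\<close> vertices has vertex set \<open>{0, \<dots>, n - 1}\<close> and is presented by listing its
  arcs once each, in arbitrary order.\<close>

definition arc_list :: "nat \<Rightarrow> (nat \<times> nat) list \<Rightarrow> nat pair_pre_digraph \<Rightarrow> bool" where
  "arc_list n es G \<longleftrightarrow> pverts G = {..<n} \<and> distinct es \<and> set es = parcs G"

definition input_mem :: "nat \<Rightarrow> (nat \<times> nat) list \<Rightarrow> nat \<Rightarrow> nat \<Rightarrow> nat \<Rightarrow> mem" where
  "input_mem n es s lam k =
     \<lparr>regs = (\<lambda>_. 0)(''n'' := n, ''m'' := length es, ''s'' := s, ''lambda'' := lam, ''k'' := k),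
      arrs = (\<lambda>_ _. 0)(
        ''tail'' := (\<lambda>i. if i < length es then fst (es ! i) else 0),
        ''head'' := (\<lambda>i. if i < length es then snd (es ! i) else 0))\<rparr>"

definition output_arcs :: "mem \<Rightarrow> (nat \<times> nat) list" where
  "output_arcs \<sigma> =
     map (\<lambda>i. (arrs \<sigma> ''tail_out'' i, arrs \<sigma> ''head_out'' i)) [0..<regs \<sigma> ''m_out'']"

end

theory Submission
  imports Defs
begin

text \<open>
  For a single target \<open>t\<close>, add a source joined to \<open>s\<close> by an arc of capacity \<open>\<lambda>\<close>, so that all flows
  are capped at \<open>\<lambda>\<close>. Starting from unit capacities, repeat \<open>k\<close> times: compute a maximum flow and
  double the capacity of every arc, except those into \<open>t\<close>, whose tail lies on the source side of
  the minimum cut farthest from the source. The flow remains feasible and its value at most doubles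
  in each round, so a maximum flow in the last network uses at most \<open>\<lambda> 2\<^sup>k\<close> arcs into \<open>t\<close>;
  all other arcs into \<open>t\<close> are dropped.

  This is correct because of a dichotomy for a cut \<open>Y\<close>. If some farthest cut \<open>A\<close> of the chain has no
  arc from \<open>A \<inter> Y\<close> to \<open>Y - A\<close>, then \<open>A \<inter> Y\<close> is a cut of the old network which, under every set of
  failures, is at most as large as \<open>Y\<close> is in the new one. Otherwise uncrossing \<open>Y\<close> with the chain gains
  one unit per round, so \<open>Y\<close> exceeds the minimum cut by \<open>k\<close> and survives \<open>k\<close> failures. Uncrossing
  also shows that dropping arcs into \<open>t\<close> does no harm to other targets, so the targets can be
  processed one after the other. A target costs \<open>O(\<lambda> 2\<^sup>k)\<close> augmentations; targets without
  incident arcs are skipped, which keeps the total cost within \<open>O(\<lambda> 2\<^sup>k m n)\<close> even if there are more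
  vertices than arcs.
\<close>

section \<open>Doubling chains of farthest minimum cuts\<close>

text \<open>A round gains a unit because the chosen cut is the farthest minimum cut: a set reaching
  beyond it is strictly larger, and capacities are integers. A search backwards from the target
  delivers this cut: once the extra source is no longer reached, the vertices that can reach the
  target in the residual network form its complement. The \<open>k\<close> gained units pay for
  \<open>k\<close> failed arcs of capacity one, whence \<open>k\<close> rounds; each round may
  double the minimum cut, whence the factor \<open>2 ^ k\<close>. The flow is kept from round to
  round, so the augmentations of all rounds together are bounded by the final value.

  Only cuts are compared in the combinatorial argument. A flow is represented there by the statement
  that capacity and residual capacity of every separating cut differ by its value; real-valued flows
  enter only through the max-flow min-cut theorem, when the result is translated back to
  \<open>max_flow\<close>.\<close>

locale arc_system =
  fixes E :: "'e set" and tl hd :: "'e \<Rightarrow> 'v"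
  assumes finite_E: "finite E"
begin

definition crosses :: "'v set \<Rightarrow> 'e \<Rightarrow> bool" where
  "crosses X e \<longleftrightarrow> tl e \<in> X \<and> hd e \<notin> X"

definition cut :: "('e \<Rightarrow> nat) \<Rightarrow> 'v set \<Rightarrow> nat" where
  "cut w X = (\<Sum>e\<in>E. w e * of_bool (crosses X e))"

definition off :: "'e set \<Rightarrow> ('e \<Rightarrow> nat) \<Rightarrow> 'e \<Rightarrow> nat" where
  "off D w e = (if e \<in> D then 0 else w e)"

lemma cut_mono: "(\<And>e. e \<in> E \<Longrightarrow> crosses X e \<Longrightarrow> w e \<le> w' e) \<Longrightarrow> cut w X \<le> cut w' X"
  unfolding cut_def by (rule sum_mono) auto

lemma cut_cong: "(\<And>e. e \<in> E \<Longrightarrow> crosses X e \<Longrightarrow> w e = w' e) \<Longrightarrow> cut w X = cut w' X"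
  unfolding cut_def by (rule sum.cong) auto

lemma cut_off_le: "cut (off D w) X \<le> cut w X"
  by (rule cut_mono) (simp add: off_def)

lemma off_off: "off D (off F w) = off (D \<union> F) w"
  by (auto simp: off_def)

lemma cut_submodular: "cut w (X \<inter> Y) + cut w (X \<union> Y) \<le> cut w X + cut w Y"
  unfolding cut_def sum.distrib[symmetric]
  by (rule sum_mono) (auto simp: crosses_def)

text \<open>Charges failures to a cut. It is applied to the initial capacities, where a failing arc
  weighs at most one.\<close>

lemma cut_off_card:
  assumes "finite F" "\<And>e. e \<in> F \<Longrightarrow> w e \<le> 1"
  shows "cut w X \<le> cut (off F w) X + card F"
proof -
  have "cut w X = (\<Sum>e\<in>E. off F w e * of_bool (crosses X e)) + (\<Sum>e\<in>E. of_bool (e \<in> F) * (w e * of_bool (crosses X e)))"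
    unfolding cut_def sum.distrib[symmetric] by (rule sum.cong) (auto simp: off_def)
  also have "(\<Sum>e\<in>E. of_bool (e \<in> F) * (w e * of_bool (crosses X e))) \<le> (\<Sum>e\<in>E. of_bool (e \<in> F))"
    by (rule sum_mono) (use assms(2) in auto)
  also have "(\<Sum>e\<in>E. of_bool (e \<in> F)) = card (E \<inter> F)"
    using finite_E by (simp add: of_bool_def sum.If_cases Collect_mem_eq)
  also have "\<dots> \<le> card F" using assms(1) by (simp add: card_mono)
  finally show ?thesis by (simp add: cut_def)
qed

end

locale st_arc_system = arc_system E tl hd for E :: "'e set" and tl hd :: "'e \<Rightarrow> 'v" +
  fixes s t :: 'v
begin

definition separates :: "'v set \<Rightarrow> bool" where
  "separates X \<longleftrightarrow> s \<in> X \<and> t \<notin> X"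

lemma separates_Int: "separates X \<Longrightarrow> separates Y \<Longrightarrow> separates (X \<inter> Y)"
  and separates_Un: "separates X \<Longrightarrow> separates Y \<Longrightarrow> separates (X \<union> Y)"
  by (auto simp: separates_def)

text \<open>Such a set is the union of all minimum cuts. The strict inequality for sets not inside
  \<open>A\<close> is the form in which uncrossing uses it.\<close>

definition farthest_min_cut :: "('e \<Rightarrow> nat) \<Rightarrow> 'v set \<Rightarrow> bool" where
  "farthest_min_cut w A \<longleftrightarrow> separates A \<and>
     (\<forall>X. separates X \<longrightarrow> cut w A \<le> cut w X \<and> (\<not> X \<subseteq> A \<longrightarrow> cut w A < cut w X))"

definition doubled :: "('e \<Rightarrow> nat) \<Rightarrow> 'v set \<Rightarrow> 'e \<Rightarrow> nat" where
  "doubled w A e = (if tl e \<in> A \<and> hd e \<noteq> t then 2 * w e else w e)"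

lemma farthest_min_cutD:
  assumes "farthest_min_cut w A"
  shows "separates A" "separates X \<Longrightarrow> cut w A \<le> cut w X"
    "separates X \<Longrightarrow> \<not> X \<subseteq> A \<Longrightarrow> cut w A < cut w X"
  using assms by (auto simp: farthest_min_cut_def)

lemma cut_doubled_le: "cut (doubled w A) X \<le> 2 * cut w X"
  unfolding cut_def sum_distrib_left by (rule sum_mono) (simp add: doubled_def)

text \<open>Inside \<open>A\<close> the new cut value is twice the old one minus the capacity of the
  arcs into \<open>t\<close>, which stay undoubled. The subtracted part grows with the set, so
  \<open>A\<close> remains minimum among its subsets.\<close>

lemma cut_doubled_inside:
  assumes "separates X" "X \<subseteq> A" "separates A" "cut w A \<le> cut w X"
  shows "cut (doubled w A) A \<le> cut (doubled w A) X"
proof -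
  have eq: "cut (doubled w A) Y + (\<Sum>e\<in>E. w e * of_bool (tl e \<in> Y \<and> hd e = t)) = 2 * cut w Y"
    if "Y \<subseteq> A" "t \<notin> Y" for Y
    unfolding cut_def sum_distrib_left sum.distrib[symmetric] using that
    by (intro sum.cong) (auto simp: doubled_def crosses_def)
  have "(\<Sum>e\<in>E. w e * of_bool (tl e \<in> X \<and> hd e = t)) \<le> (\<Sum>e\<in>E. w e * of_bool (tl e \<in> A \<and> hd e = t))"
    using assms(2) by (intro sum_mono) auto
  with eq[of X] eq[of A] assms show ?thesis by (auto simp: separates_def)
qed

text \<open>Uncrossing in the doubled network: if \<open>A\<close> stuck out of \<open>A'\<close>,
  the union would be strictly larger than \<open>A'\<close> while the intersection is at least as
  large as \<open>A\<close>, against submodularity.\<close>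

lemma farthest_min_cut_doubled_mono:
  assumes "farthest_min_cut w A" "farthest_min_cut (doubled w A) A'"
  shows "A \<subseteq> A'"
proof (rule ccontr)
  let ?w = "doubled w A"
  note A = farthest_min_cutD[OF assms(1)] and A' = farthest_min_cutD[OF assms(2)]
  assume "\<not> A \<subseteq> A'"
  then have "cut ?w A' < cut ?w (A \<union> A')"
    using A(1) A'(1) by (intro A'(3)) (auto simp: separates_Un)
  moreover have "cut ?w A \<le> cut ?w (A \<inter> A')"
    using A(1) A'(1) by (intro cut_doubled_inside A(2)) (auto simp: separates_Int)
  ultimately show False using cut_submodular[of ?w A A'] by simp
qed

end

text \<open>\<open>D\<close> is the set of arcs into \<open>t\<close> that will be discarded.
  \<open>D_cut\<close> is the cut form of the existence of a maximum flow of the last network that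
  avoids \<open>D\<close>.\<close>

locale doubling_chain = st_arc_system E tl hd s t
  for E :: "'e set" and tl hd :: "'e \<Rightarrow> 'v" and s t :: 'v +
  fixes u :: "nat \<Rightarrow> 'e \<Rightarrow> nat" and A :: "nat \<Rightarrow> 'v set" and k :: nat and D :: "'e set"
  assumes farthest: "i \<le> k \<Longrightarrow> farthest_min_cut (u i) (A i)"
    and u_Suc: "i < k \<Longrightarrow> u (Suc i) = doubled (u i) (A i)"
    and D_head: "e \<in> D \<Longrightarrow> hd e = t"
    and D_cut: "separates X \<Longrightarrow> cut (u k) (A k) \<le> cut (off D (u k)) X"
begin

lemma separates_A: "i \<le> k \<Longrightarrow> separates (A i)"
  using farthest_min_cutD(1)[OF farthest] .

lemma A_mono: "i \<le> j \<Longrightarrow> j \<le> k \<Longrightarrow> A i \<subseteq> A j"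
proof (induction j rule: dec_induct)
  case (step j)
  then have "A j \<subseteq> A (Suc j)"
    using farthest_min_cut_doubled_mono[of "u j" "A j" "A (Suc j)"] farthest[of j] farthest[of "Suc j"]
      u_Suc[of j] by simp
  with step show ?case by auto
qed simp

lemma u_mono: "i \<le> k \<Longrightarrow> u 0 e \<le> u i e"
proof (induction i)
  case (Suc i)
  then show ?case using u_Suc[of i] by (simp add: doubled_def)
qed simp

lemma u_into_target: "i \<le> k \<Longrightarrow> hd e = t \<Longrightarrow> u i e = u 0 e"
  by (induction i) (simp_all add: u_Suc doubled_def)

text \<open>The cut \<^term>\<open>A k\<close> is saturated by a flow that avoids \<^term>\<open>D\<close>.\<close>

lemma D_from_last:
  assumes "e \<in> E" "e \<in> D" "tl e \<in> A k" "i \<le> k"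
  shows "u i e = 0"
proof (rule ccontr)
  assume "u i e \<noteq> 0"
  then have "u k e \<noteq> 0"
    using u_into_target[OF assms(4), of e] u_into_target[of k e] D_head[OF assms(2)] by simp
  have "hd e \<notin> A k" using separates_A[of k] D_head[OF assms(2)] by (simp add: separates_def)
  \<comment> \<open>An arc of \<open>D\<close> with positive capacity leaving \<open>A k\<close>
    would make deletion of \<open>D\<close> lower this very cut, against
    \<open>D_cut\<close>.\<close>
  have "cut (off D (u k)) (A k) < cut (u k) (A k)"
    unfolding cut_def
  proof (rule sum_strict_mono_ex1[OF finite_E])
    show "\<forall>e\<in>E. off D (u k) e * of_bool (crosses (A k) e) \<le> u k e * of_bool (crosses (A k) e)"
      by (simp add: off_def)
    show "\<exists>e\<in>E. off D (u k) e * of_bool (crosses (A k) e) < u k e * of_bool (crosses (A k) e)"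
      using assms \<open>u k e \<noteq> 0\<close> \<open>hd e \<notin> A k\<close> by (intro bexI[of _ e]) (auto simp: off_def crosses_def)
  qed
  with D_cut[OF separates_A[OF order_refl]] show False by linarith
qed

lemma cut_off_eq: "X \<subseteq> A k \<Longrightarrow> i \<le> k \<Longrightarrow> cut (off D (u i)) X = cut (u i) X"
  by (rule cut_cong) (auto simp: off_def crosses_def D_from_last)

text \<open>The witness stays inside \<open>Y\<close> while leaving \<open>A j\<close>. If
  \<open>t\<close> is not in \<open>Y\<close>, its capacity is doubled in round
  \<open>j\<close>.\<close>

definition leaves :: "nat \<Rightarrow> 'v set \<Rightarrow> bool" where
  "leaves j Y \<longleftrightarrow> (\<exists>e\<in>E. 0 < u j e \<and> tl e \<in> A j \<inter> Y \<and> hd e \<in> Y - A j)"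

text \<open>Uncrossing \<^term>\<open>Y\<close> with the next cut of the chain gains one unit, either because
  \<^term>\<open>Y \<inter> A (Suc i)\<close> is not contained in the farthest cut \<^term>\<open>A i\<close>, or because a doubled arc
  runs from \<^term>\<open>A (Suc i)\<close> to \<^term>\<open>Y - A (Suc i)\<close>.\<close>

lemma cut_large:
  assumes "i \<le> k" "separates Y" "\<And>j. i \<le> j \<Longrightarrow> j < k \<Longrightarrow> leaves j Y"
  shows "cut (u i) (A i) + (k - i) \<le> cut (off D (u i)) Y"
  using assms
proof (induction i arbitrary: Y rule: inc_induct)
  case base
  show ?case using D_cut[OF base.prems(1)] by simp
next
  case (step i)
  let ?X = "A (Suc i)" and ?w = "off D (u i)" and ?w' = "off D (u (Suc i))"
  have X: "separates ?X" "?X \<subseteq> A k" "A i \<subseteq> ?X"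
    using step.hyps by (simp_all add: separates_A A_mono del: Suc_le_eq)
  obtain e where e: "e \<in> E" "0 < u i e" "tl e \<in> A i \<inter> Y" "hd e \<in> Y - A i"
    using step.prems(2)[OF order_refl step.hyps(2)] unfolding leaves_def by blast
  have "hd e \<noteq> t" using e(4) step.prems(1) by (auto simp: separates_def)
  have le: "?w e \<le> ?w' e" for e using step.hyps by (simp add: off_def u_Suc doubled_def)
  have eq: "?w e = ?w' e" if "tl e \<notin> A i" for e
    using step.hyps that by (simp add: off_def u_Suc doubled_def)
  have "leaves j (Y \<union> ?X)" if "Suc i \<le> j" "j < k" for j
  proof -
    have "leaves j Y" using step.prems(2) that by simp
    then show ?thesis unfolding leaves_def by blast
  qed
  then have "cut (u (Suc i)) ?X + (k - Suc i) \<le> cut ?w' (Y \<union> ?X)"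
    using separates_Un[OF step.prems(1) X(1)] by (intro step.IH)
  then have 1: "cut ?w' ?X + (k - Suc i) \<le> cut ?w' (Y \<union> ?X)"
    using X step.hyps by (simp add: cut_off_eq)
  \<comment> \<open>An arc whose capacity changes has its tail in \<open>A i\<close>, hence in
    \<open>?X\<close>; if it crosses the union it also crosses \<open>?X\<close>. So the doubling
    raises the cut of the union by no more than that of \<open>?X\<close>.\<close>
  have pt: "?w' e * of_bool (crosses (Y \<union> ?X) e) + ?w e * of_bool (crosses ?X e) \<le>
      ?w e * of_bool (crosses (Y \<union> ?X) e) + ?w' e * of_bool (crosses ?X e)" for e
  proof (cases "tl e \<in> A i")
    case True
    then show ?thesis using le[of e] X(3) by (auto simp: crosses_def)
  next
    case False
    then show ?thesis using eq[of e] by simp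
  qed
  have 2: "cut ?w' (Y \<union> ?X) + cut ?w ?X \<le> cut ?w (Y \<union> ?X) + cut ?w' ?X"
    unfolding cut_def sum.distrib[symmetric] by (rule sum_mono) (rule pt)
  have 3: "cut (u i) (A i) \<le> cut ?w (Y \<inter> ?X)"
    using X step.hyps step.prems
    by (subst cut_off_eq) (auto intro: farthest_min_cutD(2)[OF farthest] separates_Int)
  \<comment> \<open>Facts 1 to 4 together give the claim with \<open>k - Suc i\<close> in place of
    \<open>k - i\<close>. The missing unit comes from making 3 strict if the head of
    \<open>e\<close> lies in \<open>?X\<close>, and 2 strict otherwise.\<close>
  note 4 = cut_submodular[of ?w Y ?X]
  show ?case
  proof (cases "hd e \<in> ?X")
    case True
    have "cut (u i) (A i) < cut ?w (Y \<inter> ?X)"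
      using X step.hyps step.prems True e
      by (subst cut_off_eq) (auto intro!: farthest_min_cutD(3)[OF farthest] separates_Int)
    then show ?thesis using 1 2 4 step.hyps by linarith
  next
    case False
    \<comment> \<open>Here \<open>e\<close> crosses \<open>?X\<close> but not the union, and its
      capacity is positive and doubled; it is not in \<open>D\<close> because its head is not
      \<open>t\<close>.\<close>
    have "cut ?w' (Y \<union> ?X) + cut ?w ?X < cut ?w (Y \<union> ?X) + cut ?w' ?X"
      unfolding cut_def sum.distrib[symmetric]
    proof (rule sum_strict_mono_ex1[OF finite_E])
      show "\<exists>e\<in>E. ?w' e * of_bool (crosses (Y \<union> ?X) e) + ?w e * of_bool (crosses ?X e) <
          ?w e * of_bool (crosses (Y \<union> ?X) e) + ?w' e * of_bool (crosses ?X e)"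
        using e False X(3) \<open>hd e \<noteq> t\<close> step.hyps
        by (intro bexI[of _ e]) (auto simp: crosses_def off_def u_Suc doubled_def dest: D_head)
    qed (use pt in blast)
    then show ?thesis using 1 3 4 step.hyps by linarith
  qed
qed

theorem single_target:
  assumes "finite F" "card F \<le> k" "\<And>e. e \<in> F \<Longrightarrow> u 0 e \<le> 1" "separates Y"
  shows "\<exists>X. separates X \<and> cut (off F (u 0)) X \<le> cut (off D (off F (u 0))) Y"
proof (cases "\<forall>j<k. leaves j Y")
  case True
  \<comment> \<open>The surplus \<open>k\<close> of \<open>Y\<close> over the first minimum cut
    compensates the at most \<open>k\<close> failures, so \<open>A 0\<close> itself is the
    witness.\<close>
  have "cut (off F (u 0)) (A 0) \<le> cut (u 0) (A 0)" by (rule cut_off_le)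
  also have "\<dots> + k \<le> cut (off D (u 0)) Y"
    using cut_large[of 0 Y] True assms(4) by simp
  also have "\<dots> \<le> cut (off F (off D (u 0))) Y + card F"
    using assms by (intro cut_off_card) (auto simp: off_def)
  finally have "cut (off F (u 0)) (A 0) \<le> cut (off D (off F (u 0))) Y"
    using assms(2) by (simp add: off_off Un_commute)
  then show ?thesis using separates_A by blast
next
  case False
  then obtain j where j: "j < k" "\<not> leaves j Y" by blast
  \<comment> \<open>An arc of positive capacity leaving \<open>A j \<inter> Y\<close> must leave
    \<open>Y\<close>, since otherwise it would witness \<open>leaves j Y\<close>; and it is not in
    \<open>D\<close>, because its tail lies in \<open>A k\<close>. The comparison therefore holds
    arc by arc, whatever fails.\<close>
  have "cut (off F (u 0)) (A j \<inter> Y) \<le> cut (off D (off F (u 0))) Y"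
    unfolding cut_def
  proof (rule sum_mono)
    fix e assume e: "e \<in> E"
    show "off F (u 0) e * of_bool (crosses (A j \<inter> Y) e) \<le>
        off D (off F (u 0)) e * of_bool (crosses Y e)"
    proof (cases "crosses (A j \<inter> Y) e \<and> u 0 e \<noteq> 0")
      case True
      have "0 < u j e" using u_mono[of j e] j True by linarith
      with True j e have "hd e \<notin> Y" unfolding leaves_def crosses_def by blast
      moreover have "e \<notin> D"
        using D_from_last[of e 0] A_mono[of j k] True e j by (auto simp: crosses_def)
      ultimately show ?thesis using True by (simp add: crosses_def off_def)
    qed (auto simp: off_def)
  qed
  then show ?thesis using separates_A[of j] assms(4) j by (auto intro: separates_Int)
qed

end

context st_arc_system
begin

text \<open>Minimum cuts for the target \<^term>\<open>t\<close> avoid the arcs of \<^term>\<open>D\<close>, so every other cut can be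
  uncrossed with one of them.\<close>

lemma other_targets:
  assumes "\<And>e. e \<in> D \<Longrightarrow> hd e = t"
    and preserved: "\<And>Y. separates Y \<Longrightarrow> \<exists>X. separates X \<and> cut w X \<le> cut (off D w) Y"
    and "s \<in> Y" "v \<notin> Y"
  shows "\<exists>X. s \<in> X \<and> v \<notin> X \<and> cut w X \<le> cut (off D w) Y"
proof (cases "t \<in> Y")
  case True
  then have "cut w Y = cut (off D w) Y"
    using assms(1) by (intro cut_cong) (auto simp: crosses_def off_def)
  then show ?thesis using assms by (intro exI[of _ Y]) simp
next
  case False
  with assms have Y: "separates Y" by (simp add: separates_def)
  define Z where "Z = arg_min (cut w) separates"
  have Z: "separates Z" "\<And>X. separates X \<Longrightarrow> cut w Z \<le> cut w X"
    unfolding Z_def using arg_min_natI[of separates, OF Y] arg_min_nat_le[of separates] by blast+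
  have min: "cut w Z \<le> cut (off D w) X" if "separates X" for X
    using preserved[OF that] Z(2) le_trans by blast
  \<comment> \<open>The minimum cut \<open>Z\<close> stays minimum after deleting \<open>D\<close>,
    so no arc of positive weight in \<open>D\<close> can cross it.\<close>
  have "w e = 0" if "e \<in> E" "e \<in> D" "crosses Z e" for e
  proof (rule ccontr)
    assume "w e \<noteq> 0"
    have "cut (off D w) Z < cut w Z"
      unfolding cut_def
    proof (rule sum_strict_mono_ex1[OF finite_E])
      show "\<exists>e\<in>E. off D w e * of_bool (crosses Z e) < w e * of_bool (crosses Z e)"
        using that \<open>w e \<noteq> 0\<close> by (intro bexI[of _ e]) (auto simp: off_def)
    qed (auto simp: off_def)
    with min[OF Z(1)] show False by simp
  qed
  \<comment> \<open>Arcs of \<open>D\<close> end in \<open>t\<close>, which lies outside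
    \<open>Z\<close>; those leaving \<open>Y \<inter> Z\<close> therefore cross \<open>Z\<close> and
    weigh nothing.\<close>
  then have "cut w (Y \<inter> Z) = cut (off D w) (Y \<inter> Z)"
    using assms(1) Z(1) by (intro cut_cong) (auto simp: off_def crosses_def separates_def)
  also have "\<dots> \<le> cut (off D w) Y"
    using cut_submodular[of "off D w" Y Z] min[OF separates_Un[OF Y Z(1)]] cut_off_le[of D w Z]
    by simp
  finally show ?thesis using assms Z(1) by (intro exI[of _ "Y \<inter> Z"]) (auto simp: separates_def)
qed

end

section \<open>Residual networks and the max-flow min-cut theorem\<close>

text \<open>Abstract because two concrete encodings are needed: arcs tagged with a direction for the
  max-flow min-cut theorem, and numbers below \<open>M + M\<close> for the program.\<close>

locale residual_arcs =
  fixes R :: "'a set" and src dst :: "'a \<Rightarrow> 'v" and rev :: "'a \<Rightarrow> 'a"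
  assumes finite_R: "finite R"
    and rev_in: "a \<in> R \<Longrightarrow> rev a \<in> R"
    and rev_rev: "a \<in> R \<Longrightarrow> rev (rev a) = a"
    and rev_neq: "a \<in> R \<Longrightarrow> rev a \<noteq> a"
    and src_rev: "a \<in> R \<Longrightarrow> src (rev a) = dst a"
begin

lemma dst_rev: "a \<in> R \<Longrightarrow> dst (rev a) = src a"
  using src_rev[of "rev a"] rev_in rev_rev by simp

definition resid :: "('a \<Rightarrow> nat) \<Rightarrow> 'v set \<Rightarrow> nat" where
  "resid r X = (\<Sum>a\<in>R. r a * of_bool (src a \<in> X \<and> dst a \<notin> X))"

definition push :: "'a \<Rightarrow> ('a \<Rightarrow> nat) \<Rightarrow> 'a \<Rightarrow> nat" where
  "push a r = r(a := r a - 1, rev a := Suc (r (rev a)))"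

text \<open>The change depends only on the two ends of \<open>a\<close>, so it telescopes along a
  path. Additions on both sides avoid truncated subtraction.\<close>

lemma resid_push:
  assumes "a \<in> R" "0 < r a"
  shows "resid (push a r) X + of_bool (src a \<in> X) = resid r X + of_bool (dst a \<in> X)"
proof -
  have split: "resid q X = q a * of_bool (src a \<in> X \<and> dst a \<notin> X) + (q (rev a) * of_bool (dst a \<in> X \<and> src a \<notin> X)
      + (\<Sum>b\<in>R - {a} - {rev a}. q b * of_bool (src b \<in> X \<and> dst b \<notin> X)))" for q
  proof -
    let ?g = "\<lambda>b. q b * of_bool (src b \<in> X \<and> dst b \<notin> X)"
    have "resid q X = ?g a + (?g (rev a) + (\<Sum>b\<in>R - {a} - {rev a}. ?g b))"
      unfolding resid_def using assms(1) finite_R rev_in[of a] rev_neq[of a]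
      by (subst sum.remove[of _ a], simp, simp, subst sum.remove[of _ "rev a"]) simp_all
    then show ?thesis using src_rev[OF assms(1)] dst_rev[OF assms(1)] by (simp only:)
  qed
  have "(\<Sum>b\<in>R - {a} - {rev a}. push a r b * of_bool (src b \<in> X \<and> dst b \<notin> X)) =
      (\<Sum>b\<in>R - {a} - {rev a}. r b * of_bool (src b \<in> X \<and> dst b \<notin> X))"
    by (rule sum.cong) (auto simp: push_def)
  moreover have "push a r a = r a - 1" "push a r (rev a) = Suc (r (rev a))"
    using rev_neq[OF assms(1)] by (simp_all add: push_def)
  ultimately show ?thesis
    using assms(2) unfolding split[of r] split[of "push a r"] by (auto simp: of_bool_def)
qed

lemma push_sum:
  assumes "a \<in> R" "0 < r a" "b \<in> R"
  shows "push a r b + push a r (rev b) = r b + r (rev b)"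
proof (cases "b = a \<or> b = rev a")
  case True
  then show ?thesis using assms rev_neq[of a] rev_rev[of a] by (auto simp: push_def)
next
  case False
  then have "rev b \<noteq> a \<and> rev b \<noteq> rev a" using assms rev_rev by metis
  with False show ?thesis by (simp add: push_def)
qed

lemma push_ge: "b \<noteq> a \<Longrightarrow> r b \<le> push a r b"
  by (simp add: push_def)

text \<open>A tree directed towards \<open>t\<close>: \<open>par y\<close> is the first arc on the
  way from \<open>y\<close>. Strictly decreasing levels guarantee that parent chains end in
  \<open>t\<close> and replace an explicit notion of path.\<close>

definition in_tree :: "'v set \<Rightarrow> ('v \<Rightarrow> nat) \<Rightarrow> ('v \<Rightarrow> 'a) \<Rightarrow> 'v \<Rightarrow> bool" where
  "in_tree S lev par t \<longleftrightarrow> t \<in> S \<and> (\<forall>y\<in>S. y \<noteq> t \<longrightarrow>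
     par y \<in> R \<and> src (par y) = y \<and> dst (par y) \<in> S \<and> lev (dst (par y)) < lev y)"

text \<open>Only levels up to that of \<open>x\<close> are constrained: pushing along
  \<open>par x\<close> may exhaust that arc, but the rest of the walk stays at smaller
  levels.\<close>

definition usable :: "'v set \<Rightarrow> ('v \<Rightarrow> nat) \<Rightarrow> ('v \<Rightarrow> 'a) \<Rightarrow> 'v \<Rightarrow> ('a \<Rightarrow> nat) \<Rightarrow> 'v \<Rightarrow> bool" where
  "usable S lev par t r x \<longleftrightarrow> (\<forall>y\<in>S. y \<noteq> t \<and> lev y \<le> lev x \<longrightarrow> 0 < r (par y))"

lemma usable_push:
  assumes "in_tree S lev par t" "usable S lev par t r x" "x \<in> S" "x \<noteq> t"
  shows "usable S lev par t (push (par x) r) (dst (par x))"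
  unfolding usable_def
proof (intro ballI impI)
  fix y assume y: "y \<in> S" "y \<noteq> t \<and> lev y \<le> lev (dst (par x))"
  have less: "lev (dst (par x)) < lev x" and "src (par x) = x" "src (par y) = y"
    using assms y by (auto simp: in_tree_def)
  then have "par y \<noteq> par x" using y by (metis leD)
  then have "r (par y) \<le> push (par x) r (par y)" by (rule push_ge)
  moreover have "0 < r (par y)" using assms(2) y less by (simp add: usable_def)
  ultimately show "0 < push (par x) r (par y)" by simp
qed

text \<open>One unit is pushed along each parent arc from \<open>x\<close> to \<open>t\<close>. The
  changes of the cut telescope, and the end \<open>t\<close> contributes nothing as it lies outside
  \<open>X\<close>.\<close>

lemma augment_along_tree:
  assumes "in_tree S lev par t" "usable S lev par t r x" "x \<in> S"
  shows "\<exists>r'. (\<forall>a\<in>R. r' a + r' (rev a) = r a + r (rev a)) \<and>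
    (\<forall>X. t \<notin> X \<longrightarrow> resid r' X + of_bool (x \<in> X) = resid r X)"
  using assms(2,3)
proof (induction "lev x" arbitrary: x r rule: less_induct)
  case less
  show ?case
  proof (cases "x = t")
    case True
    then show ?thesis by (intro exI[of _ r]) auto
  next
    case False
    let ?a = "par x"
    let ?r = "push ?a r"
    have a: "?a \<in> R" "src ?a = x" "dst ?a \<in> S" "lev (dst ?a) < lev x"
      using assms(1) less.prems(2) False by (auto simp: in_tree_def)
    have pos: "0 < r ?a" using less.prems False by (simp add: usable_def)
    obtain r' where r': "\<forall>b\<in>R. r' b + r' (rev b) = ?r b + ?r (rev b)"
        "\<forall>X. t \<notin> X \<longrightarrow> resid r' X + of_bool (dst ?a \<in> X) = resid ?r X"
      using less.hyps[OF a(4) usable_push[OF assms(1) less.prems False] a(3)] by blast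
    have "resid r' X + of_bool (x \<in> X) = resid r X" if "t \<notin> X" for X
      using r'(2)[rule_format, OF that] resid_push[of "par x" r X, OF a(1) pos] a(2) by simp
    moreover have "r' b + r' (rev b) = r b + r (rev b)" if "b \<in> R" for b
      using r'(1) push_sum[of "par x" r b, OF a(1) pos that] that by simp
    ultimately show ?thesis by blast
  qed
qed

lemma resid_closed:
  assumes "\<And>a. a \<in> R \<Longrightarrow> 0 < r a \<Longrightarrow> dst a \<in> S \<Longrightarrow> src a \<in> S"
  shows "resid r (- S) = 0"
  unfolding resid_def using assms by (intro sum.neutral) auto

text \<open>At a vertex of \<open>X \<inter> S\<close> of least level, the parent arc leads to a
  vertex of \<open>S\<close> of smaller level, hence out of \<open>X\<close>.\<close>

lemma resid_meets_tree:
  assumes "in_tree S lev par t" "\<And>y. y \<in> S \<Longrightarrow> y \<noteq> t \<Longrightarrow> 0 < r (par y)"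
    and "x \<in> X \<inter> S" "t \<notin> X"
  shows "0 < resid r X"
proof -
  define y where "y = arg_min lev (\<lambda>y. y \<in> X \<inter> S)"
  have y: "y \<in> X \<inter> S" and min: "\<And>z. z \<in> X \<inter> S \<Longrightarrow> lev y \<le> lev z"
    unfolding y_def using assms(3) arg_min_natI[of "\<lambda>y. y \<in> X \<inter> S" x lev]
      arg_min_nat_le[of "\<lambda>y. y \<in> X \<inter> S" _ lev] by blast+
  with assms(4) have "y \<noteq> t" by auto
  with assms(1) y have par: "par y \<in> R" "src (par y) = y" "dst (par y) \<in> S" "lev (dst (par y)) < lev y"
    by (auto simp: in_tree_def)
  with min have "dst (par y) \<notin> X" by (meson IntI not_less)
  have "r (par y) * of_bool (src (par y) \<in> X \<and> dst (par y) \<notin> X) \<le> resid r X"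
    unfolding resid_def using finite_R par(1) by (intro member_le_sum) auto
  with \<open>dst (par y) \<notin> X\<close> assms(2)[of y] y \<open>y \<noteq> t\<close> par(2) show ?thesis by simp
qed

text \<open>With \<open>S\<close> the set of vertices that reach \<open>t\<close> along positive
  arcs, the complement of \<open>S\<close> has residual capacity 0. So \<open>s\<close> lies in
  \<open>S\<close>, and shortest distances to \<open>t\<close> supply the tree.\<close>

lemma augmentation_exists:
  assumes "\<And>X. s \<in> X \<Longrightarrow> t \<notin> X \<Longrightarrow> 0 < resid r X"
  shows "\<exists>r'. (\<forall>a\<in>R. r' a + r' (rev a) = r a + r (rev a)) \<and>
    (\<forall>X. s \<in> X \<and> t \<notin> X \<longrightarrow> resid r' X + 1 = resid r X)"
proof -
  define Q where "Q = {(x, y). \<exists>a\<in>R. 0 < r a \<and> src a = x \<and> dst a = y}"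
  define S where "S = {x. \<exists>i. (x, t) \<in> Q ^^ i}"
  define lev where "lev x = (LEAST i. (x, t) \<in> Q ^^ i)" for x
  have lev: "(x, t) \<in> Q ^^ lev x" if "x \<in> S" for x
    using that unfolding S_def lev_def by (auto intro: LeastI)
  have "\<exists>a\<in>R. 0 < r a \<and> src a = x \<and> dst a \<in> S \<and> lev (dst a) < lev x" if "x \<in> S" "x \<noteq> t" for x
  proof -
    from lev[OF that(1)] that(2) obtain i where i: "lev x = Suc i" by (cases "lev x") auto
    with lev[OF that(1)] obtain y where y: "(x, y) \<in> Q" "(y, t) \<in> Q ^^ i"
      by (metis relpow_Suc_D2)
    then have "lev y \<le> i" "y \<in> S" by (auto simp: lev_def S_def intro: Least_le)
    with y i show ?thesis by (auto simp: Q_def)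
  qed
  then obtain par where par: "\<And>x. x \<in> S \<Longrightarrow> x \<noteq> t \<Longrightarrow>
      par x \<in> R \<and> 0 < r (par x) \<and> src (par x) = x \<and> dst (par x) \<in> S \<and> lev (dst (par x)) < lev x"
    by metis
  have "t \<in> S" unfolding S_def by (auto intro: exI[of _ 0])
  have "src a \<in> S" if "a \<in> R" "0 < r a" "dst a \<in> S" for a
  proof -
    from that(3) obtain i where "(dst a, t) \<in> Q ^^ i" by (auto simp: S_def)
    then have "(src a, t) \<in> Q ^^ Suc i" using that by (intro relpow_Suc_I2) (auto simp: Q_def)
    then show ?thesis unfolding S_def by blast
  qed
  then have "resid r (- S) = 0" by (rule resid_closed)
  with assms[of "- S"] \<open>t \<in> S\<close> have "s \<in> S" by auto
  have "in_tree S lev par t" "usable S lev par t r s"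
    using par \<open>t \<in> S\<close> by (auto simp: in_tree_def usable_def)
  from augment_along_tree[OF this \<open>s \<in> S\<close>] obtain r' where
    r': "\<forall>a\<in>R. r' a + r' (rev a) = r a + r (rev a)"
      "\<forall>X. t \<notin> X \<longrightarrow> resid r' X + of_bool (s \<in> X) = resid r X" by blast
  have "resid r' X + 1 = resid r X" if "s \<in> X \<and> t \<notin> X" for X
    using r'(2)[rule_format, of X] that by simp
  with r'(1) show ?thesis by blast
qed

end

section \<open>Real-valued flows and cuts of a finite digraph\<close>

definition arc_cut :: "('a, 'b) pre_digraph \<Rightarrow> 'a set \<Rightarrow> 'b set" where
  "arc_cut G X = {e \<in> arcs G. tail G e \<in> X \<and> head G e \<notin> X}"

context fin_digraph
begin

definition net_flow :: "('b \<Rightarrow> real) \<Rightarrow> 'a set \<Rightarrow> real" where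
  "net_flow f X = (\<Sum>e\<in>arcs G. f e * (of_bool (tail G e \<in> X) - of_bool (head G e \<in> X)))"

lemma net_flow_vertex:
  "(\<Sum>e\<in>out_arcs G v. f e) - (\<Sum>e\<in>in_arcs G v. f e) = net_flow f {v}"
proof -
  have "(\<Sum>e\<in>out_arcs G v. f e) = (\<Sum>e\<in>arcs G. f e * of_bool (tail G e = v))"
    "(\<Sum>e\<in>in_arcs G v. f e) = (\<Sum>e\<in>arcs G. f e * of_bool (head G e = v))"
    by (auto simp: out_arcs_def in_arcs_def sum.inter_filter of_bool_def intro!: sum.cong)
  then show ?thesis by (simp add: net_flow_def right_diff_distrib sum_subtractf)
qed

lemma net_flow_sum: "net_flow f X = (\<Sum>v\<in>verts G \<inter> X. net_flow f {v})"
proof -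
  have "(\<Sum>v\<in>verts G \<inter> X. net_flow f {v}) =
      (\<Sum>e\<in>arcs G. \<Sum>v\<in>verts G \<inter> X. f e * (of_bool (tail G e = v) - of_bool (head G e = v)))"
    unfolding net_flow_def by (subst sum.swap) simp
  also have "\<dots> = net_flow f X"
    unfolding net_flow_def
  proof (rule sum.cong[OF refl])
    fix e assume "e \<in> arcs G"
    then have "(\<Sum>v\<in>verts G \<inter> X. of_bool (tail G e = v)) = (of_bool (tail G e \<in> X) :: real)"
      "(\<Sum>v\<in>verts G \<inter> X. of_bool (head G e = v)) = (of_bool (head G e \<in> X) :: real)"
      by (simp_all add: of_bool_def)
    then show "(\<Sum>v\<in>verts G \<inter> X. f e * (of_bool (tail G e = v) - of_bool (head G e = v))) =
        f e * (of_bool (tail G e \<in> X) - of_bool (head G e \<in> X))"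
      by (simp add: sum_distrib_left[symmetric] sum_subtractf)
  qed
  finally show ?thesis by simp
qed

text \<open>The alternative \<open>s = t\<close> admits sets containing the target; with
  \<open>X\<close> the whole vertex set it shows that a flow from a vertex to itself has value
  0.\<close>

lemma flow_value_eq_net_flow:
  assumes "is_flow G s t f" "s \<in> verts G" "s \<in> X" "t \<notin> X \<or> s = t"
  shows "flow_value G s f = net_flow f X"
proof -
  have "net_flow f {v} = 0" if "v \<in> verts G \<inter> X - {s}" for v
  proof -
    have "v \<in> verts G - {s, t}" using assms(4) that by auto
    then show ?thesis using assms(1) net_flow_vertex[of f v] by (simp add: is_flow_def)
  qed
  then have "net_flow f X = net_flow f {s}"
    unfolding net_flow_sum[of f X] using assms(2,3)
    by (subst sum.remove[of _ s]) auto
  then show ?thesis using net_flow_vertex[of f s] by (simp add: flow_value_def)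
qed

lemma flow_value_le_cut:
  assumes "is_flow G s t f" "s \<in> verts G" "s \<in> X" "t \<notin> X"
  shows "flow_value G s f \<le> card (arc_cut G X)"
proof -
  have "net_flow f X \<le> (\<Sum>e\<in>arcs G. of_bool (tail G e \<in> X \<and> head G e \<notin> X))"
    unfolding net_flow_def using assms(1) by (intro sum_mono) (auto simp: is_flow_def)
  also have "\<dots> = card (arc_cut G X)"
    by (simp add: of_bool_def sum.If_cases arc_cut_def Collect_conj_eq Int_assoc)
  finally show ?thesis using flow_value_eq_net_flow[OF assms(1-3)] assms(4) by simp
qed

lemma zero_flow: "is_flow G s t (\<lambda>_. 0)" "flow_value G s (\<lambda>_. 0) = 0"
  by (simp_all add: is_flow_def flow_value_def)

lemma max_flow_le_cut:
  assumes "s \<in> verts G" "s \<in> X" "t \<notin> X"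
  shows "max_flow G s t \<le> card (arc_cut G X)"
  unfolding max_flow_def
  using flow_value_le_cut[OF _ assms] zero_flow(1) by (intro cSup_least) auto

lemma flow_value_le_max_flow:
  assumes "is_flow G s t f" "s \<in> verts G" "s \<noteq> t"
  shows "flow_value G s f \<le> max_flow G s t"
  unfolding max_flow_def using assms flow_value_le_cut[of s t _ "{s}"]
  by (intro cSup_upper bdd_aboveI[of _ "real (card (arc_cut G {s}))"]) auto

lemma max_flow_self:
  assumes "s \<in> verts G" shows "max_flow G s s = 0"
proof -
  have "flow_value G s f = 0" if "is_flow G s s f" for f
    using flow_value_eq_net_flow[OF that assms, of "verts G"] assms wellformed
    by (simp add: net_flow_def)
  then have "{flow_value G s f |f. is_flow G s s f} = {0}"
    using zero_flow by (auto intro!: exI[of _ "\<lambda>_. 0"])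
  then show ?thesis by (simp add: max_flow_def)
qed

text \<open>A residual network of greatest value admits no augmentation, so some separating set has
  residual capacity 0. Its cut size equals the value, and the reverse entries form a flow of that
  value.\<close>

lemma min_cut_le_max_flow:
  assumes "s \<in> verts G" "s \<noteq> t"
  shows "\<exists>X. s \<in> X \<and> t \<notin> X \<and> card (arc_cut G X) \<le> max_flow G s t"
proof -
  let ?R = "arcs G \<times> (UNIV :: bool set)"
  let ?src = "\<lambda>(e, b). if b then head G e else tail G e"
  let ?dst = "\<lambda>(e, b). if b then tail G e else head G e"
  interpret N: residual_arcs ?R ?src ?dst "\<lambda>(e, b). (e, \<not> b)"
    by unfold_locales (auto split: prod.splits)
  have resid: "N.resid r X =
      (\<Sum>e\<in>arcs G. r (e, False) * of_bool (tail G e \<in> X \<and> head G e \<notin> X)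
        + r (e, True) * of_bool (head G e \<in> X \<and> tail G e \<notin> X))" for r X
  proof -
    have "N.resid r X = (\<Sum>(e, b)\<in>?R. r (e, b) * of_bool ((if b then head G e else tail G e) \<in> X
        \<and> (if b then tail G e else head G e) \<notin> X))"
      unfolding N.resid_def by (rule sum.cong) auto
    also have "\<dots> = (\<Sum>e\<in>arcs G. \<Sum>b\<in>UNIV. r (e, b) * of_bool ((if b then head G e else tail G e) \<in> X
        \<and> (if b then tail G e else head G e) \<notin> X))"
      by (simp only: sum.cartesian_product)
    also have "\<dots> = (\<Sum>e\<in>arcs G. r (e, False) * of_bool (tail G e \<in> X \<and> head G e \<notin> X)
        + r (e, True) * of_bool (head G e \<in> X \<and> tail G e \<notin> X))"
      by (rule sum.cong) (simp_all add: UNIV_bool)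
    finally show ?thesis .
  qed
  \<comment> \<open>\<open>v\<close> is the value of the integral flow encoded by \<open>r\<close>;
    that it is a flow is expressed only by the cut equation.\<close>
  define ok where "ok r v \<longleftrightarrow> (\<forall>e\<in>arcs G. r (e, False) + r (e, True) = 1) \<and>
      (\<forall>X. s \<in> X \<and> t \<notin> X \<longrightarrow> card (arc_cut G X) = N.resid r X + v)" for r :: "_ \<Rightarrow> nat" and v
  have "ok (\<lambda>(e, b). of_bool (\<not> b)) 0"
    unfolding ok_def resid
    by (auto simp: arc_cut_def of_bool_def sum.If_cases Collect_conj_eq Int_assoc)
  moreover have "v \<le> card (arc_cut G {s})" if "\<exists>r. ok r v" for v
    using that assms(2) by (auto simp: ok_def)
  ultimately obtain v where v: "\<exists>r. ok r v" "\<And>v'. \<exists>r. ok r v' \<Longrightarrow> v' \<le> v"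
    using Nat.ex_has_greatest_nat[of "\<lambda>v. \<exists>r. ok r v" 0 "card (arc_cut G {s})"] by blast
  then obtain r where r: "ok r v" by blast
  have "\<exists>X. s \<in> X \<and> t \<notin> X \<and> N.resid r X = 0"
  proof (rule ccontr)
    assume "\<not> ?thesis"
    then obtain r' where r': "\<forall>a\<in>?R. r' a + r' (case a of (e, b) \<Rightarrow> (e, \<not> b)) = r a + r (case a of (e, b) \<Rightarrow> (e, \<not> b))"
        "\<forall>X. s \<in> X \<and> t \<notin> X \<longrightarrow> N.resid r' X + 1 = N.resid r X"
      using N.augmentation_exists[of s t r] by auto
    have "ok r' (Suc v)"
      unfolding ok_def
    proof (intro conjI ballI allI impI)
      fix e assume e: "e \<in> arcs G"
      with r'(1)[rule_format, of "(e, False)"] have "r' (e, False) + r' (e, True) = r (e, False) + r (e, True)"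
        by simp
      with r e show "r' (e, False) + r' (e, True) = 1" by (simp add: ok_def)
    next
      fix X assume X: "s \<in> X \<and> t \<notin> X"
      with r have "card (arc_cut G X) = N.resid r X + v" unfolding ok_def by blast
      with r'(2) X show "card (arc_cut G X) = N.resid r' X + Suc v" by auto
    qed
    with v(2)[of "Suc v"] show False by auto
  qed
  then obtain X where X: "s \<in> X" "t \<notin> X" "card (arc_cut G X) = v"
    using r by (auto simp: ok_def)
  define f where "f e = real (r (e, True))" for e
  have f: "real (r (e, False)) = 1 - f e" "0 \<le> f e" "f e \<le> 1" if "e \<in> arcs G" for e
  proof -
    from r that have "r (e, False) + r (e, True) = 1" unfolding ok_def by blast
    then have "real (r (e, False)) + real (r (e, True)) = 1" by (metis of_nat_add of_nat_1)
    then show "real (r (e, False)) = 1 - f e" "0 \<le> f e" "f e \<le> 1" by (auto simp: f_def)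
  qed
  have net: "net_flow f Y = v" if "s \<in> Y" "t \<notin> Y" for Y
  proof -
    have "real v = real (card (arc_cut G Y)) - real (N.resid r Y)" using r that by (simp add: ok_def)
    also have "real (card (arc_cut G Y)) = (\<Sum>e\<in>arcs G. of_bool (tail G e \<in> Y \<and> head G e \<notin> Y))"
      by (simp add: of_bool_def sum.If_cases arc_cut_def Collect_conj_eq Int_assoc)
    also have "\<dots> - real (N.resid r Y) = net_flow f Y"
      unfolding resid net_flow_def of_nat_sum sum_subtractf[symmetric]
      using f(1) by (intro sum.cong) (auto simp: f_def)
    finally show ?thesis by simp
  qed
  have "is_flow G s t f"
    unfolding is_flow_def
  proof (intro conjI ballI)
    fix w assume w: "w \<in> verts G - {s, t}"
    \<comment> \<open>Conservation at \<open>w\<close> is recovered from cuts: \<open>{s}\<close>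
      and \<open>{s, w}\<close> both carry net flow \<open>v\<close>, so their difference, the net
      flow of \<open>w\<close>, vanishes.\<close>
    have "net_flow f {s, w} = net_flow f {s} + net_flow f {w}"
      using w unfolding net_flow_def sum.distrib[symmetric] by (intro sum.cong) (auto simp: algebra_simps)
    then have "net_flow f {w} = 0" using w assms(2) net[of "{s}"] net[of "{s, w}"] by auto
    then show "(\<Sum>e\<in>in_arcs G w. f e) = (\<Sum>e\<in>out_arcs G w. f e)"
      using net_flow_vertex[of f w] by simp
  qed (use f in auto)
  moreover have "flow_value G s f = v"
    using net[of "{s}"] net_flow_vertex[of f s] assms(2) by (simp add: flow_value_def)
  ultimately have "real v \<le> max_flow G s t" using flow_value_le_max_flow[of s t f] assms by simp
  with X show ?thesis by auto
qed

end

section \<open>Processing one target\<close>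

text \<open>Graphs without arcs are treated separately, since there
  \<open>lam * 2 ^ k * m * n\<close> is 0 and cannot pay for any step.\<close>

locale instance_data =
  fixes n :: nat and es :: "(nat \<times> nat) list" and s lam k :: nat
  assumes es_bounded: "set es \<subseteq> {..<n} \<times> {..<n}" and es_distinct: "distinct es"
    and es_nonempty: "es \<noteq> []" and s_bounded: "s < n" and lam_pos: "1 \<le> lam" and k_pos: "1 \<le> k"
begin

text \<open>Vertex \<^term>\<open>n\<close> is an extra source, joined to \<^term>\<open>s\<close> by the arc with index \<^term>\<open>length es\<close>
  and capacity \<^term>\<open>lam\<close>; it caps all flows at \<^term>\<open>lam\<close>. Indices \<^term>\<open>a < M\<close> denote
  arcs, and \<^term>\<open>a + M\<close> denotes the reverse of \<^term>\<open>a\<close>.\<close>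

abbreviation m :: nat where "m \<equiv> length es"
abbreviation M :: nat where "M \<equiv> Suc (length es)"

definition tl :: "nat \<Rightarrow> nat" where "tl e = (if e < m then fst (es ! e) else n)"
definition hd :: "nat \<Rightarrow> nat" where "hd e = (if e < m then snd (es ! e) else s)"
definition src :: "nat \<Rightarrow> nat" where "src a = (if a < M then tl a else hd (a - M))"
definition dst :: "nat \<Rightarrow> nat" where "dst a = (if a < M then hd a else tl (a - M))"
definition rev :: "nat \<Rightarrow> nat" where "rev a = (if a < M then a + M else a - M)"

lemma tl_less: "e < m \<Longrightarrow> tl e < n" and hd_less: "hd e < n"
  using es_bounded s_bounded by (auto simp: tl_def hd_def dest!: nth_mem)

lemma tl_m: "tl m = n"
  by (simp add: tl_def)

lemma src_le: "src a \<le> n" and dst_le: "dst a \<le> n"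
  using tl_less hd_less by (auto simp: src_def dst_def tl_def less_imp_le)

sublocale arcs: arc_system "{..m}" tl hd
  by unfold_locales simp

definition half_arcs :: "nat set" where "half_arcs = {..<M + M}"

sublocale residual_arcs half_arcs src dst rev
  by unfold_locales (auto simp: half_arcs_def rev_def src_def dst_def)

lemma resid_eq:
  "resid r X = (\<Sum>e\<le>m. r e * of_bool (tl e \<in> X \<and> hd e \<notin> X) + r (e + M) * of_bool (hd e \<in> X \<and> tl e \<notin> X))"
proof -
  let ?g = "\<lambda>a. r a * of_bool (src a \<in> X \<and> dst a \<notin> X)"
  have "resid r X = sum ?g {0..<M} + sum ?g {0 + M..<M + M}"
    using resid_def[of r X] unfolding half_arcs_def lessThan_atLeast0
    by (simp only: sum.atLeastLessThan_concat add_0 le_add1 le0)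
  also have "sum ?g {0 + M..<M + M} = (\<Sum>e<M. ?g (e + M))"
    by (simp only: sum.shift_bounds_nat_ivl lessThan_atLeast0)
  also have "sum ?g {0..<M} = (\<Sum>e\<le>m. r e * of_bool (tl e \<in> X \<and> hd e \<notin> X))"
    unfolding lessThan_atLeast0[symmetric] lessThan_Suc_atMost
    by (rule sum.cong) (auto simp: src_def dst_def)
  also have "(\<Sum>e<M. ?g (e + M)) = (\<Sum>e\<le>m. r (e + M) * of_bool (hd e \<in> X \<and> tl e \<notin> X))"
    unfolding lessThan_Suc_atMost by (rule sum.cong) (auto simp: src_def dst_def)
  finally show ?thesis by (simp only: sum.distrib)
qed

definition wt :: "nat set \<Rightarrow> nat \<Rightarrow> nat" where
  "wt L e = (if e = m then lam else of_bool (e \<in> L))"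

text \<open>Arcs leaving \<open>t\<close> get capacity 0. They cross no cut that separates
  \<open>t\<close> from the source, so these cuts keep their values, while all flow entering
  \<open>t\<close> now counts towards the flow value.\<close>

definition caps :: "nat \<Rightarrow> nat set \<Rightarrow> nat \<Rightarrow> nat" where
  "caps t L e = (if e = m then lam else of_bool (e \<in> L \<and> tl e \<noteq> t))"

text \<open>Cut form of the assertion that passing from \<open>L\<close> to \<open>L'\<close> lowers
  no flow value capped at \<open>lam\<close>. The source arc \<open>m\<close> never fails.
  \<open>F\<close> may contain indices outside \<open>L\<close> and \<open>L'\<close>, which makes
  the relation transitive, so targets can be processed in succession.\<close>

definition preserves :: "nat set \<Rightarrow> nat set \<Rightarrow> bool" where
  "preserves L L' \<longleftrightarrow> (\<forall>F v Y. F \<subseteq> {..<m} \<and> card F \<le> k \<and> n \<in> Y \<and> v \<notin> Y \<longrightarrow>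
     (\<exists>X. n \<in> X \<and> v \<notin> X \<and> arcs.cut (arcs.off F (wt L)) X \<le> arcs.cut (arcs.off F (wt L')) Y))"

lemma preserves_refl: "preserves L L"
  unfolding preserves_def by blast

lemma preserves_trans: "preserves L L' \<Longrightarrow> preserves L' L'' \<Longrightarrow> preserves L L''"
  unfolding preserves_def by (meson le_trans)

end

locale target_data = instance_data +
  fixes t :: nat
  assumes t_bounded: "t < n"
begin

sublocale st: st_arc_system "{..m}" tl hd n t
  by unfold_locales

text \<open>A record for the proof only: the program stores neither the earlier capacities
  \<open>u j\<close> nor the cuts \<open>A j\<close>, just the current residual capacities.
  \<open>phase\<close> hides the record existentially.\<close>

definition history :: "nat set \<Rightarrow> nat \<Rightarrow> (nat \<Rightarrow> nat \<Rightarrow> nat) \<Rightarrow> (nat \<Rightarrow> nat set) \<Rightarrow> bool" where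
  "history L i u A \<longleftrightarrow> u 0 = caps t L \<and>
     (\<forall>j<i. st.farthest_min_cut (u j) (A j) \<and> arcs.cut (u j) (A j) \<le> lam * 2 ^ j \<and>
       u (Suc j) = st.doubled (u j) (A j))"

text \<open>The entries \<^term>\<open>r (e + M)\<close> are the flow along \<^term>\<open>e\<close>. Conservation is expressed through cuts only:
  for every cut, capacity and residual capacity differ by the flow value \<^term>\<open>v\<close>.\<close>

definition phase_for :: "nat set \<Rightarrow> nat \<Rightarrow> (nat \<Rightarrow> nat) \<Rightarrow> nat \<Rightarrow> (nat \<Rightarrow> nat \<Rightarrow> nat) \<Rightarrow> (nat \<Rightarrow> nat set) \<Rightarrow> bool" where
  "phase_for L i r v u A \<longleftrightarrow> history L i u A \<and> (\<forall>e\<le>m. r e + r (e + M) = u i e) \<and>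
     (\<forall>X. st.separates X \<longrightarrow> arcs.cut (u i) X = resid r X + v)"

definition phase :: "nat set \<Rightarrow> nat \<Rightarrow> (nat \<Rightarrow> nat) \<Rightarrow> nat \<Rightarrow> bool" where
  "phase L i r v \<longleftrightarrow> (\<exists>u A. phase_for L i r v u A)"

lemma phase_init:
  assumes "\<And>e. e \<le> m \<Longrightarrow> r e = caps t L e" "\<And>e. e \<le> m \<Longrightarrow> r (e + M) = 0"
  shows "phase L 0 r 0"
  unfolding phase_def phase_for_def history_def resid_eq arcs.cut_def using assms
  by (intro exI[of _ "\<lambda>_. caps t L"]) (auto simp: arcs.crosses_def intro!: sum.cong)

lemma phase_augment:
  assumes "phase L i r v" "\<And>a. a \<in> half_arcs \<Longrightarrow> r' a + r' (rev a) = r a + r (rev a)"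
    and "\<And>X. n \<in> X \<Longrightarrow> t \<notin> X \<Longrightarrow> resid r' X + 1 = resid r X"
  shows "phase L i r' (Suc v)"
proof -
  obtain u A where "phase_for L i r v u A" using assms(1) by (auto simp: phase_def)
  moreover have "r' e + r' (e + M) = r e + r (e + M)" if "e \<le> m" for e
    using assms(2)[of e] that by (simp add: rev_def half_arcs_def)
  moreover have "resid r X + v = resid r' X + Suc v" if "st.separates X" for X
    using assms(3)[of X] that by (simp add: st.separates_def)
  ultimately have "phase_for L i r' (Suc v) u A" by (simp add: phase_for_def)
  then show ?thesis by (auto simp: phase_def)
qed

lemma cut_source: "arcs.cut (caps t L) {n} \<le> lam"
proof -
  have "arcs.cut (caps t L) {n} \<le> (\<Sum>e\<le>m. if e = m then lam else 0)"
    unfolding arcs.cut_def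
  proof (rule sum_mono)
    fix e assume "e \<in> {..m}"
    then show "caps t L e * of_bool (arcs.crosses {n} e) \<le> (if e = m then lam else 0)"
      using tl_less[of e] by (cases "e = m") (auto simp: caps_def arcs.crosses_def)
  qed
  then show ?thesis by simp
qed

lemma separates_source: "st.separates {n}"
  using t_bounded by (simp add: st.separates_def)

text \<open>The minimum cut of the previous round still separates, and doubling at most doubles it;
  the initial value \<open>lam\<close> is the capacity of the source arc.\<close>

lemma history_bound:
  assumes "history L i u A"
  shows "\<exists>X. st.separates X \<and> arcs.cut (u i) X \<le> lam * 2 ^ i"
proof (cases i)
  case 0
  with assms show ?thesis
    using cut_source[of L] separates_source by (auto simp: history_def)
next
  case (Suc j)
  with assms have "st.farthest_min_cut (u j) (A j)" "arcs.cut (u j) (A j) \<le> lam * 2 ^ j"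
    "u i = st.doubled (u j) (A j)" by (auto simp: history_def)
  with st.cut_doubled_le[of "u j" "A j" "A j"] Suc show ?thesis
    by (intro exI[of _ "A j"]) (auto simp: st.farthest_min_cutD(1))
qed

lemma phase_bound:
  assumes "phase L i r v"
  shows "v \<le> lam * 2 ^ i"
proof -
  obtain u A where p: "phase_for L i r v u A" using assms by (auto simp: phase_def)
  then obtain X where "st.separates X" "arcs.cut (u i) X \<le> lam * 2 ^ i"
    using history_bound[of L i u A] by (auto simp: phase_for_def)
  with p show ?thesis by (auto simp: phase_for_def)
qed

text \<open>\<open>S\<close> is the set of vertices that reach \<open>t\<close> in the residual
  network. The tree certifies that all of \<open>S\<close> does, the closure condition that nothing
  else does; that the source \<open>n\<close> is missing means that the flow is maximum.\<close>

definition blocked :: "(nat \<Rightarrow> nat) \<Rightarrow> nat set \<Rightarrow> bool" where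
  "blocked r S \<longleftrightarrow> n \<notin> S \<and> (\<exists>lev par. in_tree S lev par t \<and> (\<forall>y\<in>S. y \<noteq> t \<longrightarrow> 0 < r (par y))) \<and>
     (\<forall>a\<in>half_arcs. 0 < r a \<longrightarrow> dst a \<in> S \<longrightarrow> src a \<in> S)"

text \<open>The complement of \<open>S\<close> has residual capacity 0, so its cut equals the flow
  value. A separating set meeting \<open>S\<close> has positive residual capacity by the tree, hence
  a strictly larger cut.\<close>

lemma blocked_farthest:
  assumes "phase_for L i r v u A" "blocked r S"
  shows "st.farthest_min_cut (u i) (- S)" "arcs.cut (u i) (- S) = v"
proof -
  obtain lev par where S: "n \<notin> S" "in_tree S lev par t" "\<And>y. y \<in> S \<Longrightarrow> y \<noteq> t \<Longrightarrow> 0 < r (par y)"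
      "\<And>a. a \<in> half_arcs \<Longrightarrow> 0 < r a \<Longrightarrow> dst a \<in> S \<Longrightarrow> src a \<in> S"
    using assms(2) unfolding blocked_def by blast
  have sep: "st.separates (- S)" using S(1,2) by (auto simp: st.separates_def in_tree_def)
  have cut: "arcs.cut (u i) X = resid r X + v" if "st.separates X" for X
    using assms(1) that by (simp add: phase_for_def)
  show eq: "arcs.cut (u i) (- S) = v"
    using cut[OF sep] resid_closed[of r S, OF S(4)] by simp
  have "v < arcs.cut (u i) X" if "st.separates X" "\<not> X \<subseteq> - S" for X
  proof -
    from that(2) obtain x where x: "x \<in> X \<inter> S" by auto
    have "t \<notin> X" using that(1) by (simp add: st.separates_def)
    from resid_meets_tree[of S lev par t r x X, OF S(2,3) x this] have "0 < resid r X" by simp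
    with cut[OF that(1)] show ?thesis by simp
  qed
  with sep eq cut show "st.farthest_min_cut (u i) (- S)"
    by (simp add: st.farthest_min_cut_def)
qed

text \<open>With flow \<open>r (e + M)\<close> unchanged, doubling the capacity
  \<open>r e + r (e + M)\<close> leaves \<open>2 * r e + r (e + M)\<close> as forward residual
  capacity. Every cut gains the same amount in capacity and in residual capacity, so
  \<open>v\<close> persists.\<close>

lemma phase_double:
  assumes "phase L i r v" "blocked r S"
    and fwd: "\<And>e. e \<le> m \<Longrightarrow> r' e = (if tl e \<notin> S \<and> hd e \<noteq> t then r e + r e + r (e + M) else r e)"
    and bwd: "\<And>e. e \<le> m \<Longrightarrow> r' (e + M) = r (e + M)"
  shows "phase L (Suc i) r' v"
proof -
  obtain u0 A0 where p: "phase_for L i r v u0 A0" using assms(1) by (auto simp: phase_def)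
  define A where "A = A0(i := - S)"
  define u where "u = u0(Suc i := st.doubled (u0 i) (- S))"
  note far = blocked_farthest[OF p assms(2)]
  have "history L (Suc i) u A"
    using p far phase_bound[OF assms(1)]
    by (auto simp: phase_for_def history_def u_def A_def less_Suc_eq)
  moreover have u': "r' e + r' (e + M) = u (Suc i) e" if "e \<le> m" for e
  proof -
    have "r e + r (e + M) = u0 i e" using p that by (simp add: phase_for_def)
    with fwd[OF that] bwd[OF that] show ?thesis by (auto simp: u_def st.doubled_def)
  qed
  moreover have "arcs.cut (u (Suc i)) X = resid r' X + v" if "st.separates X" for X
  proof -
    have "arcs.cut (u (Suc i)) X + resid r X = arcs.cut (u0 i) X + resid r' X"
      unfolding arcs.cut_def resid_eq sum.distrib[symmetric]
    proof (rule sum.cong[OF refl])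
      fix e assume "e \<in> {..m}"
      then have "r e + r (e + M) = u0 i e" "r' (e + M) = r (e + M)" "r' e + r' (e + M) = u (Suc i) e"
        using p u'[of e] bwd[of e] by (auto simp: phase_for_def)
      then show "u (Suc i) e * of_bool (arcs.crosses X e) + (r e * of_bool (tl e \<in> X \<and> hd e \<notin> X) +
          r (e + M) * of_bool (hd e \<in> X \<and> tl e \<notin> X)) =
          u0 i e * of_bool (arcs.crosses X e) + (r' e * of_bool (tl e \<in> X \<and> hd e \<notin> X) +
          r' (e + M) * of_bool (hd e \<in> X \<and> tl e \<notin> X))"
        by (auto simp: arcs.crosses_def)
    qed
    then show ?thesis using p that by (simp add: phase_for_def)
  qed
  ultimately show ?thesis by (auto simp: phase_def phase_for_def)
qed

definition dropped :: "(nat \<Rightarrow> nat) \<Rightarrow> nat set" where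
  "dropped r = {e. e < m \<and> hd e = t \<and> r (e + M) = 0}"

lemma phase_final_preserves:
  assumes "phase L k r v" "blocked r S"
  shows "preserves L (L - dropped r)"
proof -
  obtain u A0 where p: "phase_for L k r v u A0" using assms(1) by (auto simp: phase_def)
  define A where "A = A0(k := - S)"
  let ?D = "dropped r"
  note far = blocked_farthest[OF p assms(2)]
  interpret chain: doubling_chain "{..m}" tl hd n t u A k ?D
  proof
    show "st.farthest_min_cut (u i) (A i)" if "i \<le> k" for i
      using p far that by (auto simp: phase_for_def history_def A_def)
    show "u (Suc i) = st.doubled (u i) (A i)" if "i < k" for i
      using p that by (auto simp: phase_for_def history_def A_def)
    show "hd e = t" if "e \<in> ?D" for e using that by (simp add: dropped_def)
    fix X assume X: "st.separates X"
    \<comment> \<open>The arcs of \<open>?D\<close> carry no flow, so their whole capacity is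
      residual and is covered by \<open>resid r X\<close>.\<close>
    have "arcs.cut (u k) X \<le> arcs.cut (arcs.off ?D (u k)) X + resid r X"
      unfolding arcs.cut_def resid_eq sum.distrib[symmetric]
    proof (rule sum_mono)
      fix e assume "e \<in> {..m}"
      then have "r e + r (e + M) = u k e" using p by (simp add: phase_for_def)
      then show "u k e * of_bool (arcs.crosses X e) \<le> arcs.off ?D (u k) e * of_bool (arcs.crosses X e) +
          (r e * of_bool (tl e \<in> X \<and> hd e \<notin> X) + r (e + M) * of_bool (hd e \<in> X \<and> tl e \<notin> X))"
        by (auto simp: arcs.crosses_def arcs.off_def dropped_def)
    qed
    moreover have "arcs.cut (u k) X = resid r X + v" using p X by (simp add: phase_for_def)
    ultimately show "arcs.cut (u k) (A k) \<le> arcs.cut (arcs.off ?D (u k)) X"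
      using far by (simp add: A_def)
  qed
  have u0: "u 0 = caps t L" using p by (simp add: phase_for_def history_def)
  \<comment> \<open>The two weights differ only on arcs leaving \<open>t\<close>, and a separating
    set does not contain \<open>t\<close>.\<close>
  have caps: "arcs.cut (arcs.off D (arcs.off F (caps t L))) X = arcs.cut (arcs.off D (arcs.off F (wt L))) X"
    if "st.separates X" for D F X
    using that by (intro arcs.cut_cong) (auto simp: arcs.off_def caps_def wt_def arcs.crosses_def st.separates_def)
  have caps': "arcs.cut (arcs.off F (caps t L)) X = arcs.cut (arcs.off F (wt L)) X"
    if "st.separates X" for F X
    using caps[OF that, of "{}" F] by (simp add: arcs.off_off)
  have off: "arcs.off ?D (arcs.off F (wt L)) = arcs.off F (wt (L - ?D))" for F
    by (auto simp: arcs.off_def wt_def dropped_def fun_eq_iff)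
  show ?thesis
    unfolding preserves_def
  proof (intro allI impI)
    fix F v Y assume F: "F \<subseteq> {..<m} \<and> card F \<le> k \<and> n \<in> Y \<and> v \<notin> Y"
    have "\<exists>X. st.separates X \<and> arcs.cut (arcs.off F (wt L)) X \<le> arcs.cut (arcs.off ?D (arcs.off F (wt L))) Z"
      if Z: "st.separates Z" for Z
    proof -
      have "finite F" using F finite_subset[of F "{..<m}"] by blast
      moreover have "u 0 e \<le> 1" if "e \<in> F" for e using F that by (auto simp: u0 caps_def)
      ultimately obtain X where "st.separates X"
        "arcs.cut (arcs.off F (u 0)) X \<le> arcs.cut (arcs.off ?D (arcs.off F (u 0))) Z"
        using chain.single_target[of F Z] F Z by blast
      then show ?thesis using caps[OF Z] caps'[of X F] by (intro exI[of _ X]) (simp add: u0)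
    qed
    then have "\<exists>X. n \<in> X \<and> v \<notin> X \<and> arcs.cut (arcs.off F (wt L)) X \<le> arcs.cut (arcs.off ?D (arcs.off F (wt L))) Y"
      using F by (intro st.other_targets) (auto simp: dropped_def)
    then show "\<exists>X. n \<in> X \<and> v \<notin> X \<and> arcs.cut (arcs.off F (wt L)) X \<le> arcs.cut (arcs.off F (wt (L - ?D))) Y"
      by (simp add: off)
  qed
qed

text \<open>Compare capacities around \<open>t\<close>: every retained arc into \<open>t\<close>
  carries at least one unit and no flow leaves \<open>t\<close>, so the number of retained arcs is
  at most the flow value. Loops at \<open>t\<close> have capacity 0 and are dropped.\<close>

lemma phase_final_card:
  assumes "phase L i r v" "L \<subseteq> {..<m}"
  shows "card {e \<in> L - dropped r. hd e = t} \<le> lam * 2 ^ i"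
proof -
  obtain u A where p: "phase_for L i r v u A" using assms(1) by (auto simp: phase_def)
  then have hist: "history L i u A" by (simp add: phase_for_def)
  have "u j e = 0" if "j \<le> i" "e \<le> m" "tl e = t" for j e
    using that(1)
  proof (induction j)
    case 0
    show ?case using hist that t_bounded by (auto simp: history_def caps_def tl_m)
  next
    case (Suc j)
    then show ?case using hist by (simp add: history_def st.doubled_def)
  qed
  then have out: "r (e + M) = 0" if "e \<le> m" "tl e = t" for e
    using that p by (auto simp: phase_for_def)
  have sep: "st.separates (- {t})" using t_bounded by (simp add: st.separates_def)
  have sub: "{e \<in> L - dropped r. hd e = t} \<subseteq> {..m}" using assms(2) by auto
  have "card {e \<in> L - dropped r. hd e = t} + resid r (- {t}) \<le> arcs.cut (u i) (- {t})"
  proof -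
    have "card {e \<in> L - dropped r. hd e = t} = (\<Sum>e\<le>m. of_bool (e \<in> {e \<in> L - dropped r. hd e = t}))"
      using sub by (simp add: of_bool_def sum.If_cases Int_absorb1)
    moreover have "(\<Sum>e\<le>m. of_bool (e \<in> {e \<in> L - dropped r. hd e = t})) + resid r (- {t}) \<le> arcs.cut (u i) (- {t})"
      unfolding arcs.cut_def resid_eq sum.distrib[symmetric]
    proof (rule sum_mono)
      fix e assume "e \<in> {..m}"
      then have "r e + r (e + M) = u i e" "tl e = t \<Longrightarrow> r (e + M) = 0" using p out by (auto simp: phase_for_def)
      moreover have "e < m" if "e \<in> L" using assms(2) that by auto
      ultimately show "of_bool (e \<in> {e \<in> L - dropped r. hd e = t}) +
          (r e * of_bool (tl e \<in> - {t} \<and> hd e \<notin> - {t}) + r (e + M) * of_bool (hd e \<in> - {t} \<and> tl e \<notin> - {t}))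
          \<le> u i e * of_bool (arcs.crosses (- {t}) e)"
        by (auto simp: arcs.crosses_def dropped_def)
    qed
    ultimately show ?thesis by simp
  qed
  moreover have "arcs.cut (u i) (- {t}) = resid r (- {t}) + v" using p sep by (simp add: phase_for_def)
  ultimately show ?thesis using phase_bound[OF assms(1)] by simp
qed

end

section \<open>Programs with time credits\<close>

text \<open>The predicate \<open>Q\<close> receives the final memory and the credits that are left over from \<open>c\<close>.\<close>

definition wp :: "prog \<Rightarrow> (mem \<Rightarrow> nat \<Rightarrow> bool) \<Rightarrow> mem \<Rightarrow> nat \<Rightarrow> bool" where
  "wp p Q \<sigma> c \<longleftrightarrow> (\<exists>T \<tau>. run p \<sigma> T \<tau> \<and> T \<le> c \<and> Q \<tau> (c - T))"

lemma wp_iff: "run p \<sigma> T \<tau> \<Longrightarrow> wp p Q \<sigma> c \<longleftrightarrow> T \<le> c \<and> Q \<tau> (c - T)"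
  unfolding wp_def using run_deterministic by blast

lemmas wp_Skip = wp_iff[OF run.skip]
  and wp_Assign = wp_iff[OF run.assign]
  and wp_Store = wp_iff[OF run.store]

lemma wp_Seq: "wp (Seq p q) Q \<sigma> c \<longleftrightarrow> wp p (wp q Q) \<sigma> c"
proof
  assume "wp (Seq p q) Q \<sigma> c"
  then obtain T1 T2 \<rho> \<tau> where "run p \<sigma> T1 \<rho>" "run q \<rho> T2 \<tau>" "T1 + T2 \<le> c" "Q \<tau> (c - (T1 + T2))"
    unfolding wp_def by (blast elim: run_SeqE)
  then show "wp p (wp q Q) \<sigma> c"
    unfolding wp_def by (intro exI[of _ T1] exI[of _ \<rho>] conjI exI[of _ T2] exI[of _ \<tau>]) auto
next
  assume "wp p (wp q Q) \<sigma> c"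
  then obtain T1 T2 \<rho> \<tau> where "run p \<sigma> T1 \<rho>" "T1 \<le> c" "run q \<rho> T2 \<tau>" "T2 \<le> c - T1" "Q \<tau> (c - T1 - T2)"
    unfolding wp_def by blast
  then show "wp (Seq p q) Q \<sigma> c"
    unfolding wp_def by (intro exI[of _ "T1 + T2"] exI[of _ \<tau>] conjI run.seq[of p \<sigma> T1 \<rho>]) auto
qed

text \<open>Every iteration costs at least one credit, so no separate termination measure is needed.\<close>

lemma wp_Loop:
  assumes "I \<sigma> c"
    and step: "\<And>\<sigma> c. I \<sigma> c \<Longrightarrow> test_val b \<sigma> \<Longrightarrow>
      test_time b + 1 \<le> c \<and> wp p I \<sigma> (c - (test_time b + 1))"
    and exit: "\<And>\<sigma> c. I \<sigma> c \<Longrightarrow> \<not> test_val b \<sigma> \<Longrightarrow>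
      test_time b + 1 \<le> c \<and> Q \<sigma> (c - (test_time b + 1))"
  shows "wp (Loop b p) Q \<sigma> c"
  using assms(1)
proof (induction c arbitrary: \<sigma> rule: less_induct)
  case (less c)
  show ?case
  proof (cases "test_val b \<sigma>")
    case True
    from step[OF less.prems True] obtain T \<rho> where T: "test_time b + 1 \<le> c" "run p \<sigma> T \<rho>"
        "T \<le> c - (test_time b + 1)" "I \<rho> (c - (test_time b + 1) - T)"
      unfolding wp_def by blast
    then have "c - (test_time b + 1) - T < c" by linarith
    from less.IH[OF this T(4)] obtain U \<tau> where U: "run (Loop b p) \<rho> U \<tau>"
        "U \<le> c - (test_time b + 1) - T" "Q \<tau> (c - (test_time b + 1) - T - U)"
      unfolding wp_def by blast
    have "run (Loop b p) \<sigma> (test_time b + 1 + T + U) \<tau>"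
      using run.loop_step[OF True T(2) U(1)] .
    then show ?thesis
      unfolding wp_def using T U by (intro exI[of _ "test_time b + 1 + T + U"] exI[of _ \<tau>]) auto
  next
    case False
    with exit[OF less.prems False] show ?thesis
      unfolding wp_def using run.loop_done[OF False] by blast
  qed
qed

lemma regs_set [simp]:
  "regs (set_reg x v \<sigma>) = (regs \<sigma>)(x := v)" "regs (set_elem a i v \<sigma>) = regs \<sigma>"
  "arrs (set_reg x v \<sigma>) = arrs \<sigma>" "arrs (set_elem a i v \<sigma>) = (arrs \<sigma>)(a := (arrs \<sigma> a)(i := v))"
  by (simp_all add: set_reg_def set_elem_def)

lemmas wp_simps = wp_Skip wp_Assign wp_Store wp_Seq

abbreviation seq_prog :: "prog \<Rightarrow> prog \<Rightarrow> prog" (infixr ";;" 55) where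
  "p ;; q \<equiv> Seq p q"

abbreviation increment :: "string \<Rightarrow> prog" where
  "increment x \<equiv> Assign x (Add (Reg x) (Lit 1))"

section \<open>Backward breadth-first search over linked lists of half arcs\<close>

context instance_data
begin

text \<open>\<^term>\<open>prv v p\<close> is the successor of the last half arc below \<^term>\<open>p\<close> that ends in \<^term>\<open>v\<close>, and
  \<^term>\<open>0::nat\<close> if there is none: the linked lists of the program are chains of such values.\<close>

definition prv :: "nat \<Rightarrow> nat \<Rightarrow> nat" where
  "prv v p = (if \<exists>a<p. dst a = v then Suc (GREATEST a. a < p \<and> dst a = v) else 0)"

lemma prv_cases:
  obtains (none) "prv v p = 0" "\<And>a. a < p \<Longrightarrow> dst a \<noteq> v"
  | (some) a where "prv v p = Suc a" "a < p" "dst a = v" "\<And>b. b < p \<Longrightarrow> dst b = v \<Longrightarrow> b \<le> a"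
proof (cases "\<exists>a<p. dst a = v")
  case True
  then obtain a where a: "a < p \<and> dst a = v" by blast
  let ?g = "GREATEST a. a < p \<and> dst a = v"
  have "?g < p \<and> dst ?g = v"
    by (rule GreatestI_nat[where b = p]) (use a in auto)
  moreover have "b \<le> ?g" if "b < p" "dst b = v" for b
    by (rule Greatest_le_nat[where b = p]) (use that in auto)
  ultimately show ?thesis using True some[of ?g] by (auto simp: prv_def)
next
  case False
  then show ?thesis using none by (auto simp: prv_def)
qed

lemma prv_0: "prv v 0 = 0"
  by (simp add: prv_def)

lemma prv_Suc: "prv v (Suc p) = (if dst p = v then Suc p else prv v p)"
proof (cases "dst p = v")
  case True
  show ?thesis
    by (insert True, rule prv_cases[where v = v and p = "Suc p"]) (auto simp: less_Suc_eq_le intro: le_antisym)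
next
  case False
  then have "a < Suc p \<and> dst a = v \<longleftrightarrow> a < p \<and> dst a = v" for a by (auto simp: less_Suc_eq)
  with False show ?thesis by (simp add: prv_def)
qed

text \<open>Allows a list pointer to be read as a threshold on half-arc numbers, which is how
  \<open>pending\<close> treats the rest of a list.\<close>

lemma less_prv: "a < prv v p \<and> dst a = v \<longleftrightarrow> a < p \<and> dst a = v"
  by (rule prv_cases[where v = v and p = p]) (auto simp: less_Suc_eq_le)

text \<open>The half arcs still to be scanned: those into vertices not yet taken from the queue, and
  the rest of the current list. Here \<open>h\<close> counts the removed vertices, so
  \<open>q (h - 1)\<close> is the current one, and \<open>p = 0\<close> marks the end of its list.
  The cardinality pays for the scanning steps.\<close>

definition pending :: "(nat \<Rightarrow> nat) \<Rightarrow> nat \<Rightarrow> nat \<Rightarrow> nat set" where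
  "pending q h p = {a \<in> half_arcs. dst a \<notin> q ` {..<h} \<or> (0 < p \<and> dst a = q (h - 1) \<and> a < p)}"

text \<open>A parent arc leads to an earlier queue position; these positions later serve as the
  levels of the search tree.\<close>

definition queue_state :: "nat \<Rightarrow> (nat \<Rightarrow> nat) \<Rightarrow> (nat \<Rightarrow> nat) \<Rightarrow> (nat \<Rightarrow> nat) \<Rightarrow> (nat \<Rightarrow> nat) \<Rightarrow>
    nat \<Rightarrow> bool" where
  "queue_state t r q mark par e \<longleftrightarrow>
     0 < e \<and> q 0 = t \<and> inj_on q {..<e} \<and> q ` {..<e} \<subseteq> {..n} \<and>
     (\<forall>v\<le>n. mark v \<noteq> 0 \<longleftrightarrow> v \<in> q ` {..<e}) \<and>
     (\<forall>j<e. 0 < j \<longrightarrow> par (q j) \<in> half_arcs \<and> src (par (q j)) = q j \<and> 0 < r (par (q j)) \<and>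
        (\<exists>i<j. dst (par (q j)) = q i))"

definition search_state :: "nat \<Rightarrow> (nat \<Rightarrow> nat) \<Rightarrow> (nat \<Rightarrow> nat) \<Rightarrow> (nat \<Rightarrow> nat) \<Rightarrow> (nat \<Rightarrow> nat) \<Rightarrow>
    nat \<Rightarrow> nat \<Rightarrow> nat \<Rightarrow> bool" where
  "search_state t r q mark par h e p \<longleftrightarrow> queue_state t r q mark par e \<and> h \<le> e \<and>
     (0 < p \<longrightarrow> 0 < h \<and> p \<le> M + M \<and> dst (p - 1) = q (h - 1)) \<and>
     (\<forall>a\<in>half_arcs. a \<notin> pending q h p \<longrightarrow> 0 < r a \<longrightarrow> src a \<in> q ` {..<e})"

lemma search_state_marked:
  assumes "search_state t r q mark par h e p" "v \<le> n"
  shows "mark v \<noteq> 0 \<longleftrightarrow> v \<in> q ` {..<e}"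
  using assms by (simp add: search_state_def queue_state_def)

lemma search_state_closed:
  assumes "search_state t r q mark par h e p" "a \<in> half_arcs" "a \<notin> pending q h p" "0 < r a"
  shows "src a \<in> q ` {..<e}"
  using assms by (simp add: search_state_def)

lemma finite_pending: "finite (pending q h p)"
  using finite_R by (simp add: pending_def)

lemma search_state_le:
  assumes "search_state t r q mark par h e p"
  shows "e \<le> n + 1"
proof -
  have "inj_on q {..<e}" "q ` {..<e} \<subseteq> {..n}"
    using assms by (simp_all add: search_state_def queue_state_def)
  then show ?thesis using card_mono[of "{..n}" "q ` {..<e}"] by (simp add: card_image)
qed

lemma search_state_init:
  assumes "t < n" "\<And>v. v \<le> n \<Longrightarrow> mark v = of_bool (v = t)" "q 0 = t"
  shows "search_state t r q mark par 0 (Suc 0) 0"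
  using assms by (auto simp: search_state_def queue_state_def pending_def lessThan_Suc)

text \<open>Half arcs into \<open>q h\<close> move from the first disjunct of \<open>pending\<close>
  to the second. Injectivity of the queue ensures that \<open>q h\<close> was not removed
  before.\<close>

lemma search_state_pop:
  assumes "search_state t r q mark par h e 0" "h < e"
  shows "search_state t r q mark par (Suc h) e (prv (q h) (M + M))"
    "pending q (Suc h) (prv (q h) (M + M)) = pending q h 0"
proof -
  have new: "q h \<notin> q ` {..<h}"
  proof
    assume "q h \<in> q ` {..<h}"
    then obtain j where "j < h" "q h = q j" by auto
    moreover have "inj_on q {..<e}" using assms(1) by (simp add: search_state_def queue_state_def)
    ultimately show False using inj_onD[of q "{..<e}" h j] assms(2) by simp
  qed
  show eq: "pending q (Suc h) (prv (q h) (M + M)) = pending q h 0"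
  proof (rule set_eqI)
    fix a
    have "0 < prv (q h) (M + M) \<and> dst a = q h \<and> a < prv (q h) (M + M) \<longleftrightarrow> a \<in> half_arcs \<and> dst a = q h"
      using less_prv[of a "q h" "M + M"] unfolding half_arcs_def lessThan_iff by linarith
    moreover have "dst a \<notin> q ` {..<Suc h} \<longleftrightarrow> dst a \<notin> q ` {..<h} \<and> dst a \<noteq> q h"
      by (auto simp: lessThan_Suc)
    ultimately show "a \<in> pending q (Suc h) (prv (q h) (M + M)) \<longleftrightarrow> a \<in> pending q h 0"
      unfolding pending_def using new by (cases "dst a = q h") simp_all
  qed
  have "dst (prv (q h) (M + M) - 1) = q h \<and> prv (q h) (M + M) \<le> M + M" if "0 < prv (q h) (M + M)"
    by (insert that, rule prv_cases[where v = "q h" and p = "M + M"]) auto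
  with assms show "search_state t r q mark par (Suc h) e (prv (q h) (M + M))"
    unfolding search_state_def eq by simp
qed

lemma pending_next:
  assumes "search_state t r q mark par h e (Suc a)"
  shows "pending q h (prv (dst a) a) = pending q h (Suc a) - {a}" "a \<in> pending q h (Suc a)"
proof -
  have a: "dst a = q (h - 1)" "0 < h" "a \<in> half_arcs"
    using assms by (auto simp: search_state_def half_arcs_def)
  then show "a \<in> pending q h (Suc a)" by (simp add: pending_def)
  have "q (h - 1) \<in> q ` {..<h}" using a(2) by auto
  show "pending q h (prv (dst a) a) = pending q h (Suc a) - {a}"
  proof (rule set_eqI)
    fix b
    have "0 < prv (dst a) a \<and> dst b = dst a \<and> b < prv (dst a) a \<longleftrightarrow> b < a \<and> dst b = dst a"
      using less_prv[of b "dst a" a] by linarith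
    then have "b \<in> pending q h (prv (dst a) a) \<longleftrightarrow>
        b \<in> half_arcs \<and> (dst b \<notin> q ` {..<h} \<or> b < a \<and> dst b = dst a)"
      unfolding pending_def a(1) by blast
    also have "\<dots> \<longleftrightarrow> b \<in> pending q h (Suc a) - {a}"
      using \<open>q (h - 1) \<in> q ` {..<h}\<close> a(1) unfolding pending_def less_Suc_eq by auto
    finally show "b \<in> pending q h (prv (dst a) a) \<longleftrightarrow> b \<in> pending q h (Suc a) - {a}" .
  qed
qed

lemma prv_next:
  assumes "search_state t r q mark par h e (Suc a)" "0 < prv (dst a) a"
  shows "0 < h \<and> prv (dst a) a \<le> M + M \<and> dst (prv (dst a) a - 1) = q (h - 1)"
  by (insert assms, rule prv_cases[where v = "dst a" and p = a]) (auto simp: search_state_def)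

lemma search_state_closed_next:
  assumes st: "search_state t r q mark par h e (Suc a)"
    and "b \<in> half_arcs" "b \<notin> pending q h (prv (dst a) a)" "0 < r b" "b \<noteq> a"
  shows "src b \<in> q ` {..<e}"
  using search_state_closed[OF st] pending_next(1)[OF st] assms by simp

lemma search_state_skip:
  assumes st: "search_state t r q mark par h e (Suc a)" and "r a = 0 \<or> mark (src a) \<noteq> 0"
  shows "search_state t r q mark par h e (prv (dst a) a)"
proof -
  have "src a \<in> q ` {..<e}" if "0 < r a"
    using search_state_marked[OF st src_le[of a]] assms(2) that by simp
  then have "src b \<in> q ` {..<e}"
    if "b \<in> half_arcs" "b \<notin> pending q h (prv (dst a) a)" "0 < r b" for b
    using search_state_closed_next[OF st that] that(3) by (cases "b = a") simp_all
  moreover have "queue_state t r q mark par e" "h \<le> e" using st by (simp_all add: search_state_def)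
  ultimately show ?thesis using prv_next[OF st] unfolding search_state_def by blast
qed

lemma queue_state_insert:
  assumes st: "queue_state t r q mark par e"
    and a: "a \<in> half_arcs" "0 < r a" "mark (src a) = 0" "dst a \<in> q ` {..<e}"
  shows "queue_state t r (q(e := src a)) (mark(src a := 1)) (par(src a := a)) (Suc e)"
proof -
  let ?q = "q(e := src a)" and ?par = "par(src a := a)"
  have img: "?q ` {..<Suc e} = insert (src a) (q ` {..<e})"
    by (auto simp: lessThan_Suc)
  have new: "src a \<notin> q ` {..<e}" using st a(3) src_le[of a] by (auto simp: queue_state_def)
  have "inj_on q {..<e}" using st by (simp add: queue_state_def)
  then have "inj_on ?q {..<Suc e}"
    using new by (auto simp: lessThan_Suc inj_on_fun_updI)
  moreover have "?par (?q j) \<in> half_arcs \<and> src (?par (?q j)) = ?q j \<and> 0 < r (?par (?q j)) \<and>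
      (\<exists>i<j. dst (?par (?q j)) = ?q i)" if "j < Suc e" "0 < j" for j
  proof (cases "j = e")
    case True
    from a(4) obtain i where "i < e" "dst a = q i" by auto
    with True a show ?thesis by (auto intro!: exI[of _ i])
  next
    case False
    then have "j < e" using that by simp
    then have "q j \<noteq> src a" using new image_eqI[of _ q j] by fastforce
    moreover obtain i where "i < j" "dst (par (q j)) = q i" "par (q j) \<in> half_arcs"
        "src (par (q j)) = q j" "0 < r (par (q j))"
      using st \<open>0 < j\<close> \<open>j < e\<close> unfolding queue_state_def by blast
    ultimately show ?thesis using \<open>j < e\<close> by (auto intro!: exI[of _ i])
  qed
  moreover have "?q 0 = t" using st by (auto simp: queue_state_def)
  moreover have "insert (src a) (q ` {..<e}) \<subseteq> {..n}"
    using st src_le[of a] by (auto simp: queue_state_def)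
  moreover have "(mark(src a := 1)) v \<noteq> 0 \<longleftrightarrow> v \<in> insert (src a) (q ` {..<e})" if "v \<le> n" for v
    using st that by (auto simp: queue_state_def)
  ultimately show ?thesis unfolding queue_state_def img by simp
qed

text \<open>The new vertex is written at position \<open>e\<close>, beyond the removed prefix of
  length \<open>h\<close>, so appending it makes no half arc pending or settled.\<close>

lemma search_state_take:
  assumes st: "search_state t r q mark par h e (Suc a)" and "0 < r a" "mark (src a) = 0"
  shows "search_state t r (q(e := src a)) (mark(src a := 1)) (par(src a := a)) h (Suc e) (prv (dst a) a)"
    "pending (q(e := src a)) h p = pending q h p"
proof -
  have h: "h \<le> e" "0 < h" "dst a = q (h - 1)" "a \<in> half_arcs" "queue_state t r q mark par e"
    using st by (auto simp: search_state_def half_arcs_def)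
  have "(q(e := src a)) ` {..<h} = q ` {..<h}"
    using h(1) by auto
  then show pend: "pending (q(e := src a)) h p = pending q h p" for p
    using h(1,2) unfolding pending_def by auto
  have "dst a \<in> q ` {..<e}" using h(1-3) by auto
  then have "queue_state t r (q(e := src a)) (mark(src a := 1)) (par(src a := a)) (Suc e)"
    using h(4,5) assms(2,3) by (intro queue_state_insert)
  moreover have "src b \<in> (q(e := src a)) ` {..<Suc e}"
    if "b \<in> half_arcs" "b \<notin> pending q h (prv (dst a) a)" "0 < r b" for b
    using search_state_closed_next[OF st that] by (cases "b = a") (auto simp: lessThan_Suc)
  moreover have "(q(e := src a)) (h - 1) = q (h - 1)" using h(1,2) by auto
  ultimately show "search_state t r (q(e := src a)) (mark(src a := 1)) (par(src a := a)) h (Suc e) (prv (dst a) a)"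
    unfolding search_state_def pend using h(1) prv_next[OF st] by auto
qed

text \<open>When the queue is exhausted nothing that ends in \<open>S\<close> is pending, so
  \<open>S\<close> is closed; the level of a vertex is its queue position.\<close>

lemma search_state_tree:
  assumes "search_state t r q mark par e e 0"
  defines "S \<equiv> q ` {..<e}" and "lev \<equiv> inv_into {..<e} q"
  shows "in_tree S lev par t" "\<And>y. y \<in> S \<Longrightarrow> y \<noteq> t \<Longrightarrow> 0 < r (par y)"
    "\<And>a. a \<in> half_arcs \<Longrightarrow> 0 < r a \<Longrightarrow> dst a \<in> S \<Longrightarrow> src a \<in> S"
    "\<And>y. y \<in> S \<Longrightarrow> lev y \<le> n" "\<And>v. v \<le> n \<Longrightarrow> mark v \<noteq> 0 \<longleftrightarrow> v \<in> S"
proof -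
  have st: "queue_state t r q mark par e" using assms(1) by (simp add: search_state_def)
  then have inj: "inj_on q {..<e}" and e: "0 < e" "q 0 = t" by (simp_all add: queue_state_def)
  have lev: "lev (q j) = j" if "j < e" for j
    unfolding lev_def using inj that by (intro inv_into_f_f) auto
  have "t \<in> S" using e by (auto simp: S_def)
  have y: "par y \<in> half_arcs \<and> src (par y) = y \<and> dst (par y) \<in> S \<and> lev (dst (par y)) < lev y \<and> 0 < r (par y)"
    if "y \<in> S" "y \<noteq> t" for y
  proof -
    obtain j where j: "y = q j" "j < e" using \<open>y \<in> S\<close> by (auto simp: S_def)
    with that e have "0 < j" by (auto intro: gr_zeroI)
    with st j(2) obtain i where "i < j" "dst (par (q j)) = q i" "par (q j) \<in> half_arcs"
        "src (par (q j)) = q j" "0 < r (par (q j))"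
      unfolding queue_state_def by blast
    with j show ?thesis by (auto simp: lev S_def)
  qed
  then show "in_tree S lev par t" "\<And>y. y \<in> S \<Longrightarrow> y \<noteq> t \<Longrightarrow> 0 < r (par y)"
    using \<open>t \<in> S\<close> unfolding in_tree_def by blast+
  show "src a \<in> S" if "a \<in> half_arcs" "0 < r a" "dst a \<in> S" for a
    using search_state_closed[OF assms(1)] that by (simp add: pending_def S_def)
  show "lev y \<le> n" if "y \<in> S" for y
    using that lev search_state_le[OF assms(1)] by (auto simp: S_def)
  show "mark v \<noteq> 0 \<longleftrightarrow> v \<in> S" if "v \<le> n" for v
    using search_state_marked[OF assms(1) that] by (simp add: S_def)
qed

end

section \<open>The program and its verification\<close>

definition clear_prog :: prog where
  "clear_prog =
     Assign ''j'' (Lit 0);;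
     Loop (Less (Reg ''j'') (Add (Reg ''n'') (Lit 1)))
       (Store ''mark'' (Reg ''j'') (Lit 0);; increment ''j'');;
     Store ''mark'' (Reg ''t'') (Lit 1);;
     Store ''queue'' (Lit 0) (Reg ''t'');;
     Assign ''done'' (Lit 0);;
     Assign ''seen'' (Lit 1);;
     Assign ''p'' (Lit 0)"

text \<open>\<open>done\<close> and \<open>seen\<close> are the positions \<open>h\<close> and
  \<open>e\<close> of \<open>search_state\<close>, and \<open>p\<close> is one more than the next
  half arc. Removing a vertex and scanning a half arc share a single loop, so that a single
  potential bounds the time.\<close>

definition explore_prog :: prog where
  "explore_prog =
     Loop (Negate (Both (Equal (Reg ''p'') (Lit 0)) (Equal (Reg ''done'') (Reg ''seen''))))
       (Branch (Equal (Reg ''p'') (Lit 0))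
         (Assign ''p'' (Elem ''first'' (Elem ''queue'' (Reg ''done'')));; increment ''done'')
         (Assign ''p'' (Sub (Reg ''p'') (Lit 1));;
          Assign ''x'' (Elem ''src'' (Reg ''p''));;
          Branch (Both (Less (Lit 0) (Elem ''r'' (Reg ''p''))) (Equal (Elem ''mark'' (Reg ''x'')) (Lit 0)))
            (Store ''mark'' (Reg ''x'') (Lit 1);;
             Store ''par'' (Reg ''x'') (Reg ''p'');;
             Store ''queue'' (Reg ''seen'') (Reg ''x'');;
             increment ''seen'')
            Skip;;
          Assign ''p'' (Elem ''next'' (Reg ''p''))))"

definition search_prog :: prog where
  "search_prog = clear_prog;; explore_prog"

definition augment_prog :: prog where
  "augment_prog =
     Assign ''x'' (Reg ''n'');;
     Loop (Negate (Equal (Reg ''x'') (Reg ''t'')))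
       (Assign ''p'' (Elem ''par'' (Reg ''x''));;
        Store ''r'' (Reg ''p'') (Sub (Elem ''r'' (Reg ''p'')) (Lit 1));;
        Branch (Less (Reg ''p'') (Reg ''M''))
          (Store ''r'' (Add (Reg ''p'') (Reg ''M'')) (Add (Elem ''r'' (Add (Reg ''p'') (Reg ''M''))) (Lit 1)))
          (Store ''r'' (Sub (Reg ''p'') (Reg ''M'')) (Add (Elem ''r'' (Sub (Reg ''p'') (Reg ''M''))) (Lit 1)));;
        Assign ''x'' (Elem ''dst'' (Reg ''p'')))"

definition double_prog :: prog where
  "double_prog =
     Assign ''j'' (Lit 0);;
     Loop (Less (Reg ''j'') (Reg ''M''))
       (Branch (Both (Equal (Elem ''mark'' (Elem ''tail'' (Reg ''j''))) (Lit 0))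
                (Negate (Equal (Elem ''head'' (Reg ''j'')) (Reg ''t''))))
         (Store ''r'' (Reg ''j'') (Add (Add (Elem ''r'' (Reg ''j'')) (Elem ''r'' (Reg ''j'')))
            (Elem ''r'' (Add (Reg ''j'') (Reg ''M'')))))
         Skip;;
        increment ''j'')"

definition caps_prog :: prog where
  "caps_prog =
     Assign ''j'' (Lit 0);;
     Loop (Less (Reg ''j'') (Reg ''M''))
       (Branch (Equal (Elem ''tail'' (Reg ''j'')) (Reg ''t''))
         (Store ''r'' (Reg ''j'') (Lit 0))
         (Store ''r'' (Reg ''j'') (Elem ''live'' (Reg ''j'')));;
        Store ''r'' (Add (Reg ''j'') (Reg ''M'')) (Lit 0);;
        increment ''j'');;
     Store ''r'' (Reg ''m'') (Reg ''lambda'')"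

definition drop_prog :: prog where
  "drop_prog =
     Assign ''j'' (Lit 0);;
     Loop (Less (Reg ''j'') (Reg ''m''))
       (Branch (Both (Equal (Elem ''head'' (Reg ''j'')) (Reg ''t''))
                (Equal (Elem ''r'' (Add (Reg ''j'') (Reg ''M''))) (Lit 0)))
         (Store ''live'' (Reg ''j'') (Lit 0))
         Skip;;
        increment ''j'')"

text \<open>Each iteration searches once and then either augments or completes a round. The round
  \<open>i = k\<close> also ends with a doubling; this leaves the reverse entries unchanged, which
  are all that \<open>drop_prog\<close> reads of \<open>r\<close>.\<close>

definition target_prog :: prog where
  "target_prog =
     caps_prog;;
     Assign ''i'' (Lit 0);;
     Loop (Less (Reg ''i'') (Add (Reg ''k'') (Lit 1)))
       (search_prog;;
        Branch (Equal (Elem ''mark'' (Reg ''n'')) (Lit 0))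
          (double_prog;; increment ''i'')
          augment_prog);;
     drop_prog"

definition setup_prog :: prog where
  "setup_prog =
     Assign ''M'' (Add (Reg ''m'') (Lit 1));;
     Store ''tail'' (Reg ''m'') (Reg ''n'');;
     Store ''head'' (Reg ''m'') (Reg ''s'');;
     Assign ''j'' (Lit 0);;
     Loop (Less (Reg ''j'') (Reg ''M''))
       (Store ''src'' (Reg ''j'') (Elem ''tail'' (Reg ''j''));;
        Store ''dst'' (Reg ''j'') (Elem ''head'' (Reg ''j''));;
        Store ''src'' (Add (Reg ''j'') (Reg ''M'')) (Elem ''head'' (Reg ''j''));;
        Store ''dst'' (Add (Reg ''j'') (Reg ''M'')) (Elem ''tail'' (Reg ''j''));;
        Store ''live'' (Reg ''j'') (Lit 1);;
        increment ''j'');;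
     Assign ''j'' (Lit 0);;
     Loop (Less (Reg ''j'') (Add (Reg ''M'') (Reg ''M'')))
       (Store ''next'' (Reg ''j'') (Elem ''first'' (Elem ''dst'' (Reg ''j'')));;
        Store ''first'' (Elem ''dst'' (Reg ''j'')) (Add (Reg ''j'') (Lit 1));;
        increment ''j'')"

definition output_prog :: prog where
  "output_prog =
     Assign ''j'' (Lit 0);;
     Loop (Less (Reg ''j'') (Reg ''m''))
       (Branch (Equal (Elem ''live'' (Reg ''j'')) (Lit 0))
         Skip
         (Store ''tail_out'' (Reg ''m_out'') (Elem ''tail'' (Reg ''j''));;
          Store ''head_out'' (Reg ''m_out'') (Elem ''head'' (Reg ''j''));;
          increment ''m_out'');;
        increment ''j'')"

definition targets_prog :: prog where
  "targets_prog =
     Assign ''t'' (Lit 0);;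
     Loop (Less (Reg ''t'') (Reg ''n''))
       (Branch (Equal (Elem ''first'' (Reg ''t'')) (Lit 0)) Skip target_prog;;
        increment ''t'')"

definition preserver_prog :: prog where
  "preserver_prog =
     Branch (Equal (Reg ''m'') (Lit 0))
       Skip
       (setup_prog;; targets_prog;; output_prog)"

lemma wp_delay:
  assumes "\<And>T \<tau>. run p \<sigma> T \<tau> \<longleftrightarrow> (\<exists>U. T = d + U \<and> run q \<sigma> U \<tau>)"
  shows "wp p Q \<sigma> c \<longleftrightarrow> d \<le> c \<and> wp q Q \<sigma> (c - d)"
proof
  assume "wp p Q \<sigma> c"
  then obtain U \<tau> where "run q \<sigma> U \<tau>" "d + U \<le> c" "Q \<tau> (c - (d + U))"
    unfolding wp_def assms by blast
  then show "d \<le> c \<and> wp q Q \<sigma> (c - d)"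
    unfolding wp_def by (intro conjI exI[of _ U] exI[of _ \<tau>]) auto
next
  assume "d \<le> c \<and> wp q Q \<sigma> (c - d)"
  then obtain U \<tau> where "run q \<sigma> U \<tau>" "d \<le> c" "U \<le> c - d" "Q \<tau> (c - d - U)"
    unfolding wp_def by blast
  then show "wp p Q \<sigma> c"
    unfolding wp_def assms by (intro exI[of _ "d + U"] exI[of _ \<tau>]) auto
qed

lemma run_Branch_iff:
  "run (Branch b p q) \<sigma> T \<tau> \<longleftrightarrow> (\<exists>U. T = test_time b + 1 + U \<and> run (if test_val b \<sigma> then p else q) \<sigma> U \<tau>)"
proof
  assume "run (Branch b p q) \<sigma> T \<tau>"
  then show "\<exists>U. T = test_time b + 1 + U \<and> run (if test_val b \<sigma> then p else q) \<sigma> U \<tau>"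
    by (rule run_BranchE) auto
next
  assume "\<exists>U. T = test_time b + 1 + U \<and> run (if test_val b \<sigma> then p else q) \<sigma> U \<tau>"
  then obtain U where "T = test_time b + 1 + U" "run (if test_val b \<sigma> then p else q) \<sigma> U \<tau>" by blast
  then show "run (Branch b p q) \<sigma> T \<tau>"
    by (cases "test_val b \<sigma>") (simp_all only: if_True if_False run.branch_true run.branch_false simp_thms)
qed

lemma wp_Branch: "wp (Branch b p q) Q \<sigma> c \<longleftrightarrow>
    test_time b + 1 \<le> c \<and> wp (if test_val b \<sigma> then p else q) Q \<sigma> (c - (test_time b + 1))"
  by (rule wp_delay[OF run_Branch_iff])

lemma wp_Branch_True: "test_val b \<sigma> \<Longrightarrow>
    wp (Branch b p q) Q \<sigma> c \<longleftrightarrow> test_time b + 1 \<le> c \<and> wp p Q \<sigma> (c - (test_time b + 1))"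
  and wp_Branch_False: "\<not> test_val b \<sigma> \<Longrightarrow>
    wp (Branch b p q) Q \<sigma> c \<longleftrightarrow> test_time b + 1 \<le> c \<and> wp q Q \<sigma> (c - (test_time b + 1))"
  by (simp_all add: wp_Branch)

section \<open>Memory invariants and the cost of one target\<close>

context instance_data
begin

definition base :: "mem \<Rightarrow> bool" where
  "base \<sigma> \<longleftrightarrow> regs \<sigma> ''n'' = n \<and> regs \<sigma> ''m'' = m \<and> regs \<sigma> ''lambda'' = lam \<and> regs \<sigma> ''k'' = k \<and>
     regs \<sigma> ''M'' = M \<and> regs \<sigma> ''m_out'' = 0 \<and>
     (\<forall>e\<le>m. arrs \<sigma> ''tail'' e = tl e \<and> arrs \<sigma> ''head'' e = hd e) \<and>
     (\<forall>a\<in>half_arcs. arrs \<sigma> ''src'' a = src a \<and> arrs \<sigma> ''dst'' a = dst a \<and>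
        arrs \<sigma> ''next'' a = prv (dst a) a) \<and>
     (\<forall>v\<le>n. arrs \<sigma> ''first'' v = prv v (M + M))"

definition ctx :: "nat \<Rightarrow> nat \<Rightarrow> (nat \<Rightarrow> nat) \<Rightarrow> (nat \<Rightarrow> nat) \<Rightarrow> mem \<Rightarrow> bool" where
  "ctx t i live r \<sigma> \<longleftrightarrow> base \<sigma> \<and> regs \<sigma> ''t'' = t \<and> regs \<sigma> ''i'' = i \<and>
     arrs \<sigma> ''live'' = live \<and> arrs \<sigma> ''r'' = r"

lemma base_set_reg [simp]:
  assumes "x \<notin> {''n'', ''m'', ''lambda'', ''k'', ''M'', ''m_out''}"
  shows "base (set_reg x v \<sigma>) = base \<sigma>"
proof -
  have "regs (set_reg x v \<sigma>) y = regs \<sigma> y" if "y \<in> {''n'', ''m'', ''lambda'', ''k'', ''M'', ''m_out''}" for y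
    using assms that unfolding regs_set fun_upd_apply by metis
  then show ?thesis by (simp add: base_def del: regs_set(1))
qed

lemma base_set_elem [simp]:
  assumes "a \<notin> {''tail'', ''head'', ''src'', ''dst'', ''next'', ''first''}"
  shows "base (set_elem a i v \<sigma>) = base \<sigma>"
proof -
  have "arrs (set_elem a i v \<sigma>) y = arrs \<sigma> y" if "y \<in> {''tail'', ''head'', ''src'', ''dst'', ''next'', ''first''}" for y
    using assms that unfolding regs_set fun_upd_apply by metis
  then show ?thesis by (simp add: base_def del: regs_set(4))
qed

lemma ctx_set_reg [simp]:
  "x \<notin> {''n'', ''m'', ''lambda'', ''k'', ''M'', ''m_out'', ''t'', ''i''} \<Longrightarrow>
    ctx t i live r (set_reg x v \<sigma>) = ctx t i live r \<sigma>"
  by (auto simp: ctx_def)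

lemma ctx_set_elem [simp]:
  "a \<notin> {''tail'', ''head'', ''src'', ''dst'', ''next'', ''first'', ''live'', ''r''} \<Longrightarrow>
    ctx t i live r (set_elem a j v \<sigma>) = ctx t i live r \<sigma>"
  by (auto simp: ctx_def)

lemma ctx_set_r: "ctx t i live r \<sigma> \<Longrightarrow> ctx t i live (r(j := v)) (set_elem ''r'' j v \<sigma>)"
  by (simp add: ctx_def)

lemma ctxD:
  assumes "ctx t i live r \<sigma>"
  shows "base \<sigma>" "regs \<sigma> ''t'' = t" "regs \<sigma> ''i'' = i" "arrs \<sigma> ''live'' = live" "arrs \<sigma> ''r'' = r"
    "regs \<sigma> ''n'' = n" "regs \<sigma> ''m'' = m" "regs \<sigma> ''lambda'' = lam" "regs \<sigma> ''k'' = k" "regs \<sigma> ''M'' = M"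
    "e \<le> m \<Longrightarrow> arrs \<sigma> ''tail'' e = tl e" "e \<le> m \<Longrightarrow> arrs \<sigma> ''head'' e = hd e"
    "a \<in> half_arcs \<Longrightarrow> arrs \<sigma> ''src'' a = src a" "a \<in> half_arcs \<Longrightarrow> arrs \<sigma> ''dst'' a = dst a"
    "a \<in> half_arcs \<Longrightarrow> arrs \<sigma> ''next'' a = prv (dst a) a"
    "v \<le> n \<Longrightarrow> arrs \<sigma> ''first'' v = prv v (M + M)"
  using assms by (auto simp: ctx_def base_def)

text \<open>The cost unit of a linear pass: vertices plus half arcs, including those of the source
  arc.\<close>

definition size :: nat where "size = n + M + M"

abbreviation search_mem :: "nat \<Rightarrow> (nat \<Rightarrow> nat) \<Rightarrow> mem \<Rightarrow> bool" where
  "search_mem t r \<sigma> \<equiv> search_state t r (arrs \<sigma> ''queue'') (arrs \<sigma> ''mark'') (arrs \<sigma> ''par'')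
    (regs \<sigma> ''done'') (regs \<sigma> ''seen'') (regs \<sigma> ''p'')"

text \<open>Lets multiples of \<open>size\<close> absorb additive constants; \<open>M\<close> is at
  least 2 as there is an arc.\<close>

lemma size_ge: "n + 4 \<le> size"
proof -
  have "0 < m" using es_nonempty by simp
  then show ?thesis unfolding size_def by linarith
qed

text \<open>\<open>R\<close> is the reserve for everything that follows: the continuation may rely
  on at least \<open>R\<close> remaining credits. The later cost lemmas have the same shape.\<close>

lemma wp_clear:
  assumes ctx: "ctx t i live r \<sigma>" "t < n" and c: "R + 20 * size \<le> c"
    and Q: "\<And>\<tau> c'. ctx t i live r \<tau> \<Longrightarrow> search_mem t r \<tau> \<Longrightarrow> regs \<tau> ''done'' = 0 \<Longrightarrow>
      regs \<tau> ''p'' = 0 \<Longrightarrow> R \<le> c' \<Longrightarrow> Q \<tau> c'"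
  shows "wp clear_prog Q \<sigma> c"
  unfolding clear_prog_def wp_simps
  apply (intro conjI)
  subgoal using c size_ge by simp
  apply (rule wp_Loop[where I = "\<lambda>\<sigma> c. ctx t i live r \<sigma> \<and> regs \<sigma> ''j'' \<le> n + 1 \<and>
    (\<forall>v<regs \<sigma> ''j''. arrs \<sigma> ''mark'' v = 0) \<and> R + 20 + 14 * (n + 1 - regs \<sigma> ''j'') \<le> c"])
  subgoal using ctx c size_ge by simp
  subgoal premises p for \<sigma> c
    using p by (auto simp: wp_simps less_Suc_eq ctxD(6)[OF conjunct1[OF p(1)]])
  subgoal premises p for \<sigma> c
    using p ctx(2) by (auto simp: ctxD(2,6)[OF conjunct1[OF p(1)]] intro!: Q search_state_init)
  done

text \<open>The potential adds the pending half arcs and the vertices still to be removed from the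
  queue; each iteration consumes one of them.\<close>

lemma wp_explore:
  assumes ctx: "ctx t i live r \<sigma>" "search_mem t r \<sigma>" "regs \<sigma> ''done'' = 0" "regs \<sigma> ''p'' = 0"
    and c: "R + 70 * size \<le> c"
    and Q: "\<And>\<tau> c'. ctx t i live r \<tau> \<Longrightarrow> search_mem t r \<tau> \<Longrightarrow> regs \<tau> ''done'' = regs \<tau> ''seen'' \<Longrightarrow>
      regs \<tau> ''p'' = 0 \<Longrightarrow> R \<le> c' \<Longrightarrow> Q \<tau> c'"
  shows "wp explore_prog Q \<sigma> c"
proof -
  let ?pend = "\<lambda>\<sigma>. pending (arrs \<sigma> ''queue'') (regs \<sigma> ''done'') (regs \<sigma> ''p'')"
  let ?I = "\<lambda>\<sigma> c. ctx t i live r \<sigma> \<and> search_mem t r \<sigma> \<and>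
    R + 10 + 50 * (card (?pend \<sigma>) + (n + 1 - regs \<sigma> ''done'')) \<le> c"
  have "card (?pend \<sigma>) \<le> card half_arcs" using finite_R by (intro card_mono) (auto simp: pending_def)
  then have "card (?pend \<sigma>) \<le> M + M" by (simp add: half_arcs_def)
  show ?thesis
    unfolding explore_prog_def
  proof (rule wp_Loop[where I = ?I])
    show "?I \<sigma> c" using ctx c \<open>card (?pend \<sigma>) \<le> M + M\<close> size_ge by (simp add: size_def)
  next
    fix \<sigma> c assume I: "?I \<sigma> c" and b: "\<not> test_val (Negate (Both (Equal (Reg ''p'') (Lit 0)) (Equal (Reg ''done'') (Reg ''seen'')))) \<sigma>"
    show "test_time (Negate (Both (Equal (Reg ''p'') (Lit 0)) (Equal (Reg ''done'') (Reg ''seen'')))) + 1 \<le> c \<and>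
      Q \<sigma> (c - (test_time (Negate (Both (Equal (Reg ''p'') (Lit 0)) (Equal (Reg ''done'') (Reg ''seen'')))) + 1))"
      using I b by (auto intro!: Q)
  next
    fix \<sigma> c assume I: "?I \<sigma> c" and b: "test_val (Negate (Both (Equal (Reg ''p'') (Lit 0)) (Equal (Reg ''done'') (Reg ''seen'')))) \<sigma>"
    have ctx: "ctx t i live r \<sigma>" and st: "search_mem t r \<sigma>" using I by blast+
    have le: "regs \<sigma> ''seen'' \<le> n + 1" using search_state_le[OF st] .
    let ?q = "arrs \<sigma> ''queue''" and ?mark = "arrs \<sigma> ''mark''" and ?par = "arrs \<sigma> ''par''"
      and ?h = "regs \<sigma> ''done''" and ?e = "regs \<sigma> ''seen''"
    note [simp] = ctxD(5)[OF ctx]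
    show "test_time (Negate (Both (Equal (Reg ''p'') (Lit 0)) (Equal (Reg ''done'') (Reg ''seen'')))) + 1 \<le> c \<and>
      wp (Branch (Equal (Reg ''p'') (Lit 0))
         (Assign ''p'' (Elem ''first'' (Elem ''queue'' (Reg ''done'')));; increment ''done'')
         (Assign ''p'' (Sub (Reg ''p'') (Lit 1));;
          Assign ''x'' (Elem ''src'' (Reg ''p''));;
          Branch (Both (Less (Lit 0) (Elem ''r'' (Reg ''p''))) (Equal (Elem ''mark'' (Reg ''x'')) (Lit 0)))
            (Store ''mark'' (Reg ''x'') (Lit 1);;
             Store ''par'' (Reg ''x'') (Reg ''p'');;
             Store ''queue'' (Reg ''seen'') (Reg ''x'');;
             increment ''seen'')
            Skip;;
          Assign ''p'' (Elem ''next'' (Reg ''p'')))) ?I \<sigma>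
        (c - (test_time (Negate (Both (Equal (Reg ''p'') (Lit 0)) (Equal (Reg ''done'') (Reg ''seen'')))) + 1))"
    proof (cases "regs \<sigma> ''p''")
      case 0
      have st0: "search_state t r ?q ?mark ?par ?h ?e 0" using st 0 by simp
      have h: "?h < ?e" using b 0 st by (auto simp: search_state_def)
      then have "?q ?h \<le> n" using st by (auto simp: search_state_def queue_state_def)
      then have first: "arrs \<sigma> ''first'' (?q ?h) = prv (?q ?h) (M + M)" by (rule ctxD(16)[OF ctx])
      define d where "d = n - ?h"
      have "n + 1 - ?h = Suc d" using h le by (simp add: d_def)
      then have "R + 60 + 50 * (card (pending ?q ?h 0) + d) \<le> c"
        using I 0 by simp
      then have c: "c = (c - 60) + 60" and ge: "R + 50 * (card (pending ?q ?h 0) + d) \<le> c - 60"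
        by linarith+
      \<comment> \<open>Writing the credits as a sum lets simplification evaluate the nested
        truncated subtractions.\<close>
      obtain c1 where c: "c = c1 + 60" using c by metis
      show ?thesis
        using ge h le search_state_pop[OF st0 h] ctx 0
        by (simp add: wp_simps wp_Branch_True first d_def[symmetric] c)
    next
      case (Suc a)
      have stS: "search_state t r ?q ?mark ?par ?h ?e (Suc a)" using st Suc by simp
      then have a: "a \<in> half_arcs" by (auto simp: search_state_def half_arcs_def)
      note [simp] = ctxD(13,15)[OF ctx a]
      have "card (pending ?q ?h (Suc a)) = Suc (card (pending ?q ?h (prv (dst a) a)))"
        unfolding pending_next(1)[OF stS] using card_Suc_Diff1[OF finite_pending pending_next(2)[OF stS]] by simp
      then have "R + 60 + 50 * (card (pending ?q ?h (prv (dst a) a)) + (n + 1 - ?h)) \<le> c"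
        using I Suc by simp
      then have "c = (c - 60) + 60" and ge: "R + 50 * (card (pending ?q ?h (prv (dst a) a)) + (n + 1 - ?h)) \<le> c - 60"
        by linarith+
      then obtain c1 where c: "c = c1 + 60" by metis
      show ?thesis
      proof (cases "0 < r a \<and> ?mark (src a) = 0")
        case True
        with ge Suc ctx search_state_take[OF stS] show ?thesis
          by (simp add: wp_simps wp_Branch_True wp_Branch_False c)
      next
        case False
        with ge Suc ctx search_state_skip[OF stS] show ?thesis
          by (simp add: wp_simps wp_Branch_False c)
      qed
    qed
  qed
qed

definition searched :: "nat \<Rightarrow> (nat \<Rightarrow> nat) \<Rightarrow> mem \<Rightarrow> bool" where
  "searched t r \<sigma> \<longleftrightarrow> (\<exists>e. search_state t r (arrs \<sigma> ''queue'') (arrs \<sigma> ''mark'') (arrs \<sigma> ''par'') e e 0)"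

lemma wp_search:
  assumes ctx: "ctx t i live r \<sigma>" "t < n" and c: "R + 90 * size \<le> c"
    and Q: "\<And>\<tau> c'. ctx t i live r \<tau> \<Longrightarrow> searched t r \<tau> \<Longrightarrow> R \<le> c' \<Longrightarrow> Q \<tau> c'"
  shows "wp search_prog Q \<sigma> c"
  unfolding search_prog_def wp_simps
proof (rule wp_clear[OF ctx])
  show "(R + 70 * size) + 20 * size \<le> c" using c by simp
  fix \<tau> c' assume "ctx t i live r \<tau>" "search_mem t r \<tau>" "regs \<tau> ''done'' = 0" "regs \<tau> ''p'' = 0" "R + 70 * size \<le> c'"
  then show "wp explore_prog Q \<tau> c'"
    by (rule wp_explore) (rule Q, auto simp: searched_def)
qed

definition live_of :: "nat set \<Rightarrow> (nat \<Rightarrow> nat) \<Rightarrow> bool" where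
  "live_of L live \<longleftrightarrow> (\<forall>e<m. live e = of_bool (e \<in> L))"

text \<open>At most \<open>lam * 2 ^ k\<close> augmentations and \<open>k + 1\<close> doublings,
  each with its search, cost \<open>200 * size\<close> apiece; one more such unit pays for
  \<open>caps_prog\<close> and \<open>drop_prog\<close>.\<close>

abbreviation target_cost :: nat where
  "target_cost \<equiv> 200 * size * (lam * 2 ^ k + k + 2)"

end

context target_data
begin

lemma wp_augment:
  assumes ctx: "ctx t i live r \<sigma>" and found: "searched t r \<sigma>" "arrs \<sigma> ''mark'' n \<noteq> 0"
    and c: "R + 60 * size \<le> c"
    and Q: "\<And>r' \<tau> c'. ctx t i live r' \<tau> \<Longrightarrow> (\<And>a. a \<in> half_arcs \<Longrightarrow> r' a + r' (rev a) = r a + r (rev a)) \<Longrightarrow>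
      (\<And>X. n \<in> X \<Longrightarrow> t \<notin> X \<Longrightarrow> resid r' X + 1 = resid r X) \<Longrightarrow> R \<le> c' \<Longrightarrow> Q \<tau> c'"
  shows "wp augment_prog Q \<sigma> c"
proof -
  obtain e where st: "search_state t r (arrs \<sigma> ''queue'') (arrs \<sigma> ''mark'') (arrs \<sigma> ''par'') e e 0"
    using found(1) by (auto simp: searched_def)
  define par where "par = arrs \<sigma> ''par''"
  define S where "S = arrs \<sigma> ''queue'' ` {..<e}"
  define lev where "lev = inv_into {..<e} (arrs \<sigma> ''queue'')"
  note tree = search_state_tree[OF st, folded S_def lev_def par_def]
  have "n \<in> S" using tree(5)[of n] found(2) by simp
  \<comment> \<open>The unit in transit sits at register \<open>x\<close>: for \<open>x = n\<close>
    the cut equation says that nothing has changed, for \<open>x = t\<close> it is the required drop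
    by one. The tree found by the search stays fixed while \<open>r\<close> changes.\<close>
  define I where "I \<rho> c \<longleftrightarrow> ctx t i live (arrs \<rho> ''r'') \<rho> \<and> arrs \<rho> ''par'' = par \<and> regs \<rho> ''x'' \<in> S \<and>
    usable S lev par t (arrs \<rho> ''r'') (regs \<rho> ''x'') \<and>
    (\<forall>a\<in>half_arcs. arrs \<rho> ''r'' a + arrs \<rho> ''r'' (rev a) = r a + r (rev a)) \<and>
    (\<forall>X. n \<in> X \<and> t \<notin> X \<longrightarrow> resid (arrs \<rho> ''r'') X + 1 = resid r X + of_bool (regs \<rho> ''x'' \<in> X)) \<and>
    R + 10 + 50 * lev (regs \<rho> ''x'') \<le> c" for \<rho> c
  show ?thesis
    unfolding augment_prog_def wp_simps
  proof (rule conjI[OF _ wp_Loop[where I = I]])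
    show "expr_time (Reg ''n'') + 1 \<le> c" using c size_ge by simp
  next
    have x: "regs (set_reg ''x'' (expr_val (Reg ''n'') \<sigma>) \<sigma>) ''x'' = n" using ctx by (simp add: ctxD(6))
    have r: "arrs (set_reg ''x'' (expr_val (Reg ''n'') \<sigma>) \<sigma>) ''r'' = r" using ctx by (simp add: ctxD(5))
    have "usable S lev par t r n" using tree(2) by (simp add: usable_def)
    moreover have "R + 10 + 50 * lev n \<le> c - (expr_time (Reg ''n'') + 1)"
      using c size_ge tree(4)[OF \<open>n \<in> S\<close>] by simp
    moreover have "ctx t i live r (set_reg ''x'' (expr_val (Reg ''n'') \<sigma>) \<sigma>)" using ctx by simp
    ultimately show "I (set_reg ''x'' (expr_val (Reg ''n'') \<sigma>) \<sigma>) (c - (expr_time (Reg ''n'') + 1))"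
      unfolding I_def x r using \<open>n \<in> S\<close> by (auto simp: par_def)
  next
    fix \<rho> c assume "I \<rho> c" and b: "\<not> test_val (Negate (Equal (Reg ''x'') (Reg ''t''))) \<rho>"
    note I = \<open>I \<rho> c\<close>[unfolded I_def]
    from b have "regs \<rho> ''x'' = t" using ctxD(2)[OF conjunct1[OF I]] by simp
    with I show "test_time (Negate (Equal (Reg ''x'') (Reg ''t''))) + 1 \<le> c \<and>
        Q \<rho> (c - (test_time (Negate (Equal (Reg ''x'') (Reg ''t''))) + 1))"
      by (auto intro!: Q[where r' = "arrs \<rho> ''r''"])
  next
    fix \<rho> c assume "I \<rho> c" and b: "test_val (Negate (Equal (Reg ''x'') (Reg ''t''))) \<rho>"
    note I = \<open>I \<rho> c\<close>[unfolded I_def]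
    have ctx: "ctx t i live (arrs \<rho> ''r'') \<rho>" and par: "arrs \<rho> ''par'' = par" using I by blast+
    define x q where "x = regs \<rho> ''x''" and "q = arrs \<rho> ''r''"
    define p where "p = par x"
    have x: "x \<in> S" "x \<noteq> t" and us: "usable S lev par t q x"
      using I b ctxD(2)[OF ctx] by (auto simp: x_def q_def)
    have p: "p \<in> half_arcs" "src p = x" "dst p \<in> S" "lev (dst p) < lev x" "0 < q p"
      using tree(1) us x by (auto simp: in_tree_def usable_def p_def)
    have push: "usable S lev par t (push p q) (dst p)"
      using usable_push[OF tree(1) us x] by (simp add: p_def)
    have sums: "\<forall>a\<in>half_arcs. push p q a + push p q (rev a) = r a + r (rev a)"
      using I push_sum[of p q, OF p(1,5)] by (simp add: q_def)
    have res: "\<forall>X. n \<in> X \<and> t \<notin> X \<longrightarrow> resid (push p q) X + 1 = resid r X + of_bool (dst p \<in> X)"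
    proof (intro allI impI)
      fix X assume "n \<in> X \<and> t \<notin> X"
      then have "resid q X + 1 = resid r X + of_bool (x \<in> X)" using I by (simp add: q_def x_def)
      then show "resid (push p q) X + 1 = resid r X + of_bool (dst p \<in> X)"
        using resid_push[of p q X, OF p(1,5)] p(2) by simp
    qed
    have "R + 60 + 50 * lev (dst p) \<le> c" using I p(4) unfolding x_def[symmetric] by linarith
    then have "c = (c - 50) + 50" and ge: "R + 10 + 50 * lev (dst p) \<le> c - 50" by linarith+
    then obtain c1 where c: "c = c1 + 50" by metis
    have fin: "I \<rho>' c'" if "c1 \<le> c'" "base \<rho>'" "regs \<rho>' ''t'' = t" "regs \<rho>' ''i'' = i" "arrs \<rho>' ''live'' = live"
      "arrs \<rho>' ''par'' = par" "regs \<rho>' ''x'' = dst p" "arrs \<rho>' ''r'' = push p q" for \<rho>' c'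
      using that push sums res p(3) ge c by (simp add: ctx_def I_def)
    have xr: "regs \<rho> ''x'' = x" "arrs \<rho> ''r'' = q" "regs \<rho> ''M'' = M" "arrs \<rho> ''dst'' p = dst p"
      using ctxD(10)[OF ctx] ctxD(14)[OF ctx p(1)] by (simp_all add: x_def q_def)
    have base: "base \<rho>" "regs \<rho> ''t'' = t" "regs \<rho> ''i'' = i" "arrs \<rho> ''live'' = live"
      using ctx by (simp_all add: ctxD)
    show "test_time (Negate (Equal (Reg ''x'') (Reg ''t''))) + 1 \<le> c \<and>
      wp (Assign ''p'' (Elem ''par'' (Reg ''x''));;
        Store ''r'' (Reg ''p'') (Sub (Elem ''r'' (Reg ''p'')) (Lit 1));;
        Branch (Less (Reg ''p'') (Reg ''M''))
          (Store ''r'' (Add (Reg ''p'') (Reg ''M'')) (Add (Elem ''r'' (Add (Reg ''p'') (Reg ''M''))) (Lit 1)))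
          (Store ''r'' (Sub (Reg ''p'') (Reg ''M'')) (Add (Elem ''r'' (Sub (Reg ''p'') (Reg ''M''))) (Lit 1)));;
        Assign ''x'' (Elem ''dst'' (Reg ''p''))) I \<rho>
        (c - (test_time (Negate (Equal (Reg ''x'') (Reg ''t''))) + 1))"
    proof (cases "p < M")
      case True
      then show ?thesis unfolding c
        by (simp add: wp_simps wp_Branch_True xr par p_def[symmetric])
          (rule fin, simp_all add: base xr par push_def rev_def fun_eq_iff)
    next
      case False
      then have "p - Suc m \<noteq> p" by linarith
      with False show ?thesis unfolding c
        by (simp add: wp_simps wp_Branch_False xr par p_def[symmetric])
          (rule fin, simp_all add: base xr par push_def rev_def fun_eq_iff)
    qed
  qed
qed

lemma wp_double:
  assumes ctx: "ctx t i live r \<sigma>" and c: "R + 60 * size \<le> c"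
    and Q: "\<And>r' \<tau> c'. ctx t i live r' \<tau> \<Longrightarrow>
      (\<And>e. e \<le> m \<Longrightarrow> r' e = (if arrs \<sigma> ''mark'' (tl e) = 0 \<and> hd e \<noteq> t then r e + r e + r (e + M) else r e)) \<Longrightarrow>
      (\<And>e. e \<le> m \<Longrightarrow> r' (e + M) = r (e + M)) \<Longrightarrow> R \<le> c' \<Longrightarrow> Q \<tau> c'"
  shows "wp double_prog Q \<sigma> c"
proof -
  let ?d = "\<lambda>j e. if e < j \<and> arrs \<sigma> ''mark'' (tl e) = 0 \<and> hd e \<noteq> t then r e + r e + r (e + M) else r e"
  let ?I = "\<lambda>\<rho> c. ctx t i live (?d (regs \<rho> ''j'')) \<rho> \<and> arrs \<rho> ''mark'' = arrs \<sigma> ''mark'' \<and> regs \<rho> ''j'' \<le> M \<and>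
    R + 10 + 50 * (M - regs \<rho> ''j'') \<le> c"
  show ?thesis
    unfolding double_prog_def wp_simps
  proof (rule conjI[OF _ wp_Loop[where I = ?I]])
    show "expr_time (Lit 0) + 1 \<le> c" using c size_ge by simp
    show "?I (set_reg ''j'' (expr_val (Lit 0) \<sigma>) \<sigma>) (c - (expr_time (Lit 0) + 1))"
      using c size_ge ctx by (simp add: size_def)
  next
    fix \<rho> c assume I: "?I \<rho> c" and b: "\<not> test_val (Less (Reg ''j'') (Reg ''M'')) \<rho>"
    then have "regs \<rho> ''j'' = M" using ctxD(10)[OF conjunct1[OF I]] by simp
    with I show "test_time (Less (Reg ''j'') (Reg ''M'')) + 1 \<le> c \<and>
        Q \<rho> (c - (test_time (Less (Reg ''j'') (Reg ''M'')) + 1))"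
      by (auto intro!: Q[where r' = "?d M"])
  next
    fix \<rho> c assume I: "?I \<rho> c" and b: "test_val (Less (Reg ''j'') (Reg ''M'')) \<rho>"
    define j where "j = regs \<rho> ''j''"
    have ctx: "ctx t i live (?d j) \<rho>" and mark: "arrs \<rho> ''mark'' = arrs \<sigma> ''mark''"
      using I by (auto simp: j_def)
    have jr: "regs \<rho> ''j'' = j" "arrs \<rho> ''r'' = ?d j" using ctxD(5)[OF ctx] by (simp_all add: j_def)
    have j: "j \<le> m" using b ctxD(10)[OF ctx] by (simp add: j_def)
    have base: "base \<rho>" "regs \<rho> ''t'' = t" "regs \<rho> ''i'' = i" "arrs \<rho> ''live'' = live" "regs \<rho> ''M'' = M"
      using ctx by (simp_all add: ctxD)
    have th: "arrs \<rho> ''tail'' j = tl j" "arrs \<rho> ''head'' j = hd j"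
      using ctxD(11,12)[OF ctx j] .
    have "R + 60 + 50 * (m - j) \<le> c" using I j unfolding jr by (simp add: Suc_diff_le)
    then have "c = (c - 50) + 50" and ge: "R + 10 + 50 * (m - j) \<le> c - 50" by linarith+
    then obtain c1 where c: "c = c1 + 50" by metis
    have upd: "?d (Suc j) = (if arrs \<sigma> ''mark'' (tl j) = 0 \<and> hd j \<noteq> t then (?d j)(j := r j + r j + r (j + M)) else ?d j)"
      by (auto simp: fun_eq_iff less_Suc_eq)
    show "test_time (Less (Reg ''j'') (Reg ''M'')) + 1 \<le> c \<and>
      wp (Branch (Both (Equal (Elem ''mark'' (Elem ''tail'' (Reg ''j''))) (Lit 0))
                (Negate (Equal (Elem ''head'' (Reg ''j'')) (Reg ''t''))))
         (Store ''r'' (Reg ''j'') (Add (Add (Elem ''r'' (Reg ''j'')) (Elem ''r'' (Reg ''j'')))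
            (Elem ''r'' (Add (Reg ''j'') (Reg ''M'')))))
         Skip;;
        increment ''j'') ?I \<rho> (c - (test_time (Less (Reg ''j'') (Reg ''M'')) + 1))"
    proof (cases "arrs \<sigma> ''mark'' (tl j) = 0 \<and> hd j \<noteq> t")
      case True
      then have "ctx t i live (?d (Suc j)) (set_reg ''j'' (Suc j) (set_elem ''r'' j (r j + r j + r (j + M)) \<rho>))"
        using base jr unfolding upd by (simp add: ctx_def)
      with True ge j show ?thesis unfolding c
        by (simp add: wp_simps wp_Branch_True base jr mark th)
    next
      case False
      then have "ctx t i live (?d (Suc j)) (set_reg ''j'' (Suc j) \<rho>)"
        using base jr unfolding upd if_not_P[OF False] by (simp add: ctx_def)
      with False ge j show ?thesis unfolding c
        by (simp add: wp_simps wp_Branch_False base jr mark th)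
    qed
  qed
qed

lemma wp_caps:
  assumes ctx: "ctx t i live r \<sigma>" and L: "live_of L live" and c: "R + 60 * size \<le> c"
    and Q: "\<And>r' \<tau> c'. ctx t i live r' \<tau> \<Longrightarrow> (\<And>e. e \<le> m \<Longrightarrow> r' e = caps t L e) \<Longrightarrow>
      (\<And>e. e \<le> m \<Longrightarrow> r' (e + M) = 0) \<Longrightarrow> R \<le> c' \<Longrightarrow> Q \<tau> c'"
  shows "wp caps_prog Q \<sigma> c"
proof -
  define I where "I \<rho> c \<longleftrightarrow> ctx t i live (arrs \<rho> ''r'') \<rho> \<and> regs \<rho> ''j'' \<le> M \<and>
    (\<forall>e<regs \<rho> ''j''. arrs \<rho> ''r'' e = (if tl e = t then 0 else live e) \<and> arrs \<rho> ''r'' (e + M) = 0) \<and>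
    R + 20 + 50 * (M - regs \<rho> ''j'') \<le> c" for \<rho> c
  show ?thesis
    unfolding caps_prog_def wp_simps
  proof (rule conjI[OF _ wp_Loop[where I = I]])
    show "expr_time (Lit 0) + 1 \<le> c" using c size_ge by simp
    show "I (set_reg ''j'' (expr_val (Lit 0) \<sigma>) \<sigma>) (c - (expr_time (Lit 0) + 1))"
      using c size_ge ctx by (simp add: size_def I_def ctxD(5))
  next
    fix \<rho> c assume "I \<rho> c" and b: "\<not> test_val (Less (Reg ''j'') (Reg ''M'')) \<rho>"
    note I = \<open>I \<rho> c\<close>[unfolded I_def]
    have ctx: "ctx t i live (arrs \<rho> ''r'') \<rho>" using I by blast
    have j: "regs \<rho> ''j'' = M" using b I ctxD(10)[OF ctx] by simp
    have "R + 20 \<le> c" using I by linarith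
    have "ctx t i live ((arrs \<rho> ''r'')(m := lam)) (set_elem ''r'' m lam \<rho>)"
      using ctx by (rule ctx_set_r)
    moreover have "((arrs \<rho> ''r'')(m := lam)) e = caps t L e" "((arrs \<rho> ''r'')(m := lam)) (e + M) = 0" if "e \<le> m" for e
      using I that L unfolding j by (auto simp: caps_def live_of_def)
    ultimately have "Q (set_elem ''r'' m lam \<rho>) c'" if "R \<le> c'" for c'
      using that by (rule Q)
    then show "test_time (Less (Reg ''j'') (Reg ''M'')) + 1 \<le> c \<and>
        (expr_time (Reg ''m'') + expr_time (Reg ''lambda'') + 1 \<le> c - (test_time (Less (Reg ''j'') (Reg ''M'')) + 1) \<and>
        Q (set_elem ''r'' (expr_val (Reg ''m'') \<rho>) (expr_val (Reg ''lambda'') \<rho>) \<rho>)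
          (c - (test_time (Less (Reg ''j'') (Reg ''M'')) + 1) - (expr_time (Reg ''m'') + expr_time (Reg ''lambda'') + 1)))"
      using \<open>R + 20 \<le> c\<close> ctxD(7,8)[OF ctx] by simp
  next
    fix \<rho> c assume "I \<rho> c" and b: "test_val (Less (Reg ''j'') (Reg ''M'')) \<rho>"
    note I = \<open>I \<rho> c\<close>[unfolded I_def]
    define j where "j = regs \<rho> ''j''"
    have ctx: "ctx t i live (arrs \<rho> ''r'') \<rho>" using I by blast
    have jr: "regs \<rho> ''j'' = j" by (simp add: j_def)
    have j: "j \<le> m" using b ctxD(10)[OF ctx] by (simp add: j_def)
    have base: "base \<rho>" "regs \<rho> ''t'' = t" "regs \<rho> ''i'' = i" "arrs \<rho> ''live'' = live" "regs \<rho> ''M'' = M"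
      using ctx by (simp_all add: ctxD)
    have th: "arrs \<rho> ''tail'' j = tl j" using ctxD(11)[OF ctx j] .
    have "R + 70 + 50 * (m - j) \<le> c" using I j unfolding jr by (simp add: Suc_diff_le)
    then have "c = (c - 50) + 50" and ge: "R + 20 + 50 * (m - j) \<le> c - 50" by linarith+
    then obtain c1 where c: "c = c1 + 50" by metis
    have fin: "I \<rho>' c'" if "c1 \<le> c'" "base \<rho>'" "regs \<rho>' ''t'' = t" "regs \<rho>' ''i'' = i" "arrs \<rho>' ''live'' = live"
      "regs \<rho>' ''j'' = Suc j" "arrs \<rho>' ''r'' = (arrs \<rho> ''r'')(j := (if tl j = t then 0 else live j), j + M := 0)" for \<rho>' c'
      using that j ge I unfolding jr by (auto simp add: I_def ctx_def c less_Suc_eq)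
    show "test_time (Less (Reg ''j'') (Reg ''M'')) + 1 \<le> c \<and>
      wp (Branch (Equal (Elem ''tail'' (Reg ''j'')) (Reg ''t''))
         (Store ''r'' (Reg ''j'') (Lit 0))
         (Store ''r'' (Reg ''j'') (Elem ''live'' (Reg ''j'')));;
        Store ''r'' (Add (Reg ''j'') (Reg ''M'')) (Lit 0);;
        increment ''j'') I \<rho> (c - (test_time (Less (Reg ''j'') (Reg ''M'')) + 1))"
    proof (cases "tl j = t")
      case True
      show ?thesis unfolding c
        by (simp add: wp_simps wp_Branch_True base jr th True)
          (rule fin, simp_all add: base jr True)
    next
      case False
      show ?thesis unfolding c
        by (simp add: wp_simps wp_Branch_False base jr th False)
          (rule fin, simp_all add: base jr False)
    qed
  qed
qed

lemma wp_drop: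
  assumes ctx: "ctx t i live r \<sigma>" and L: "live_of L live" and c: "R + 60 * size \<le> c"
    and Q: "\<And>live' \<tau> c'. ctx t i live' r \<tau> \<Longrightarrow> live_of (L - dropped r) live' \<Longrightarrow> R \<le> c' \<Longrightarrow> Q \<tau> c'"
  shows "wp drop_prog Q \<sigma> c"
proof -
  let ?live = "\<lambda>j e. if e < j \<and> e \<in> dropped r then 0 else live e"
  define I where "I \<rho> c \<longleftrightarrow> ctx t i (?live (regs \<rho> ''j'')) r \<rho> \<and> regs \<rho> ''j'' \<le> m \<and>
    R + 20 + 50 * (m - regs \<rho> ''j'') \<le> c" for \<rho> c
  show ?thesis
    unfolding drop_prog_def wp_simps
  proof (rule conjI[OF _ wp_Loop[where I = I]])
    show "expr_time (Lit 0) + 1 \<le> c" using c size_ge by simp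
    show "I (set_reg ''j'' (expr_val (Lit 0) \<sigma>) \<sigma>) (c - (expr_time (Lit 0) + 1))"
      using c size_ge ctx by (simp add: size_def I_def)
  next
    fix \<rho> c assume "I \<rho> c" and b: "\<not> test_val (Less (Reg ''j'') (Reg ''m'')) \<rho>"
    note I = \<open>I \<rho> c\<close>[unfolded I_def]
    have j: "regs \<rho> ''j'' = m" using b I ctxD(7)[OF conjunct1[OF I]] by simp
    have "live_of (L - dropped r) (?live m)" using L by (auto simp: live_of_def dropped_def)
    with I show "test_time (Less (Reg ''j'') (Reg ''m'')) + 1 \<le> c \<and>
        Q \<rho> (c - (test_time (Less (Reg ''j'') (Reg ''m'')) + 1))"
      unfolding j by (auto intro!: Q[where live' = "?live m"])
  next
    fix \<rho> c assume "I \<rho> c" and b: "test_val (Less (Reg ''j'') (Reg ''m'')) \<rho>"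
    note I = \<open>I \<rho> c\<close>[unfolded I_def]
    define j where "j = regs \<rho> ''j''"
    have ctx: "ctx t i (?live j) r \<rho>" using I unfolding j_def by blast
    have jr: "regs \<rho> ''j'' = j" by (simp add: j_def)
    have j: "j < m" using b ctxD(7)[OF ctx] by (simp add: j_def)
    have base: "base \<rho>" "regs \<rho> ''t'' = t" "regs \<rho> ''i'' = i" "arrs \<rho> ''live'' = ?live j" "regs \<rho> ''M'' = M"
        "arrs \<rho> ''r'' = r" "regs \<rho> ''m'' = m"
      using ctxD(1-5,7,10)[OF ctx] by simp_all
    have th: "arrs \<rho> ''head'' j = hd j" using ctxD(12)[OF ctx] j by simp
    obtain d where d: "m - j = Suc d" using j by (metis Suc_diff_Suc)
    have "R + 70 + 50 * d \<le> c" using I unfolding jr d by simp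
    then have "c = (c - 50) + 50" and ge: "R + 20 + 50 * d \<le> c - 50" by linarith+
    then obtain c1 where c: "c = c1 + 50" by metis
    have fin: "I \<rho>' c'" if "c1 \<le> c'" "base \<rho>'" "regs \<rho>' ''t'' = t" "regs \<rho>' ''i'' = i" "arrs \<rho>' ''live'' = ?live (Suc j)"
      "regs \<rho>' ''j'' = Suc j" "arrs \<rho>' ''r'' = r" for \<rho>' c'
    proof -
      have "m - Suc j = d" using d by simp
      with that j ge show ?thesis by (simp add: I_def ctx_def c)
    qed
    show "test_time (Less (Reg ''j'') (Reg ''m'')) + 1 \<le> c \<and>
      wp (Branch (Both (Equal (Elem ''head'' (Reg ''j'')) (Reg ''t''))
                (Equal (Elem ''r'' (Add (Reg ''j'') (Reg ''M''))) (Lit 0)))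
         (Store ''live'' (Reg ''j'') (Lit 0))
         Skip;;
        increment ''j'') I \<rho> (c - (test_time (Less (Reg ''j'') (Reg ''m'')) + 1))"
    proof (cases "hd j = t \<and> r (j + M) = 0")
      case True
      then have upd: "?live (Suc j) = (?live j)(j := 0)" using j by (auto simp: dropped_def less_Suc_eq)
      show ?thesis unfolding c using True j
        by (simp add: wp_simps wp_Branch_True base jr th) (rule fin, simp_all only: upd, simp_all add: base jr)
    next
      case False
      then have upd: "?live (Suc j) = ?live j" using j by (auto simp: dropped_def less_Suc_eq fun_eq_iff)
      show ?thesis unfolding c using False j
        by (simp add: wp_simps wp_Branch_False base jr th) (rule fin, simp_all only: upd, simp_all add: base jr)
    qed
  qed
qed

definition finished :: "nat set \<Rightarrow> (nat \<Rightarrow> nat) \<Rightarrow> bool" where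
  "finished L r \<longleftrightarrow> preserves L (L - dropped r) \<and> card {e \<in> L - dropped r. hd e = t} \<le> lam * 2 ^ k"

lemma dropped_cong: "(\<And>e. e \<le> m \<Longrightarrow> r (e + M) = r' (e + M)) \<Longrightarrow> dropped r = dropped r'"
  unfolding dropped_def by (rule Collect_cong) auto

lemma finished_double:
  assumes "phase L k r v" "blocked r S" "L \<subseteq> {..<m}" "\<And>e. e \<le> m \<Longrightarrow> r' (e + M) = r (e + M)"
  shows "finished L r'"
  using phase_final_preserves[OF assms(1,2)] phase_final_card[OF assms(1,3)] dropped_cong[of r' r, OF assms(4)]
  by (simp add: finished_def)

lemma phase_le: "phase L i r v \<Longrightarrow> i \<le> k \<Longrightarrow> v \<le> lam * 2 ^ k"
  by (drule phase_bound, erule order_trans) (simp add: power_increasing)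

text \<open>Every iteration raises either the flow value \<open>v\<close> or the round
  \<open>i\<close>, and neither is ever reset. So \<open>(lam * 2 ^ k - v) + (k + 1 - i)\<close>
  bounds the iterations left.\<close>

lemma wp_target:
  assumes ctx: "ctx t i0 live r0 \<sigma>" and L: "live_of L live" "L \<subseteq> {..<m}"
    and c: "R + target_cost \<le> c"
    and Q: "\<And>i r live' L' \<tau> c'. ctx t i live' r \<tau> \<Longrightarrow> live_of L' live' \<Longrightarrow> L' \<subseteq> L \<Longrightarrow> preserves L L' \<Longrightarrow>
      card {e \<in> L'. hd e = t} \<le> lam * 2 ^ k \<Longrightarrow> R \<le> c' \<Longrightarrow> Q \<tau> c'"
  shows "wp target_prog Q \<sigma> c"
proof -
  let ?P = "200 * size"
  let ?R = "R + 60 * size"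
  define I where "I \<rho> c \<longleftrightarrow> (\<exists>i r. ctx t i live r \<rho> \<and>
    ((i \<le> k \<and> (\<exists>v. phase L i r v \<and> ?R + 10 + ?P * ((lam * 2 ^ k - v) + (k + 1 - i)) \<le> c)) \<or>
     (i = k + 1 \<and> finished L r \<and> ?R + 10 \<le> c)))" for \<rho> c
  have cost: "target_cost = ?P * (lam * 2 ^ k + (k + 1)) + ?P" by (simp add: algebra_simps)
  show ?thesis
    unfolding target_prog_def wp_simps
  proof (rule wp_caps[OF ctx L(1)])
    let ?R1 = "?R + 20 + ?P * (lam * 2 ^ k + (k + 1))"
    show "?R1 + 60 * size \<le> c" using c size_ge unfolding cost by linarith
    fix r \<tau> c assume r: "ctx t i0 live r \<tau>" "\<And>e. e \<le> m \<Longrightarrow> r e = caps t L e" "\<And>e. e \<le> m \<Longrightarrow> r (e + M) = 0"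
      and c: "?R1 \<le> c"
    have "phase L 0 r 0" using r(2,3) by (rule phase_init)
    moreover have "ctx t 0 live r (set_reg ''i'' 0 \<tau>)" using r(1) by (simp add: ctx_def)
    moreover have "?R + 10 + ?P * ((lam * 2 ^ k - 0) + (k + 1 - 0)) \<le> c - 2" using c by simp
    ultimately have init: "I (set_reg ''i'' 0 \<tau>) (c - 2)" unfolding I_def by blast
    show "expr_time (Lit 0) + 1 \<le> c \<and>
      wp (Loop (Less (Reg ''i'') (Add (Reg ''k'') (Lit 1)))
       (search_prog;;
        Branch (Equal (Elem ''mark'' (Reg ''n'')) (Lit 0))
          (double_prog;; increment ''i'')
          augment_prog))
        (wp drop_prog Q) (set_reg ''i'' (expr_val (Lit 0) \<tau>) \<tau>) (c - (expr_time (Lit 0) + 1))"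
    proof (rule conjI[OF _ wp_Loop[where I = I]])
      show "expr_time (Lit 0) + 1 \<le> c" using c by simp
      show "I (set_reg ''i'' (expr_val (Lit 0) \<tau>) \<tau>) (c - (expr_time (Lit 0) + 1))"
        using init by (simp add: numeral_2_eq_2)
    next
      fix \<rho> c assume "I \<rho> c" and b: "\<not> test_val (Less (Reg ''i'') (Add (Reg ''k'') (Lit 1))) \<rho>"
      then obtain i r where i: "ctx t i live r \<rho>" "finished L r" "?R + 10 \<le> c"
        unfolding I_def using ctxD(3,9) by fastforce
      then have "6 \<le> c" by linarith
      have "wp drop_prog Q \<rho> (c - 6)"
      proof (rule wp_drop[OF i(1) L(1)])
        show "R + 60 * size \<le> c - 6" using i(3) by simp
        fix live' \<tau> c'
        assume "ctx t i live' r \<tau>" "live_of (L - dropped r) live'" "R \<le> c'"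
        then show "Q \<tau> c'" using i(2) by (intro Q[of i live' r \<tau> "L - dropped r"]) (auto simp: finished_def)
      qed
      then show "test_time (Less (Reg ''i'') (Add (Reg ''k'') (Lit 1))) + 1 \<le> c \<and>
          wp drop_prog Q \<rho> (c - (test_time (Less (Reg ''i'') (Add (Reg ''k'') (Lit 1))) + 1))"
        using \<open>6 \<le> c\<close> by (simp add: eval_nat_numeral)
    next
      fix \<rho> c assume "I \<rho> c" and b: "test_val (Less (Reg ''i'') (Add (Reg ''k'') (Lit 1))) \<rho>"
      then obtain i r v where i: "ctx t i live r \<rho>" "i \<le> k" "phase L i r v"
          "?R + 10 + ?P * ((lam * 2 ^ k - v) + (k + 1 - i)) \<le> c"
        unfolding I_def using ctxD(3,9) by fastforce
      define a where "a = (lam * 2 ^ k - v) + (k - i)"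
      have Suc_a: "(lam * 2 ^ k - v) + (k + 1 - i) = Suc a" using i(2) by (simp add: a_def)
      have ge: "?R + 10 + ?P * a + ?P \<le> c" using i(4) unfolding Suc_a by simp
      then have "6 \<le> c" by linarith
      let ?body = "\<lambda>\<tau> c. wp (Branch (Equal (Elem ''mark'' (Reg ''n'')) (Lit 0))
          (double_prog;; increment ''i'') augment_prog) I \<tau> c"
      have "wp search_prog ?body \<rho> (c - 6)"
      proof (rule wp_search[OF i(1) t_bounded])
        show "(?R + 10 + ?P * a + 100 * size) + 90 * size \<le> c - 6" using ge size_ge by simp
        fix \<tau> c' assume \<tau>: "ctx t i live r \<tau>" "searched t r \<tau>" and "?R + 10 + ?P * a + 100 * size \<le> c'"
        then have c': "?R + 10 + ?P * a + 60 * size + 40 \<le> c'" and "5 \<le> c'" using size_ge by linarith+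
        obtain e where st: "search_state t r (arrs \<tau> ''queue'') (arrs \<tau> ''mark'') (arrs \<tau> ''par'') e e 0"
          using \<tau>(2) by (auto simp: searched_def)
        define S where "S = arrs \<tau> ''queue'' ` {..<e}"
        note tree = search_state_tree[OF st, folded S_def]
        note n = ctxD(6)[OF \<tau>(1)]
        show "?body \<tau> c'"
        proof (cases "arrs \<tau> ''mark'' n = 0")
          case True
          then have "n \<notin> S" using tree(5)[of n] by simp
          then have bl: "blocked r S" unfolding blocked_def using tree(1-3) by blast
          have "wp double_prog (wp (increment ''i'') I) \<tau> (c' - 5)"
          proof (rule wp_double[OF \<tau>(1)])
            show "(?R + 20 + ?P * a) + 60 * size \<le> c' - 5" using c' by simp
            fix r' \<rho> d assume r': "ctx t i live r' \<rho>"
              "\<And>e. e \<le> m \<Longrightarrow> r' e = (if arrs \<tau> ''mark'' (tl e) = 0 \<and> hd e \<noteq> t then r e + r e + r (e + M) else r e)"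
              "\<And>e. e \<le> m \<Longrightarrow> r' (e + M) = r (e + M)" and d: "?R + 20 + ?P * a \<le> d"
            have "r' e = (if tl e \<notin> S \<and> hd e \<noteq> t then r e + r e + r (e + M) else r e)" if "e \<le> m" for e
            proof -
              have "tl e \<le> n" using tl_less[of e] that by (cases "e = m") (simp_all add: tl_m)
              then show ?thesis using r'(2)[OF that] tree(5)[of "tl e"] by auto
            qed
            then have ph: "phase L (Suc i) r' v" using r'(3) by (rule phase_double[OF i(3) bl])
            have ctx': "ctx t (Suc i) live r' (set_reg ''i'' (Suc i) \<rho>)" using r'(1) by (simp add: ctx_def)
            have "I (set_reg ''i'' (Suc i) \<rho>) d'" if "d = d' + 4" for d'
            proof (cases "i = k")
              case True
              with finished_double[OF _ bl L(2) r'(3)] i(3) have "finished L r'" by simp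
              with ctx' True d that show ?thesis unfolding I_def by auto
            next
              case False
              have "(lam * 2 ^ k - v) + (k + 1 - Suc i) = a" by (simp add: a_def)
              then have "?R + 10 + ?P * ((lam * 2 ^ k - v) + (k + 1 - Suc i)) \<le> d'" using d that by simp
              moreover have "Suc i \<le> k" using False i(2) by simp
              ultimately show ?thesis using ctx' ph unfolding I_def by blast
            qed
            moreover have "4 \<le> d" "d = (d - 4) + 4" using d by linarith+
            ultimately have "I (set_reg ''i'' (Suc i) \<rho>) (d - 4)" by blast
            then show "wp (increment ''i'') I \<rho> d"
              using ctxD(3)[OF r'(1)] \<open>4 \<le> d\<close> by (simp add: wp_simps eval_nat_numeral)
          qed
          with True \<open>5 \<le> c'\<close> n show ?thesis
            by (simp add: wp_Branch_True wp_simps eval_nat_numeral)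
        next
          case False
          have "wp augment_prog I \<tau> (c' - 5)"
          proof (rule wp_augment[OF \<tau> False])
            show "(?R + 10 + ?P * a) + 60 * size \<le> c' - 5" using c' by simp
            fix r' \<rho> d assume r': "ctx t i live r' \<rho>" "\<And>a. a \<in> half_arcs \<Longrightarrow> r' a + r' (rev a) = r a + r (rev a)"
              "\<And>X. n \<in> X \<Longrightarrow> t \<notin> X \<Longrightarrow> resid r' X + 1 = resid r X" and d: "?R + 10 + ?P * a \<le> d"
            have ph: "phase L i r' (Suc v)" using r'(2,3) by (rule phase_augment[OF i(3)])
            \<comment> \<open>This bound is what makes the truncated difference
              \<open>lam * 2 ^ k - v\<close> really decrease.\<close>
            then have "Suc v \<le> lam * 2 ^ k" using i(2) by (rule phase_le)
            then have "(lam * 2 ^ k - Suc v) + (k + 1 - i) = a" using i(2) by (simp add: a_def)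
            with d have "?R + 10 + ?P * ((lam * 2 ^ k - Suc v) + (k + 1 - i)) \<le> d" by (simp only:)
            with r'(1) ph i(2) show "I \<rho> d" unfolding I_def by blast
          qed
          with False \<open>5 \<le> c'\<close> n show ?thesis
            by (simp add: wp_Branch_False wp_simps eval_nat_numeral)
        qed
      qed
      then show "test_time (Less (Reg ''i'') (Add (Reg ''k'') (Lit 1))) + 1 \<le> c \<and>
        wp (search_prog;;
        Branch (Equal (Elem ''mark'' (Reg ''n'')) (Lit 0))
          (double_prog;; increment ''i'')
          augment_prog) I \<rho> (c - (test_time (Less (Reg ''i'') (Add (Reg ''k'') (Lit 1))) + 1))"
        using \<open>6 \<le> c\<close> by (simp add: wp_Seq eval_nat_numeral)
    qed
  qed
qed

end

section \<open>Input, output, the loop over all targets and the total cost\<close>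

context instance_data
begin

lemma wp_setup:
  assumes c: "R + 300 * size \<le> c"
    and Q: "\<And>\<tau> c'. base \<tau> \<Longrightarrow> live_of {..<m} (arrs \<tau> ''live'') \<Longrightarrow> R \<le> c' \<Longrightarrow> Q \<tau> c'"
  shows "wp setup_prog Q (input_mem n es s lam k) c"
proof -
  define C where "C \<rho> \<longleftrightarrow> regs \<rho> ''n'' = n \<and> regs \<rho> ''m'' = m \<and> regs \<rho> ''lambda'' = lam \<and> regs \<rho> ''k'' = k \<and>
    regs \<rho> ''M'' = M \<and> regs \<rho> ''m_out'' = 0 \<and> (\<forall>e\<le>m. arrs \<rho> ''tail'' e = tl e \<and> arrs \<rho> ''head'' e = hd e)" for \<rho> :: mem
  \<comment> \<open>The reserve \<open>120 * size\<close> is for the second loop, whose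
    \<open>M + M\<close> iterations are charged 60 credits each.\<close>
  define I where "I \<rho> c \<longleftrightarrow> C \<rho> \<and> arrs \<rho> ''first'' = (\<lambda>_. 0) \<and> regs \<rho> ''j'' \<le> M \<and>
    (\<forall>e<regs \<rho> ''j''. arrs \<rho> ''src'' e = tl e \<and> arrs \<rho> ''dst'' e = hd e \<and>
      arrs \<rho> ''src'' (e + M) = hd e \<and> arrs \<rho> ''dst'' (e + M) = tl e \<and> arrs \<rho> ''live'' e = 1) \<and>
    R + 120 * size + 20 + 60 * (M - regs \<rho> ''j'') \<le> c" for \<rho> :: mem and c
  define J where "J \<rho> c \<longleftrightarrow> C \<rho> \<and> (\<forall>a<M + M. arrs \<rho> ''src'' a = src a \<and> arrs \<rho> ''dst'' a = dst a) \<and>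
    live_of {..<m} (arrs \<rho> ''live'') \<and> regs \<rho> ''j'' \<le> M + M \<and>
    (\<forall>v. arrs \<rho> ''first'' v = prv v (regs \<rho> ''j'')) \<and>
    (\<forall>a<regs \<rho> ''j''. arrs \<rho> ''next'' a = prv (dst a) a) \<and>
    R + 20 + 60 * (M + M - regs \<rho> ''j'') \<le> c" for \<rho> :: mem and c
  have C_set_reg: "C (set_reg ''j'' v \<rho>) = C \<rho>" for v \<rho> by (simp add: C_def)
  have C_set_elem: "C (set_elem x i v \<rho>) = C \<rho>" if "x \<notin> {''tail'', ''head''}" for x i v \<rho>
    using that by (auto simp: C_def)
  have start: "C (set_reg ''j'' 0 (set_elem ''head'' m s (set_elem ''tail'' m n (set_reg ''M'' M (input_mem n es s lam k)))))"
    by (auto simp: C_def input_mem_def tl_def hd_def)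
  \<comment> \<open>Cells not set by the input hold 0, so all lists are initially empty, in
    accordance with \<open>prv v 0 = 0\<close>.\<close>
  have first: "arrs (input_mem n es s lam k) ''first'' = (\<lambda>_. 0)" by (simp add: input_mem_def)
  have input: "regs (input_mem n es s lam k) ''m'' = m" "regs (input_mem n es s lam k) ''n'' = n"
    "regs (input_mem n es s lam k) ''s'' = s" by (simp_all add: input_mem_def)
  obtain c0 where c0: "c = c0 + 20" "R + 120 * size + 20 + 60 * M \<le> c0"
  proof
    show "c = (c - 20) + 20" "R + 120 * size + 20 + 60 * M \<le> c - 20"
      using c size_ge by (simp_all add: size_def)
  qed
  let ?L1 = "Loop (Less (Reg ''j'') (Reg ''M''))
       (Store ''src'' (Reg ''j'') (Elem ''tail'' (Reg ''j''));;
        Store ''dst'' (Reg ''j'') (Elem ''head'' (Reg ''j''));;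
        Store ''src'' (Add (Reg ''j'') (Reg ''M'')) (Elem ''head'' (Reg ''j''));;
        Store ''dst'' (Add (Reg ''j'') (Reg ''M'')) (Elem ''tail'' (Reg ''j''));;
        Store ''live'' (Reg ''j'') (Lit 1);;
        increment ''j'')"
  let ?L2 = "Loop (Less (Reg ''j'') (Add (Reg ''M'') (Reg ''M'')))
       (Store ''next'' (Reg ''j'') (Elem ''first'' (Elem ''dst'' (Reg ''j'')));;
        Store ''first'' (Elem ''dst'' (Reg ''j'')) (Add (Reg ''j'') (Lit 1));;
        increment ''j'')"
  have L2: "wp ?L2 Q \<rho> c" if "J \<rho> c" for \<rho> c
  proof (rule wp_Loop[where I = J])
    fix \<rho> c assume "J \<rho> c" and b: "\<not> test_val (Less (Reg ''j'') (Add (Reg ''M'') (Reg ''M''))) \<rho>"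
    note J = \<open>J \<rho> c\<close>[unfolded J_def]
    have "regs \<rho> ''j'' = M + M" using J b by (simp add: C_def)
    with J have "base \<rho>" "live_of {..<m} (arrs \<rho> ''live'')" "R + 20 \<le> c"
      by (simp_all add: base_def C_def half_arcs_def)
    then show "test_time (Less (Reg ''j'') (Add (Reg ''M'') (Reg ''M''))) + 1 \<le> c \<and>
        Q \<rho> (c - (test_time (Less (Reg ''j'') (Add (Reg ''M'') (Reg ''M''))) + 1))"
      by (auto intro!: Q)
  next
    fix \<rho> c assume "J \<rho> c" and b: "test_val (Less (Reg ''j'') (Add (Reg ''M'') (Reg ''M''))) \<rho>"
    note J = \<open>J \<rho> c\<close>[unfolded J_def]
    define j where "j = regs \<rho> ''j''"
    have jr: "regs \<rho> ''j'' = j" by (simp add: j_def)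
    have Mr: "regs \<rho> ''M'' = M" using J by (simp add: C_def)
    have j: "j < M + M" using b Mr by (simp add: jr)
    have dr: "arrs \<rho> ''dst'' j = dst j" "arrs \<rho> ''first'' (dst j) = prv (dst j) j" using J j by (simp_all add: jr)
    obtain d where d: "M + M - j = Suc d" using j by (metis Suc_diff_Suc)
    have "R + 80 + 60 * d \<le> c" using J unfolding jr d by simp
    then have "c = (c - 60) + 60" and ge: "R + 20 + 60 * d \<le> c - 60" by linarith+
    then obtain c1 where c: "c = c1 + 60" by metis
    have fin: "J \<rho>' c'" if "c1 \<le> c'" "C \<rho>'" "arrs \<rho>' ''src'' = arrs \<rho> ''src''" "arrs \<rho>' ''dst'' = arrs \<rho> ''dst''"
      "arrs \<rho>' ''live'' = arrs \<rho> ''live''" "regs \<rho>' ''j'' = Suc j"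
      "arrs \<rho>' ''first'' = (arrs \<rho> ''first'')(dst j := Suc j)"
      "arrs \<rho>' ''next'' = (arrs \<rho> ''next'')(j := prv (dst j) j)" for \<rho>' c'
    proof -
      have "M + M - Suc j = d" using d by simp
      then have "R + 20 + 60 * (M + M - Suc j) \<le> c'" using that(1) ge c by simp
      moreover have "arrs \<rho>' ''first'' v = prv v (Suc j)" for v
        using J by (simp add: that(7) jr prv_Suc)
      moreover have "arrs \<rho>' ''next'' a = prv (dst a) a" if "a < Suc j" for a
        using J that by (auto simp: \<open>arrs \<rho>' ''next'' = _\<close> jr less_Suc_eq)
      ultimately show ?thesis using J that j unfolding J_def by simp
    qed
    show "test_time (Less (Reg ''j'') (Add (Reg ''M'') (Reg ''M''))) + 1 \<le> c \<and>
      wp (Store ''next'' (Reg ''j'') (Elem ''first'' (Elem ''dst'' (Reg ''j'')));;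
        Store ''first'' (Elem ''dst'' (Reg ''j'')) (Add (Reg ''j'') (Lit 1));;
        increment ''j'') J \<rho> (c - (test_time (Less (Reg ''j'') (Add (Reg ''M'') (Reg ''M''))) + 1))"
      unfolding c using J by (simp add: wp_simps jr Mr dr) (rule fin, simp_all add: C_set_reg C_set_elem jr)
  qed (rule that)
  have L1: "wp ?L1 (wp (Assign ''j'' (Lit 0);; ?L2) Q) \<rho> c" if "I \<rho> c" for \<rho> c
  proof (rule wp_Loop[where I = I])
    fix \<rho> c assume "I \<rho> c" and b: "\<not> test_val (Less (Reg ''j'') (Reg ''M'')) \<rho>"
    note I = \<open>I \<rho> c\<close>[unfolded I_def]
    have "regs \<rho> ''j'' = M" using I b by (simp add: C_def)
    with I have e: "arrs \<rho> ''src'' e = tl e" "arrs \<rho> ''dst'' e = hd e" "arrs \<rho> ''src'' (e + M) = hd e"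
        "arrs \<rho> ''dst'' (e + M) = tl e" "arrs \<rho> ''live'' e = 1" if "e < M" for e
      using that by simp_all
    have "arrs \<rho> ''src'' a = src a \<and> arrs \<rho> ''dst'' a = dst a" if "a < M + M" for a
    proof (cases "a < M")
      case True
      then show ?thesis by (simp add: e src_def dst_def)
    next
      case False
      then show ?thesis using e(3,4)[of "a - M"] that by (simp add: src_def dst_def)
    qed
    moreover have "live_of {..<m} (arrs \<rho> ''live'')" using e(5) by (simp add: live_of_def)
    moreover have "R + 20 + 60 * (M + M) + 20 \<le> c" using I size_ge by (simp add: size_def)
    ultimately have "J (set_reg ''j'' 0 \<rho>) c'" if "c = c' + 6" for c'
      using I that by (simp add: J_def C_set_reg prv_0)
    moreover have "6 \<le> c" using \<open>R + 20 + 60 * (M + M) + 20 \<le> c\<close> by linarith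
    ultimately have "wp ?L2 Q (set_reg ''j'' 0 \<rho>) (c - 6)" by (intro L2) simp
    with \<open>6 \<le> c\<close>
    show "test_time (Less (Reg ''j'') (Reg ''M'')) + 1 \<le> c \<and>
        wp (Assign ''j'' (Lit 0);; ?L2) Q \<rho> (c - (test_time (Less (Reg ''j'') (Reg ''M'')) + 1))"
      by (simp add: wp_simps eval_nat_numeral)
  next
    fix \<rho> c assume "I \<rho> c" and b: "test_val (Less (Reg ''j'') (Reg ''M'')) \<rho>"
    note I = \<open>I \<rho> c\<close>[unfolded I_def]
    define j where "j = regs \<rho> ''j''"
    have jr: "regs \<rho> ''j'' = j" by (simp add: j_def)
    have Mr: "regs \<rho> ''M'' = M" using I by (simp add: C_def)
    have j: "j < M" using b Mr by (simp add: jr)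
    have th: "arrs \<rho> ''tail'' j = tl j" "arrs \<rho> ''head'' j = hd j" using I j by (simp_all add: C_def)
    obtain d where d: "M - j = Suc d" using j by (metis Suc_diff_Suc)
    have "R + 120 * size + 80 + 60 * d \<le> c" using I unfolding jr d by simp
    then have "c = (c - 60) + 60" and ge: "R + 120 * size + 20 + 60 * d \<le> c - 60" by linarith+
    then obtain c1 where c: "c = c1 + 60" by metis
    have fin: "I \<rho>' c'" if "c1 \<le> c'" "C \<rho>'" "arrs \<rho>' ''first'' = (\<lambda>_. 0)" "regs \<rho>' ''j'' = Suc j"
      "arrs \<rho>' ''src'' = (arrs \<rho> ''src'')(j := tl j, j + M := hd j)"
      "arrs \<rho>' ''dst'' = (arrs \<rho> ''dst'')(j := hd j, j + M := tl j)"
      "arrs \<rho>' ''live'' = (arrs \<rho> ''live'')(j := 1)" for \<rho>' c'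
    proof -
      have "M - Suc j = d" using d by simp
      then have "R + 120 * size + 20 + 60 * (M - Suc j) \<le> c'" using that(1) ge c by simp
      then show ?thesis using I that(2-) j unfolding I_def jr by (auto simp: less_Suc_eq)
    qed
    show "test_time (Less (Reg ''j'') (Reg ''M'')) + 1 \<le> c \<and>
      wp (Store ''src'' (Reg ''j'') (Elem ''tail'' (Reg ''j''));;
        Store ''dst'' (Reg ''j'') (Elem ''head'' (Reg ''j''));;
        Store ''src'' (Add (Reg ''j'') (Reg ''M'')) (Elem ''head'' (Reg ''j''));;
        Store ''dst'' (Add (Reg ''j'') (Reg ''M'')) (Elem ''tail'' (Reg ''j''));;
        Store ''live'' (Reg ''j'') (Lit 1);;
        increment ''j'') I \<rho> (c - (test_time (Less (Reg ''j'') (Reg ''M'')) + 1))"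
      unfolding c using I
      by (simp add: wp_simps jr Mr th) (rule fin, simp_all add: C_set_reg C_set_elem jr fun_eq_iff)
  qed (rule that)
  have "I (set_reg ''j'' 0 (set_elem ''head'' m s (set_elem ''tail'' m n (set_reg ''M'' M (input_mem n es s lam k))))) c'"
    if "c0 \<le> c'" for c'
    using start first c0(2) that by (simp add: I_def)
  from L1[OF this] show ?thesis
    unfolding setup_prog_def by (simp add: wp_simps input c0(1) numeral_2_eq_2)
qed

lemma wp_output:
  assumes "base \<sigma>" and L: "live_of L (arrs \<sigma> ''live'')" and c: "R + 100 * size \<le> c"
    and Q: "\<And>\<tau> c'. output_arcs \<tau> = map (nth es) (filter (\<lambda>e. e \<in> L) [0..<m]) \<Longrightarrow> Q \<tau> c'"
  shows "wp output_prog Q \<sigma> c"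
proof -
  define C where "C \<rho> \<longleftrightarrow> regs \<rho> ''m'' = m \<and> arrs \<rho> ''tail'' = arrs \<sigma> ''tail'' \<and> arrs \<rho> ''head'' = arrs \<sigma> ''head'' \<and>
    arrs \<rho> ''live'' = arrs \<sigma> ''live''" for \<rho> :: mem
  define I where "I \<rho> c \<longleftrightarrow> C \<rho> \<and> regs \<rho> ''j'' \<le> m \<and>
    output_arcs \<rho> = map (nth es) (filter (\<lambda>e. e \<in> L) [0..<regs \<rho> ''j'']) \<and>
    20 + 60 * (m - regs \<rho> ''j'') \<le> c" for \<rho> :: mem and c
  have th: "arrs \<sigma> ''tail'' e = fst (es ! e)" "arrs \<sigma> ''head'' e = snd (es ! e)" "arrs \<sigma> ''live'' e = of_bool (e \<in> L)"
    if "e < m" for e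
    using that assms(1) L by (simp_all add: base_def tl_def hd_def live_of_def)
  have base: "regs \<sigma> ''m'' = m" "regs \<sigma> ''m_out'' = 0" using assms(1) by (simp_all add: base_def)
  show ?thesis
    unfolding output_prog_def wp_simps
  proof (rule conjI[OF _ wp_Loop[where I = I]])
    show "expr_time (Lit 0) + 1 \<le> c" using c size_ge by simp
    show "I (set_reg ''j'' (expr_val (Lit 0) \<sigma>) \<sigma>) (c - (expr_time (Lit 0) + 1))"
      using c size_ge by (simp add: size_def I_def C_def base output_arcs_def)
  next
    fix \<rho> c assume "I \<rho> c" and b: "\<not> test_val (Less (Reg ''j'') (Reg ''m'')) \<rho>"
    note I = \<open>I \<rho> c\<close>[unfolded I_def]
    have "regs \<rho> ''j'' = m" using b I by (simp add: C_def)
    with I show "test_time (Less (Reg ''j'') (Reg ''m'')) + 1 \<le> c \<and>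
        Q \<rho> (c - (test_time (Less (Reg ''j'') (Reg ''m'')) + 1))"
      by (auto intro!: Q)
  next
    fix \<rho> c assume "I \<rho> c" and b: "test_val (Less (Reg ''j'') (Reg ''m'')) \<rho>"
    note I = \<open>I \<rho> c\<close>[unfolded I_def]
    define j where "j = regs \<rho> ''j''"
    have jr: "regs \<rho> ''j'' = j" by (simp add: j_def)
    have j: "j < m" using b I by (simp add: jr C_def)
    have C: "regs \<rho> ''m'' = m" "arrs \<rho> ''tail'' = arrs \<sigma> ''tail''" "arrs \<rho> ''head'' = arrs \<sigma> ''head''"
      "arrs \<rho> ''live'' = arrs \<sigma> ''live''" using I by (simp_all add: C_def)
    obtain d where d: "m - j = Suc d" using j by (metis Suc_diff_Suc)
    have "80 + 60 * d \<le> c" using I unfolding jr d by simp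
    then have "c = (c - 60) + 60" and ge: "20 + 60 * d \<le> c - 60" by linarith+
    then obtain c1 where c: "c = c1 + 60" by metis
    have fin: "I \<rho>' c'" if "c1 \<le> c'" "C \<rho>'" "regs \<rho>' ''j'' = Suc j"
      "output_arcs \<rho>' = map (nth es) (filter (\<lambda>e. e \<in> L) [0..<Suc j])" for \<rho>' c'
    proof -
      have "m - Suc j = d" using d by simp
      with that j ge c show ?thesis by (simp add: I_def)
    qed
    have out: "output_arcs \<rho> = map (nth es) (filter (\<lambda>e. e \<in> L) [0..<j])" using I by (simp add: jr)
    show "test_time (Less (Reg ''j'') (Reg ''m'')) + 1 \<le> c \<and>
      wp (Branch (Equal (Elem ''live'' (Reg ''j'')) (Lit 0))
         Skip
         (Store ''tail_out'' (Reg ''m_out'') (Elem ''tail'' (Reg ''j''));;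
          Store ''head_out'' (Reg ''m_out'') (Elem ''head'' (Reg ''j''));;
          increment ''m_out'');;
        increment ''j'') I \<rho> (c - (test_time (Less (Reg ''j'') (Reg ''m'')) + 1))"
    proof (cases "j \<in> L")
      case True
      show ?thesis unfolding c using True j
        by (simp add: wp_simps wp_Branch_False C jr th)
          (rule fin, simp_all add: C C_def jr output_arcs_def flip: out)
    next
      case False
      show ?thesis unfolding c using False j
        by (simp add: wp_simps wp_Branch_True C jr th)
          (rule fin, simp_all add: C C_def jr output_arcs_def flip: out)
    qed
  qed
qed

end

context instance_data
begin

text \<open>The full cost is charged only to vertices with a nonempty list, that is, to ends of
  arcs; any other vertex costs a constant. The degree bounds of earlier targets persist because the
  live set only shrinks.\<close>

lemma wp_targets:
  assumes base: "base \<sigma>" "live_of {..<m} (arrs \<sigma> ''live'')"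
    and c: "R + 20 + 40 * n + target_cost * card {v. v < n \<and> prv v (M + M) \<noteq> 0} + 2 \<le> c"
    and Q: "\<And>\<tau> c' L. base \<tau> \<Longrightarrow> live_of L (arrs \<tau> ''live'') \<Longrightarrow> L \<subseteq> {..<m} \<Longrightarrow> preserves {..<m} L \<Longrightarrow>
      (\<And>v. v < n \<Longrightarrow> card {e \<in> L. hd e = v} \<le> lam * 2 ^ k) \<Longrightarrow> R \<le> c' \<Longrightarrow> Q \<tau> c'"
  shows "wp targets_prog Q \<sigma> c"
proof -
  let ?N = "\<lambda>t. {v. t \<le> v \<and> v < n \<and> prv v (M + M) \<noteq> 0}"
  define I where "I \<rho> c \<longleftrightarrow> base \<rho> \<and> regs \<rho> ''t'' \<le> n \<and> (\<exists>L. live_of L (arrs \<rho> ''live'') \<and> L \<subseteq> {..<m} \<and>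
    preserves {..<m} L \<and> (\<forall>v<regs \<rho> ''t''. card {e \<in> L. hd e = v} \<le> lam * 2 ^ k)) \<and>
    R + 20 + 40 * (n - regs \<rho> ''t'') + target_cost * card (?N (regs \<rho> ''t'')) \<le> c" for \<rho> :: mem and c
  show ?thesis
    unfolding targets_prog_def wp_simps
  proof (rule conjI[OF _ wp_Loop[where I = I]])
    show "expr_time (Lit 0) + 1 \<le> c" using c by simp
    have "I (set_reg ''t'' 0 \<sigma>) c'" if "c = c' + 2" for c'
      using base preserves_refl c that unfolding I_def by (auto intro!: exI[of _ "{..<m}"])
    moreover have "c = (c - 2) + 2" "2 \<le> c" using c by linarith+
    ultimately have "I (set_reg ''t'' 0 \<sigma>) (c - 2)" by blast
    then show "I (set_reg ''t'' (expr_val (Lit 0) \<sigma>) \<sigma>) (c - (expr_time (Lit 0) + 1))"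
      using \<open>2 \<le> c\<close> by (simp add: eval_nat_numeral)
  next
    fix \<rho> c assume "I \<rho> c" and b: "\<not> test_val (Less (Reg ''t'') (Reg ''n'')) \<rho>"
    note I = \<open>I \<rho> c\<close>[unfolded I_def]
    have t: "regs \<rho> ''t'' = n" using b I by (simp add: base_def)
    obtain L where L: "live_of L (arrs \<rho> ''live'')" "L \<subseteq> {..<m}"
      "preserves {..<m} L" "\<And>v. v < n \<Longrightarrow> card {e \<in> L. hd e = v} \<le> lam * 2 ^ k"
      using I unfolding t by blast
    have "R + 20 \<le> c" using I by linarith
    then show "test_time (Less (Reg ''t'') (Reg ''n'')) + 1 \<le> c \<and>
        Q \<rho> (c - (test_time (Less (Reg ''t'') (Reg ''n'')) + 1))"
      using I by (auto intro!: Q[OF _ L])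
  next
    fix \<rho> c assume "I \<rho> c" and b: "test_val (Less (Reg ''t'') (Reg ''n'')) \<rho>"
    note I = \<open>I \<rho> c\<close>[unfolded I_def]
    define t where "t = regs \<rho> ''t''"
    have tr: "regs \<rho> ''t'' = t" by (simp add: t_def)
    have t: "t < n" using b I by (simp add: tr base_def)
    interpret target_data n es s lam k t by unfold_locales (rule t)
    obtain L where L: "live_of L (arrs \<rho> ''live'')" "L \<subseteq> {..<m}"
      "preserves {..<m} L" "\<And>v. v < t \<Longrightarrow> card {e \<in> L. hd e = v} \<le> lam * 2 ^ k"
      using I unfolding tr by blast
    have base: "base \<rho>" using I by blast
    then have ctx: "ctx t (regs \<rho> ''i'') (arrs \<rho> ''live'') (arrs \<rho> ''r'') \<rho>" by (simp add: ctx_def tr)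
    have first: "arrs \<rho> ''first'' t = prv t (M + M)" using base t by (simp add: base_def)
    obtain d where d: "n - t = Suc d" using t by (metis Suc_diff_Suc)
    have d': "n - Suc t = d" using d by simp
    have cost: "R + 60 + 40 * d + target_cost * card (?N t) \<le> c" using I unfolding tr d by simp
    have step: "wp (increment ''t'') I \<tau> (4 + c')"
      if "base \<tau>" "regs \<tau> ''t'' = t" "live_of L' (arrs \<tau> ''live'')" "L' \<subseteq> L" "preserves L L'"
        "card {e \<in> L'. hd e = t} \<le> lam * 2 ^ k" "R + 20 + 40 * d + target_cost * card (?N (Suc t)) \<le> c'" for \<tau> c' L'
    proof -
      have "card {e \<in> L'. hd e = v} \<le> lam * 2 ^ k" if "v < Suc t" for v
      proof (cases "v = t")
        case False
        have "card {e \<in> L'. hd e = v} \<le> card {e \<in> L. hd e = v}"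
          using \<open>L' \<subseteq> L\<close> L(2) finite_subset[OF L(2)] by (intro card_mono) auto
        also have "\<dots> \<le> lam * 2 ^ k" using False \<open>v < Suc t\<close> by (intro L(4)) simp
        finally show ?thesis .
      qed (use \<open>card {e \<in> L'. hd e = t} \<le> _\<close> in simp)
      moreover have "L' \<subseteq> {..<m}" using \<open>L' \<subseteq> L\<close> L(2) by blast
      moreover have "preserves {..<m} L'" using preserves_trans[OF L(3) \<open>preserves L L'\<close>] .
      ultimately have "I (set_reg ''t'' (Suc t) \<tau>) c'"
        using that(1,3,7) t unfolding I_def by (auto simp: d')
      then show ?thesis using that(2) by (simp add: wp_simps)
    qed
    show "test_time (Less (Reg ''t'') (Reg ''n'')) + 1 \<le> c \<and>
      wp (Branch (Equal (Elem ''first'' (Reg ''t'')) (Lit 0)) Skip target_prog;; increment ''t'') I \<rho>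
        (c - (test_time (Less (Reg ''t'') (Reg ''n'')) + 1))"
    proof (cases "prv t (M + M) = 0")
      case True
      have none: "hd e \<noteq> t" if "e \<in> L" for e
      proof
        assume "hd e = t"
        moreover have "e < m" using that L(2) by auto
        ultimately have "e < M + M \<and> dst e = t" by (simp add: dst_def)
        with True show False using less_prv[of e t "M + M"] by simp
      qed
      then have "{e \<in> L. hd e = t} = {}" by blast
      then have "card {e \<in> L. hd e = t} \<le> lam * 2 ^ k" by (simp only: card.empty le0)
      moreover have "?N (Suc t) = ?N t" using True by (auto simp: Suc_le_eq le_less)
      then have "R + 20 + 40 * d + target_cost * card (?N (Suc t)) \<le> c - 14" and c: "c = (c - 14) + 14"
        using cost by simp_all
      ultimately have *: "wp (increment ''t'') I \<rho> (4 + (c - 14))"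
        using base tr L(1) preserves_refl[of L] by (intro step[of \<rho> L]) simp_all
      obtain c1 where c1: "c = c1 + 14" using c by metis
      show ?thesis
        using * unfolding c1 by (simp add: wp_Branch_True wp_Skip wp_Seq tr first[unfolded True])
    next
      case False
      have "?N t = insert t (?N (Suc t))" using False t by (auto simp: Suc_le_eq le_less)
      then have "card (?N t) = Suc (card (?N (Suc t)))" by simp
      then have *: "R + 20 + 40 * d + target_cost * card (?N (Suc t)) + 4 + target_cost \<le> c - 9" and c: "c = (c - 9) + 9"
        using cost by simp_all
      have "wp target_prog (wp (increment ''t'') I) \<rho> (c - 9)"
      proof (rule wp_target[OF ctx L(1,2) *])
        fix i r live' L' \<tau> c'
        assume a: "ctx t i live' r \<tau>" "live_of L' live'" "L' \<subseteq> L" "preserves L L'"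
          "card {e \<in> L'. hd e = t} \<le> lam * 2 ^ k" "R + 20 + 40 * d + target_cost * card (?N (Suc t)) + 4 \<le> c'"
        have "wp (increment ''t'') I \<tau> (4 + (c' - 4))"
          using a ctxD(1,2,4)[OF a(1)] by (intro step[of \<tau> L']) simp_all
        moreover have "4 + (c' - 4) = c'" using a(6) by linarith
        ultimately show "wp (increment ''t'') I \<tau> c'" by simp
      qed
      moreover obtain c1 where c1: "c = c1 + 9" using c by metis
      moreover have "arrs \<rho> ''first'' t \<noteq> 0" using first False by metis
      ultimately show ?thesis
        by (simp add: wp_Branch_False wp_Seq tr)
    qed
  qed
qed

text \<open>The number of processed targets is at most \<open>n\<close> and also at most
  \<open>M + M\<close>, hence at most \<open>4 * m\<close>. Using the second bound against the
  \<open>n\<close> in \<open>size\<close> and the first against \<open>M + M\<close> gives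
  \<open>8 * m * n\<close>. With \<open>k + 2\<close> at most \<open>2 * lam * 2 ^ k\<close> the
  targets cost \<open>200 * 8 * 3 = 4800\<close> units; 10000 leaves room for the rest.\<close>

lemma cost_bound:
  "20 + 40 * n + target_cost * card {v. v < n \<and> prv v (M + M) \<noteq> 0} + 500 * size \<le> 10000 * (lam * 2 ^ k * m * n)"
proof -
  let ?W = "card {v. v < n \<and> prv v (M + M) \<noteq> 0}" and ?X = "lam * 2 ^ k"
  have m: "1 \<le> m" using es_nonempty by (cases es) auto
  have n: "1 \<le> n" using s_bounded by simp
  have X: "k + 2 \<le> 2 * ?X" "1 \<le> ?X"
  proof -
    have "k < 2 ^ k" by (rule less_exp)
    moreover have "1 * 2 ^ k \<le> ?X" using lam_pos by (intro mult_right_mono) auto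
    ultimately show "k + 2 \<le> 2 * ?X" "1 \<le> ?X" using k_pos by linarith+
  qed
  have W1: "?W \<le> n" using card_mono[of "{..<n}" "{v. v < n \<and> prv v (M + M) \<noteq> 0}"] by auto
  have "v \<in> dst ` half_arcs" if "prv v (M + M) \<noteq> 0" for v
    using that by (rule_tac prv_cases[where v = v and p = "M + M"]) (auto simp: half_arcs_def)
  then have "?W \<le> card (dst ` half_arcs)" using finite_R by (intro card_mono) auto
  also have "\<dots> \<le> card half_arcs" using finite_R by (rule card_image_le)
  finally have W2: "?W \<le> 4 * m" using m by (simp add: half_arcs_def)
  have mn: "m \<le> m * n" "n \<le> m * n" using m n by simp_all
  have "size * ?W = n * ?W + (M + M) * ?W" by (simp add: size_def algebra_simps)
  also have "\<dots> \<le> n * (4 * m) + (4 * m) * n"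
    using W1 W2 m by (intro add_mono mult_mono) auto
  finally have "size * ?W \<le> 8 * (m * n)" by (simp add: mult.commute[of n m])
  then have "(size * ?W) * (?X + k + 2) \<le> (8 * (m * n)) * (3 * ?X)"
    by (rule mult_le_mono) (use X(1) in linarith)
  then have "target_cost * ?W \<le> 4800 * (?X * m * n)" by (simp add: algebra_simps)
  moreover have "m * n \<le> ?X * m * n" using X(2) by (simp add: mult.assoc)
  moreover have size: "size \<le> 5 * (m * n)" using mn m unfolding size_def by linarith
  have "20 + 40 * n + c + 500 * size \<le> 10000 * Y" if "c \<le> 4800 * Y" "m * n \<le> Y" for c Y
    using that mn m size by linarith
  ultimately show ?thesis by blast
qed

lemma wp_preserver:
  assumes Q: "\<And>\<tau> c' L. output_arcs \<tau> = map (nth es) (filter (\<lambda>e. e \<in> L) [0..<m]) \<Longrightarrow> L \<subseteq> {..<m} \<Longrightarrow>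
      preserves {..<m} L \<Longrightarrow> (\<And>v. v < n \<Longrightarrow> card {e \<in> L. hd e = v} \<le> lam * 2 ^ k) \<Longrightarrow> Q \<tau> c'"
  shows "wp preserver_prog Q (input_mem n es s lam k) (10000 * (lam * 2 ^ k * m * n))"
proof -
  let ?W = "target_cost * card {v. v < n \<and> prv v (M + M) \<noteq> 0}"
  let ?c = "10000 * (lam * 2 ^ k * m * n)"
  have m: "regs (input_mem n es s lam k) ''m'' \<noteq> 0" using es_nonempty by (simp add: input_mem_def)
  have "(100 * size + 20 + 40 * n + ?W + 2) + 300 * size \<le> ?c - 4" "4 \<le> ?c"
    using cost_bound size_ge by linarith+
  from this(1) have "wp (setup_prog;; targets_prog;; output_prog) Q (input_mem n es s lam k) (?c - 4)"
    unfolding wp_Seq[of setup_prog]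
  proof (rule wp_setup)
    fix \<tau> c' assume \<tau>: "base \<tau>" "live_of {..<m} (arrs \<tau> ''live'')" "100 * size + 20 + 40 * n + ?W + 2 \<le> c'"
    show "wp (targets_prog;; output_prog) Q \<tau> c'"
      unfolding wp_Seq by (rule wp_targets[OF \<tau>], rule wp_output[where R = 0]) (auto intro: Q)
  qed
  moreover have "wp preserver_prog Q (input_mem n es s lam k) c"
    if "wp (setup_prog;; targets_prog;; output_prog) Q (input_mem n es s lam k) (c - 4)" "4 \<le> c" for c
    using that m unfolding preserver_prog_def by (simp add: wp_Branch_False eval_nat_numeral)
  ultimately show ?thesis using \<open>4 \<le> ?c\<close> by blast
qed

section \<open>From cuts of the capped network to fault-tolerant flow preservation\<close>

definition graph :: "nat set \<Rightarrow> nat pair_pre_digraph" where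
  "graph L = \<lparr>pverts = {..<n}, parcs = nth es ` L\<rparr>"

abbreviation faulty :: "nat set \<Rightarrow> (nat \<times> nat) set \<Rightarrow> (nat, nat \<times> nat) pre_digraph" where
  "faulty L F \<equiv> del_arcs (with_proj (graph L)) F"

lemma nth_bounded: "e < m \<Longrightarrow> fst (es ! e) < n \<and> snd (es ! e) < n"
  using subsetD[OF es_bounded nth_mem[of e]] by (simp add: mem_Times_iff)

lemma faulty_fin_digraph:
  assumes "L \<subseteq> {..<m}"
  shows "fin_digraph (faulty L F)"
proof
  show "finite (verts (faulty L F))" "finite (arcs (faulty L F))"
    using finite_subset[OF assms] by (simp_all add: del_arcs_def graph_def)
qed (use assms nth_bounded in \<open>auto simp: del_arcs_def graph_def\<close>)

lemma cut_faulty: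
  assumes "L \<subseteq> {..<m}" "n \<in> X" "s \<in> X"
  shows "arcs.cut (arcs.off {e. e < m \<and> es ! e \<in> F} (wt L)) X = card (arc_cut (faulty L F) X)"
proof -
  let ?A = "{e \<in> L. es ! e \<notin> F \<and> fst (es ! e) \<in> X \<and> snd (es ! e) \<notin> X}"
  have sub: "?A \<subseteq> {..m}" using assms(1) by auto
  have "arcs.cut (arcs.off {e. e < m \<and> es ! e \<in> F} (wt L)) X = (\<Sum>e\<le>m. of_bool (e \<in> ?A))"
    unfolding arcs.cut_def
  proof (rule sum.cong[OF refl])
    fix e assume "e \<in> {..m}"
    then show "arcs.off {e. e < m \<and> es ! e \<in> F} (wt L) e * of_bool (arcs.crosses X e) = of_bool (e \<in> ?A)"
      using assms by (cases "e = m") (auto simp: arcs.off_def wt_def arcs.crosses_def tl_def hd_def)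
  qed
  also have "\<dots> = card ?A"
    using sub by (simp add: of_bool_def sum.If_cases Int_absorb1)
  also have "\<dots> = card (nth es ` ?A)"
    using assms(1) es_distinct by (intro card_image[symmetric] inj_onI) (auto simp: nth_eq_iff_index_eq subset_iff)
  also have "nth es ` ?A = arc_cut (faulty L F) X"
    by (auto simp: arc_cut_def del_arcs_def graph_def)
  finally show ?thesis .
qed

text \<open>Failures never affect the source arc, so a cut placed before \<open>s\<close> always has
  its full capacity. This is where the cap \<open>lam\<close> in the definition of a preserver comes
  from.\<close>

lemma cut_without_source:
  assumes "n \<in> X" "s \<notin> X"
  shows "lam \<le> arcs.cut (arcs.off {e. e < m \<and> P e} (wt L)) X"
proof -
  have "lam = arcs.off {e. e < m \<and> P e} (wt L) m * of_bool (arcs.crosses X m)"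
    using assms by (simp add: arcs.off_def wt_def arcs.crosses_def tl_def hd_def)
  also have "\<dots> \<le> arcs.cut (arcs.off {e. e < m \<and> P e} (wt L)) X"
    unfolding arcs.cut_def by (rule member_le_sum) auto
  finally show ?thesis .
qed

lemma preserves_ft_bfp:
  assumes L: "L \<subseteq> {..<m}" "preserves {..<m} L"
  shows "ft_bfp lam k (with_proj (graph {..<m})) s (with_proj (graph L))"
  unfolding ft_bfp_def
proof (intro conjI allI impI ballI)
  have "wf_digraph (with_proj (graph L'))" if "L' \<subseteq> {..<m}" for L'
    by unfold_locales (use that nth_bounded in \<open>auto simp: graph_def\<close>)
  then show "spanning (with_proj (graph L)) (with_proj (graph {..<m}))"
    using L(1) by (auto simp: spanning_def subgraph_def graph_def)
next
  fix F t assume F: "F \<subseteq> arcs (with_proj (graph {..<m})) \<and> finite F \<and> card F \<le> k"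
    and "t \<in> verts (with_proj (graph {..<m}))"
  then have t: "t < n" by (simp add: graph_def)
  let ?G = "faulty {..<m} F" and ?H = "faulty L F"
  interpret G: fin_digraph ?G by (rule faulty_fin_digraph) simp
  interpret H: fin_digraph ?H by (rule faulty_fin_digraph) (rule L(1))
  have s: "s \<in> verts ?G" "s \<in> verts ?H" using s_bounded by (simp_all add: del_arcs_def graph_def)
  \<comment> \<open>Both alternatives in the definition of a preserver follow from these two
    inequalities.\<close>
  have "max_flow ?H s t \<le> max_flow ?G s t \<and> min (real lam) (max_flow ?G s t) \<le> max_flow ?H s t"
  proof (cases "s = t")
    case True
    then show ?thesis using G.max_flow_self[OF s(1)] H.max_flow_self[OF s(2)] by simp
  next
    case False
    obtain X where X: "s \<in> X" "t \<notin> X" "card (arc_cut ?G X) \<le> max_flow ?G s t"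
      using G.min_cut_le_max_flow[OF s(1) False] by blast
    have "max_flow ?H s t \<le> card (arc_cut ?H X)" using H.max_flow_le_cut[OF s(2) X(1,2)] .
    also have "card (arc_cut ?H X) \<le> card (arc_cut ?G X)"
      using L(1) G.finite_arcs by (intro card_mono) (auto simp: arc_cut_def del_arcs_def graph_def)
    finally have le: "max_flow ?H s t \<le> max_flow ?G s t" using X(3) by linarith
    obtain Y where Y: "s \<in> Y" "t \<notin> Y" "card (arc_cut ?H Y) \<le> max_flow ?H s t"
      using H.min_cut_le_max_flow[OF s(2) False] by blast
    have "fst a \<noteq> n \<and> snd a \<noteq> n" if "a \<in> nth es ` L" for a
    proof -
      from that L(1) obtain e where "a = es ! e" "e < m" by auto
      then show ?thesis using nth_bounded[of e] by simp
    qed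
    \<comment> \<open>The extra source is no vertex of the graph, so it can be added to a cut at no
      cost; \<open>preserves\<close> expects it there.\<close>
    then have "arc_cut ?H (insert n Y) = arc_cut ?H Y"
      unfolding arc_cut_def by (intro Collect_cong) (auto simp: del_arcs_def graph_def)
    then have cut_H: "arcs.cut (arcs.off {e. e < m \<and> es ! e \<in> F} (wt L)) (insert n Y) \<le> max_flow ?H s t"
      using cut_faulty[of L "insert n Y" F] L(1) Y by simp
    \<comment> \<open>Failures are given as arcs but counted as indices; the arc list has no
      repetitions, so the count does not grow.\<close>
    have "card {e. e < m \<and> es ! e \<in> F} = card (nth es ` {e. e < m \<and> es ! e \<in> F})"
      using es_distinct by (intro card_image[symmetric] inj_onI) (auto simp: nth_eq_iff_index_eq)
    also have "\<dots> \<le> card F" using F by (intro card_mono) auto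
    finally have "card {e. e < m \<and> es ! e \<in> F} \<le> k" using F by simp
    moreover have "{e. e < m \<and> es ! e \<in> F} \<subseteq> {..<m}" by auto
    moreover have "t \<notin> insert n Y" using Y(2) t by simp
    ultimately obtain Z where Z: "n \<in> Z" "t \<notin> Z"
      "arcs.cut (arcs.off {e. e < m \<and> es ! e \<in> F} (wt {..<m})) Z \<le>
       arcs.cut (arcs.off {e. e < m \<and> es ! e \<in> F} (wt L)) (insert n Y)"
      using L(2) unfolding preserves_def by (meson insertI1)
    have "min (real lam) (max_flow ?G s t) \<le> arcs.cut (arcs.off {e. e < m \<and> es ! e \<in> F} (wt {..<m})) Z"
    proof (cases "s \<in> Z")
      case True
      then show ?thesis
        using G.max_flow_le_cut[OF s(1) True Z(2)] cut_faulty[of "{..<m}" Z F] Z(1) by simp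
    next
      case False
      then show ?thesis using cut_without_source[OF Z(1) False] by (simp add: min.coboundedI1)
    qed
    with Z(3) cut_H le show ?thesis by linarith
  qed
  then show "if max_flow ?G s t \<le> real lam then max_flow ?H s t = max_flow ?G s t else max_flow ?H s t \<ge> real lam"
    by auto
qed

lemma preserver_card:
  assumes "L \<subseteq> {..<m}" "\<And>v. v < n \<Longrightarrow> card {e \<in> L. hd e = v} \<le> lam * 2 ^ k"
  shows "card (parcs (graph L)) \<le> lam * 2 ^ k * n"
proof -
  have fin: "finite L" using finite_subset[OF assms(1)] by simp
  have "card (parcs (graph L)) \<le> card L" using fin by (simp add: graph_def card_image_le)
  also have "card L = card (\<Union>v<n. {e \<in> L. hd e = v})"
    using hd_less by (intro arg_cong[of _ _ card]) auto
  also have "\<dots> \<le> (\<Sum>v<n. card {e \<in> L. hd e = v})" by (rule card_UN_le) simp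
  also have "\<dots> \<le> (\<Sum>v<n. lam * 2 ^ k)" using assms(2) by (intro sum_mono) auto
  finally show ?thesis by (simp add: mult.commute)
qed

end

theorem theorem1:
  shows "\<exists>(p :: prog) (C :: nat).
    \<forall>(G :: nat pair_pre_digraph) n m es s lam k.
      pair_fin_digraph G \<longrightarrow> arc_list n es G \<longrightarrow> m = card (parcs G) \<longrightarrow> s \<in> pverts G \<longrightarrow>
      lam \<ge> 1 \<longrightarrow> k \<ge> 1 \<longrightarrow>
      (\<exists>T \<tau> (H :: nat pair_pre_digraph).
        run p (input_mem n es s lam k) T \<tau> \<and>
        T \<le> C * max 1 (lam * 2 ^ k * m * n) \<and>
        arc_list n (output_arcs \<tau>) H \<and>
        ft_bfp lam k (with_proj G) s (with_proj H) \<and>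
        card (parcs H) \<le> lam * 2 ^ k * n)"
proof (rule exI[of _ preserver_prog], rule exI[of _ 10000], intro allI impI)
  fix G :: "nat pair_pre_digraph" and n m :: nat and es and s lam k :: nat
  assume G: "pair_fin_digraph G" and es: "arc_list n es G" and m: "m = card (parcs G)"
    and s: "s \<in> pverts G" and lam: "lam \<ge> 1" and k: "k \<ge> 1"
  have G_eq: "G = \<lparr>pverts = {..<n}, parcs = set es\<rparr>" using es by (cases G) (simp add: arc_list_def)
  have m_eq: "m = length es" using es m distinct_card[of es] by (simp add: arc_list_def)
  show "\<exists>T \<tau> (H :: nat pair_pre_digraph).
        run preserver_prog (input_mem n es s lam k) T \<tau> \<and>
        T \<le> 10000 * max 1 (lam * 2 ^ k * m * n) \<and>
        arc_list n (output_arcs \<tau>) H \<and>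
        ft_bfp lam k (with_proj G) s (with_proj H) \<and>
        card (parcs H) \<le> lam * 2 ^ k * n"
  proof (cases "es = []")
    case True
    let ?\<sigma> = "input_mem n es s lam k"
    \<comment> \<open>Without arcs the product in the time bound is 0, so these constantly many
      steps are paid for by \<open>max 1\<close>. The output is empty and presents \<open>G\<close>
      itself.\<close>
    have "run preserver_prog ?\<sigma> (test_time (Equal (Reg ''m'') (Lit 0)) + 1 + 1) ?\<sigma>"
      unfolding preserver_prog_def using True by (intro run.branch_true run.skip) (simp add: input_mem_def)
    moreover have "arc_list n (output_arcs ?\<sigma>) G"
      using True by (simp add: G_eq arc_list_def output_arcs_def input_mem_def)
    moreover have "wf_digraph (with_proj G)" using True by unfold_locales (simp_all add: G_eq)
    then have "ft_bfp lam k (with_proj G) s (with_proj G)"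
      by (auto simp: ft_bfp_def spanning_def subgraph_def)
    ultimately show ?thesis
      using True by (intro exI[of _ "test_time (Equal (Reg ''m'') (Lit 0)) + 1 + 1"] exI[of _ ?\<sigma>] exI[of _ G])
        (simp add: G_eq)
  next
    case False
    interpret pair_fin_digraph G by (rule G)
    have "set es \<subseteq> {..<n} \<times> {..<n}"
      using in_arcsD1 in_arcsD2 by (auto simp: G_eq)
    then interpret instance_data n es s lam k
      using es False s lam k by unfold_locales (auto simp: arc_list_def)
    have G_graph: "G = graph {..<length es}"
      by (simp add: G_eq graph_def set_conv_nth) auto
    have "wp preserver_prog (\<lambda>\<tau> _. \<exists>H. arc_list n (output_arcs \<tau>) H \<and>
        ft_bfp lam k (with_proj G) s (with_proj H) \<and> card (parcs H) \<le> lam * 2 ^ k * n)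
        (input_mem n es s lam k) (10000 * (lam * 2 ^ k * length es * n))"
    proof (rule wp_preserver)
      fix \<tau> L assume L: "output_arcs \<tau> = map (nth es) (filter (\<lambda>e. e \<in> L) [0..<length es])" "L \<subseteq> {..<length es}"
        "preserves {..<length es} L" "\<And>v. v < n \<Longrightarrow> card {e \<in> L. hd e = v} \<le> lam * 2 ^ k"
      have "arc_list n (output_arcs \<tau>) (graph L)"
        using L(1,2) es_distinct
        by (auto simp: arc_list_def graph_def distinct_map nth_eq_iff_index_eq intro!: inj_onI)
      then show "\<exists>H. arc_list n (output_arcs \<tau>) H \<and>
        ft_bfp lam k (with_proj G) s (with_proj H) \<and> card (parcs H) \<le> lam * 2 ^ k * n"
        using preserves_ft_bfp[OF L(2,3)] preserver_card[OF L(2,4)] unfolding G_graph by blast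
    qed
    moreover have "10000 * (lam * 2 ^ k * length es * n) \<le> 10000 * max 1 (lam * 2 ^ k * m * n)"
      unfolding m_eq by (intro mult_le_mono2 max.cobounded2)
    ultimately show ?thesis unfolding wp_def using le_trans by blast
  qed
qed

end
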